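(* Let $G=(V,E)$, centralities, importances, $F$, $G_{2\text{-hop}}$, $H$ and the summaries $\mathcal{G}^t$ ($0\le t\le |H|$) be as in the context, and let $\tau\le 1$. The algorithm T-BUDS, which computes $H$ and outputs the summary $\mathcal{G}^{t^*}$ with $t^*=\max\{t\in\{0,\dots,|H|\}: u(\mathcal{G}^t)\ge\tau\}$, runs in time $O((|F|+|V|)\cdot\lg|V|)$ and uses $O(|V|)$ space (not counting the read-only input graph and the write-only output summary).
   Context: $G=(V,E)$ is a finite simple undirected graph with node centralities $(C_x)_{x\in V}$. Edge importances $C(u,v)>0$ for $\{u,v\}\in E$ sum to $1$; each non-adjacent distinct pair has spurious importance $C_s=1/(\binom{|V|}{2}-|E|)$. $F=\{\{a,c\}: a\neq c,\ \exists b \text{ with } \{a,b\},\{b,c\}\in E\}$, $G_{2\text{-hop}}=(V,F)$ weighted by $w(a,c)=C_a+C_c$, and $H=(h_1,\dots,h_{|H|})$ is the list of edges of a minimum spanning forest of $G_{2\text{-hop}}$ sorted in nondecreasing weight. $P_0$ is the partition into singletons and $P_t$ is obtained from $P_{t-1}$ by merging the parts containing the endpoints of $h_t$. For a partition and parts $X,Y$ (possibly equal), $\mathrm{nSedge}(X,Y)$ is the sum of $C$ over edges of $G$ between $X$ and $Y$ (inside $X$ if $X=Y$) and $\mathrm{Sedge}(X,Y)$ the sum of $C_s$ over non-adjacent such pairs. The summary $\mathcal{G}^t$ of $P_t$ has superedge $\{X,Y\}$ iff some edge of $G$ joins $X$ and $Y$ and $\mathrm{Sedge}(X,Y)\le\mathrm{nSedge}(X,Y)$;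 its utility is $u(\mathcal{G}^t)=\sum_{\text{superedges}}(\mathrm{nSedge}-\mathrm{Sedge})$. *)

theory Defs
  imports Complex_Main
begin

section \<open>Graphs, two-hop forests and summaries\<close>

text \<open>A graph is a vertex set together with a set of two-element vertex sets.\<close>

definition simple_graph :: "'a set \<Rightarrow> 'a set set \<Rightarrow> bool" where
  "simple_graph V E \<longleftrightarrow> finite V \<and> E \<subseteq> {{u, v} |u v. u \<in> V \<and> v \<in> V \<and> u \<noteq> v}"

definition importances :: "'a set set \<Rightarrow> ('a set \<Rightarrow> real) \<Rightarrow> bool" where
  "importances E C \<longleftrightarrow> (\<forall>e\<in>E. C e > 0) \<and> (\<Sum>e\<in>E. C e) = 1"

text \<open>If the graph is complete the quotient is \<open>1 / 0 = 0\<close>, but then there is no spurious pair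
  to which it could be applied.\<close>

definition spurious_importance :: "'a set \<Rightarrow> 'a set set \<Rightarrow> real" where
  "spurious_importance V E = 1 / (real (card V choose 2) - real (card E))"

definition two_hop :: "'a set set \<Rightarrow> 'a set set" where
  "two_hop E = {{a, c} |a c. a \<noteq> c \<and> (\<exists>b. {a, b} \<in> E \<and> {b, c} \<in> E)}"

definition weight :: "('a \<Rightarrow> real) \<Rightarrow> 'a set \<Rightarrow> real" where
  "weight cen e = (\<Sum>x\<in>e. cen x)"

definition cycle :: "'a set set \<Rightarrow> 'a list \<Rightarrow> bool" where
  "cycle T p \<longleftrightarrow> length p \<ge> 3 \<and> distinct p \<and>
     (\<forall>i < length p. {p ! i, p ! (Suc i mod length p)} \<in> T)"

definition linked :: "'a set set \<Rightarrow> ('a \<times> 'a) set" where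
  "linked T = {(x, y). {x, y} \<in> T}\<^sup>*"

text \<open>Isolated vertices belong to every spanning forest and need not be mentioned.\<close>

definition spanning_forest :: "'a set set \<Rightarrow> 'a set set \<Rightarrow> bool" where
  "spanning_forest F T \<longleftrightarrow> T \<subseteq> F \<and> (\<nexists>p. cycle T p) \<and> linked T = linked F"

definition min_spanning_forest :: "('a set \<Rightarrow> real) \<Rightarrow> 'a set set \<Rightarrow> 'a set set \<Rightarrow> bool" where
  "min_spanning_forest w F T \<longleftrightarrow> spanning_forest F T \<and>
     (\<forall>T'. spanning_forest F T' \<longrightarrow> (\<Sum>e\<in>T. w e) \<le> (\<Sum>e\<in>T'. w e))"

definition sorted_msf :: "'a set set \<Rightarrow> ('a \<Rightarrow> real) \<Rightarrow> 'a set list \<Rightarrow> bool" where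
  "sorted_msf E cen H \<longleftrightarrow> distinct H \<and> sorted (map (weight cen) H) \<and>
     min_spanning_forest (weight cen) (two_hop E) (set H)"

definition merge_along :: "'a set set \<Rightarrow> 'a set \<Rightarrow> 'a set set" where
  "merge_along P h = insert (\<Union>{X \<in> P. X \<inter> h \<noteq> {}}) {X \<in> P. X \<inter> h = {}}"

definition partition_at :: "'a set \<Rightarrow> 'a set list \<Rightarrow> nat \<Rightarrow> 'a set set" where
  "partition_at V H t = foldl merge_along ((\<lambda>x. {x}) ` V) (take t H)"

definition pairs_between :: "'a set \<Rightarrow> 'a set \<Rightarrow> 'a set set" where
  "pairs_between X Y = {{x, y} |x y. x \<in> X \<and> y \<in> Y \<and> x \<noteq> y}"

definition nSedge :: "'a set set \<Rightarrow> ('a set \<Rightarrow> real) \<Rightarrow> 'a set \<Rightarrow> 'a set \<Rightarrow> real" where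
  "nSedge E C X Y = (\<Sum>e \<in> pairs_between X Y \<inter> E. C e)"

definition Sedge :: "'a set \<Rightarrow> 'a set set \<Rightarrow> 'a set \<Rightarrow> 'a set \<Rightarrow> real" where
  "Sedge V E X Y = (\<Sum>e \<in> pairs_between X Y - E. spurious_importance V E)"

text \<open>A superedge is the set of its one or two end parts; \<open>{X, X} = {X}\<close> is a loop.\<close>

definition superedges ::
  "'a set \<Rightarrow> 'a set set \<Rightarrow> ('a set \<Rightarrow> real) \<Rightarrow> 'a set set \<Rightarrow> 'a set set set" where
  "superedges V E C P = {{X, Y} |X Y. X \<in> P \<and> Y \<in> P \<and> pairs_between X Y \<inter> E \<noteq> {} \<and>
     Sedge V E X Y \<le> nSedge E C X Y}"

text \<open>\<open>nSedge\<close> and \<open>Sedge\<close> are symmetric, so the two choices of \<open>(X, Y)\<close> for a superedge agree.\<close>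

definition utility :: "'a set \<Rightarrow> 'a set set \<Rightarrow> ('a set \<Rightarrow> real) \<Rightarrow> 'a set set \<Rightarrow> real" where
  "utility V E C P = (\<Sum>S \<in> superedges V E C P.
     let (X, Y) = (SOME (X, Y). S = {X, Y}) in nSedge E C X Y - Sedge V E X Y)"

definition t_star ::
  "'a set \<Rightarrow> 'a set set \<Rightarrow> ('a set \<Rightarrow> real) \<Rightarrow> 'a set list \<Rightarrow> real \<Rightarrow> nat" where
  "t_star V E C H \<tau> = Max {t \<in> {0..length H}. utility V E C (partition_at V H t) \<ge> \<tau>}"

type_synonym 'a summary = "'a set set \<times> 'a set set set"

definition summary_at ::
  "'a set \<Rightarrow> 'a set set \<Rightarrow> ('a set \<Rightarrow> real) \<Rightarrow> 'a set list \<Rightarrow> nat \<Rightarrow> 'a summary" where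
  "summary_at V E C H t = (partition_at V H t, superedges V E C (partition_at V H t))"


section \<open>Machine model\<close>

text \<open>
  Programs run on a real RAM. It has a read-only input (arrays of naturals and of reals), a work
  memory (scalars and arrays of naturals and of reals) and a write-only output tape. Every operator,
  memory access and command costs one time unit; allocating an array of length \<open>k\<close> costs
  \<open>k\<close> extra units. Reads and writes outside array bounds and divisions by zero block execution.
\<close>

type_synonym name = string

record input =
  nat_in :: "name \<Rightarrow> nat list"
  real_in :: "name \<Rightarrow> real list"

record store =
  nat_var :: "name \<Rightarrow> nat"
  real_var :: "name \<Rightarrow> real"
  nat_arr :: "name \<Rightarrow> nat list"
  real_arr :: "name \<Rightarrow> real list"
  tape :: "nat list"
  allocated :: nat

definition initial :: store where
  "initial = \<lparr>nat_var = (\<lambda>_. 0), real_var = (\<lambda>_. 0), nat_arr = (\<lambda>_. []), real_arr = (\<lambda>_. []),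
     tape = [], allocated = 0\<rparr>"

datatype nexp =
    Lit nat
  | Var name
  | Arr name nexp
  | In name nexp
  | Plus nexp nexp (infixl "\<oplus>" 65)
  | Minus nexp nexp (infixl "\<ominus>" 65)
  | Times nexp nexp (infixl "\<otimes>" 70)
  | Div nexp nexp (infixl "\<oslash>" 70)
  | Mod nexp nexp (infixl "\<odot>" 70)

datatype rexp =
    OfNat nexp
  | RVar name
  | RArr name nexp
  | RIn name nexp
  | RPlus rexp rexp (infixl "\<oplus>\<^sub>r" 65)
  | RMinus rexp rexp (infixl "\<ominus>\<^sub>r" 65)
  | RTimes rexp rexp (infixl "\<otimes>\<^sub>r" 70)
  | RDiv rexp rexp (infixl "\<oslash>\<^sub>r" 70)

datatype bexp =
    NLess nexp nexp
  | NLeq nexp nexp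
  | NEq nexp nexp
  | RLeq rexp rexp
  | BNot bexp
  | BAnd bexp bexp
  | BOr bexp bexp

datatype com =
    Skip
  | Assign name nexp ("_ ::= _" [1000, 61] 61)
  | RAssign name rexp ("_ ::=\<^sub>r _" [1000, 61] 61)
  | Store name nexp nexp
  | RStore name nexp rexp
  | Alloc name nexp
  | RAlloc name nexp
  | Emit nexp
  | Seq com com (infixr ";;" 60)
  | Cond bexp com com
  | While bexp com

fun nval :: "input \<Rightarrow> store \<Rightarrow> nexp \<Rightarrow> nat" where
  "nval I s (Lit k) = k"
| "nval I s (Var x) = nat_var s x"
| "nval I s (Arr a e) = nat_arr s a ! nval I s e"
| "nval I s (In a e) = nat_in I a ! nval I s e"
| "nval I s (d \<oplus> e) = nval I s d + nval I s e"
| "nval I s (d \<ominus> e) = nval I s d - nval I s e"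
| "nval I s (d \<otimes> e) = nval I s d * nval I s e"
| "nval I s (d \<oslash> e) = nval I s d div nval I s e"
| "nval I s (d \<odot> e) = nval I s d mod nval I s e"

fun nsafe :: "input \<Rightarrow> store \<Rightarrow> nexp \<Rightarrow> bool" where
  "nsafe I s (Lit k) = True"
| "nsafe I s (Var x) = True"
| "nsafe I s (Arr a e) = (nsafe I s e \<and> nval I s e < length (nat_arr s a))"
| "nsafe I s (In a e) = (nsafe I s e \<and> nval I s e < length (nat_in I a))"
| "nsafe I s (d \<oplus> e) = (nsafe I s d \<and> nsafe I s e)"
| "nsafe I s (d \<ominus> e) = (nsafe I s d \<and> nsafe I s e)"
| "nsafe I s (d \<otimes> e) = (nsafe I s d \<and> nsafe I s e)"
| "nsafe I s (d \<oslash> e) = (nsafe I s d \<and> nsafe I s e \<and> nval I s e \<noteq> 0)"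
| "nsafe I s (d \<odot> e) = (nsafe I s d \<and> nsafe I s e \<and> nval I s e \<noteq> 0)"

fun ncost :: "nexp \<Rightarrow> nat" where
  "ncost (Lit k) = 1"
| "ncost (Var x) = 1"
| "ncost (Arr a e) = 1 + ncost e"
| "ncost (In a e) = 1 + ncost e"
| "ncost (d \<oplus> e) = 1 + ncost d + ncost e"
| "ncost (d \<ominus> e) = 1 + ncost d + ncost e"
| "ncost (d \<otimes> e) = 1 + ncost d + ncost e"
| "ncost (d \<oslash> e) = 1 + ncost d + ncost e"
| "ncost (d \<odot> e) = 1 + ncost d + ncost e"

fun rval :: "input \<Rightarrow> store \<Rightarrow> rexp \<Rightarrow> real" where
  "rval I s (OfNat e) = real (nval I s e)"
| "rval I s (RVar x) = real_var s x"
| "rval I s (RArr a e) = real_arr s a ! nval I s e"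
| "rval I s (RIn a e) = real_in I a ! nval I s e"
| "rval I s (d \<oplus>\<^sub>r e) = rval I s d + rval I s e"
| "rval I s (d \<ominus>\<^sub>r e) = rval I s d - rval I s e"
| "rval I s (d \<otimes>\<^sub>r e) = rval I s d * rval I s e"
| "rval I s (d \<oslash>\<^sub>r e) = rval I s d / rval I s e"

fun rsafe :: "input \<Rightarrow> store \<Rightarrow> rexp \<Rightarrow> bool" where
  "rsafe I s (OfNat e) = nsafe I s e"
| "rsafe I s (RVar x) = True"
| "rsafe I s (RArr a e) = (nsafe I s e \<and> nval I s e < length (real_arr s a))"
| "rsafe I s (RIn a e) = (nsafe I s e \<and> nval I s e < length (real_in I a))"
| "rsafe I s (d \<oplus>\<^sub>r e) = (rsafe I s d \<and> rsafe I s e)"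
| "rsafe I s (d \<ominus>\<^sub>r e) = (rsafe I s d \<and> rsafe I s e)"
| "rsafe I s (d \<otimes>\<^sub>r e) = (rsafe I s d \<and> rsafe I s e)"
| "rsafe I s (d \<oslash>\<^sub>r e) = (rsafe I s d \<and> rsafe I s e \<and> rval I s e \<noteq> 0)"

fun rcost :: "rexp \<Rightarrow> nat" where
  "rcost (OfNat e) = 1 + ncost e"
| "rcost (RVar x) = 1"
| "rcost (RArr a e) = 1 + ncost e"
| "rcost (RIn a e) = 1 + ncost e"
| "rcost (d \<oplus>\<^sub>r e) = 1 + rcost d + rcost e"
| "rcost (d \<ominus>\<^sub>r e) = 1 + rcost d + rcost e"
| "rcost (d \<otimes>\<^sub>r e) = 1 + rcost d + rcost e"
| "rcost (d \<oslash>\<^sub>r e) = 1 + rcost d + rcost e"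

fun bval :: "input \<Rightarrow> store \<Rightarrow> bexp \<Rightarrow> bool" where
  "bval I s (NLess d e) = (nval I s d < nval I s e)"
| "bval I s (NLeq d e) = (nval I s d \<le> nval I s e)"
| "bval I s (NEq d e) = (nval I s d = nval I s e)"
| "bval I s (RLeq d e) = (rval I s d \<le> rval I s e)"
| "bval I s (BNot b) = (\<not> bval I s b)"
| "bval I s (BAnd a b) = (bval I s a \<and> bval I s b)"
| "bval I s (BOr a b) = (bval I s a \<or> bval I s b)"

text \<open>Conjunction and disjunction are evaluated from the left, skipping an irrelevant second
  argument (which is charged nevertheless).\<close>

fun bsafe :: "input \<Rightarrow> store \<Rightarrow> bexp \<Rightarrow> bool" where
  "bsafe I s (NLess d e) = (nsafe I s d \<and> nsafe I s e)"
| "bsafe I s (NLeq d e) = (nsafe I s d \<and> nsafe I s e)"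
| "bsafe I s (NEq d e) = (nsafe I s d \<and> nsafe I s e)"
| "bsafe I s (RLeq d e) = (rsafe I s d \<and> rsafe I s e)"
| "bsafe I s (BNot b) = bsafe I s b"
| "bsafe I s (BAnd a b) = (bsafe I s a \<and> (bval I s a \<longrightarrow> bsafe I s b))"
| "bsafe I s (BOr a b) = (bsafe I s a \<and> (\<not> bval I s a \<longrightarrow> bsafe I s b))"

fun bcost :: "bexp \<Rightarrow> nat" where
  "bcost (NLess d e) = 1 + ncost d + ncost e"
| "bcost (NLeq d e) = 1 + ncost d + ncost e"
| "bcost (NEq d e) = 1 + ncost d + ncost e"
| "bcost (RLeq d e) = 1 + rcost d + rcost e"
| "bcost (BNot b) = 1 + bcost b"
| "bcost (BAnd a b) = 1 + bcost a + bcost b"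
| "bcost (BOr a b) = 1 + bcost a + bcost b"

text \<open>\<open>exec I c s t s'\<close>: started in store \<open>s\<close> on input \<open>I\<close>, the command \<open>c\<close> terminates without
  blocking after \<open>t\<close> time units in store \<open>s'\<close>. The language is deterministic. Array memory is
  never released: \<open>allocated\<close> sums the lengths of all arrays ever allocated, and so bounds the array
  space in use at every moment of the run.\<close>

inductive exec :: "input \<Rightarrow> com \<Rightarrow> store \<Rightarrow> nat \<Rightarrow> store \<Rightarrow> bool" for I :: input where
  Skip: "exec I Skip s 1 s"
| Assign: "nsafe I s e \<Longrightarrow>
    exec I (x ::= e) s (1 + ncost e) (s\<lparr>nat_var := (nat_var s)(x := nval I s e)\<rparr>)"
| RAssign: "rsafe I s e \<Longrightarrow>
    exec I (x ::=\<^sub>r e) s (1 + rcost e) (s\<lparr>real_var := (real_var s)(x := rval I s e)\<rparr>)"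
| Store: "nsafe I s d \<Longrightarrow> nsafe I s e \<Longrightarrow> nval I s d < length (nat_arr s a) \<Longrightarrow>
    exec I (Store a d e) s (1 + ncost d + ncost e)
      (s\<lparr>nat_arr := (nat_arr s)(a := (nat_arr s a)[nval I s d := nval I s e])\<rparr>)"
| RStore: "nsafe I s d \<Longrightarrow> rsafe I s e \<Longrightarrow> nval I s d < length (real_arr s a) \<Longrightarrow>
    exec I (RStore a d e) s (1 + ncost d + rcost e)
      (s\<lparr>real_arr := (real_arr s)(a := (real_arr s a)[nval I s d := rval I s e])\<rparr>)"
| Alloc: "nsafe I s e \<Longrightarrow>
    exec I (Alloc a e) s (1 + ncost e + nval I s e)
      (s\<lparr>nat_arr := (nat_arr s)(a := replicate (nval I s e) 0),
         allocated := allocated s + nval I s e\<rparr>)"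
| RAlloc: "nsafe I s e \<Longrightarrow>
    exec I (RAlloc a e) s (1 + ncost e + nval I s e)
      (s\<lparr>real_arr := (real_arr s)(a := replicate (nval I s e) 0),
         allocated := allocated s + nval I s e\<rparr>)"
| Emit: "nsafe I s e \<Longrightarrow>
    exec I (Emit e) s (1 + ncost e) (s\<lparr>tape := tape s @ [nval I s e]\<rparr>)"
| Seq: "exec I c s t s' \<Longrightarrow> exec I d s' t' s'' \<Longrightarrow> exec I (c ;; d) s (t + t') s''"
| CondTrue: "bsafe I s b \<Longrightarrow> bval I s b \<Longrightarrow> exec I c s t s' \<Longrightarrow>
    exec I (Cond b c d) s (1 + bcost b + t) s'"
| CondFalse: "bsafe I s b \<Longrightarrow> \<not> bval I s b \<Longrightarrow> exec I d s t s' \<Longrightarrow>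
    exec I (Cond b c d) s (1 + bcost b + t) s'"
| WhileFalse: "bsafe I s b \<Longrightarrow> \<not> bval I s b \<Longrightarrow> exec I (While b c) s (1 + bcost b) s"
| WhileTrue: "bsafe I s b \<Longrightarrow> bval I s b \<Longrightarrow> exec I c s t s' \<Longrightarrow> exec I (While b c) s' t' s'' \<Longrightarrow>
    exec I (While b c) s (1 + bcost b + t + t') s''"

fun scalars :: "com \<Rightarrow> name set" where
  "scalars (x ::= e) = {x}"
| "scalars (x ::=\<^sub>r e) = {x}"
| "scalars (c ;; d) = scalars c \<union> scalars d"
| "scalars (Cond b c d) = scalars c \<union> scalars d"
| "scalars (While b c) = scalars c"
| "scalars _ = {}"

text \<open>Words of work memory occupied by a run of \<open>c\<close> ending in store \<open>s\<close>. A name may denote both a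
  scalar of type \<^typ>\<open>nat\<close> and one of type \<^typ>\<open>real\<close>, hence the factor.\<close>

definition space :: "com \<Rightarrow> store \<Rightarrow> nat" where
  "space c s = 2 * card (scalars c) + allocated s"


section \<open>The algorithm T-BUDS\<close>

definition For :: "name \<Rightarrow> nexp \<Rightarrow> nexp \<Rightarrow> com \<Rightarrow> com" where
  "For x l h c = x ::= l ;; While (NLess (Var x) h) (c ;; x ::= Var x \<oplus> Lit 1)"

abbreviation "N \<equiv> In ''n'' (Lit 0)"

text \<open>The pair \<open>(u, v)\<close> of vertices is coded by \<open>u * n + v\<close>.\<close>

definition key :: "nexp \<Rightarrow> rexp" where
  "key e = RIn ''cen'' (e \<oslash> N) \<oplus>\<^sub>r RIn ''cen'' (e \<odot> N)"

text \<open>Bottom-up merge sort of the first \<open>cnt\<close> entries of \<open>buf\<close> by weight.\<close>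

definition take_from :: "name \<Rightarrow> com" where
  "take_from i = Store ''tmp'' (Var ''k'') (Arr ''buf'' (Var i)) ;; i ::= Var i \<oplus> Lit 1"

definition merge_runs :: com where
  "merge_runs =
    ''mid'' ::= Var ''lo'' \<oplus> Var ''w'' ;;
    Cond (NLess (Var ''cnt'') (Var ''mid'')) (''mid'' ::= Var ''cnt'') Skip ;;
    ''hi'' ::= Var ''lo'' \<oplus> Var ''w'' \<oplus> Var ''w'' ;;
    Cond (NLess (Var ''cnt'') (Var ''hi'')) (''hi'' ::= Var ''cnt'') Skip ;;
    ''i'' ::= Var ''lo'' ;;
    ''j'' ::= Var ''mid'' ;;
    For ''k'' (Var ''lo'') (Var ''hi'')
      (Cond (BAnd (NLess (Var ''i'') (Var ''mid''))
               (BOr (NLeq (Var ''hi'') (Var ''j''))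
                 (RLeq (key (Arr ''buf'' (Var ''i''))) (key (Arr ''buf'' (Var ''j''))))))
         (take_from ''i'')
         (take_from ''j''))"

definition sort_buffer :: com where
  "sort_buffer =
    ''w'' ::= Lit 1 ;;
    While (NLess (Var ''w'') (Var ''cnt''))
     (''lo'' ::= Lit 0 ;;
      While (NLess (Var ''lo'') (Var ''cnt'')) (merge_runs ;; ''lo'' ::= Var ''hi'') ;;
      For ''k'' (Lit 0) (Var ''cnt'') (Store ''buf'' (Var ''k'') (Arr ''tmp'' (Var ''k''))) ;;
      ''w'' ::= Var ''w'' \<oplus> Var ''w'')"

text \<open>Kruskal's algorithm on the first \<open>cnt\<close> entries of \<open>buf\<close>, with union by size. The accepted
  edges, in nondecreasing weight, replace the contents of the buffer; for the \<open>i\<close>-th of them the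
  root \<open>child ! i\<close> was linked below the root \<open>parent ! i\<close>.\<close>

definition find_root :: "name \<Rightarrow> com" where
  "find_root x =
    While (BNot (NEq (Arr ''up'' (Var x)) (Var x))) (x ::= Arr ''up'' (Var x))"

definition kruskal :: com where
  "kruskal =
    sort_buffer ;;
    For ''x'' (Lit 0) N
     (Store ''up'' (Var ''x'') (Var ''x'') ;; Store ''rank'' (Var ''x'') (Lit 1)) ;;
    ''acc'' ::= Lit 0 ;;
    For ''i'' (Lit 0) (Var ''cnt'')
     (''e'' ::= Arr ''buf'' (Var ''i'') ;;
      ''x'' ::= Var ''e'' \<oslash> N ;; find_root ''x'' ;;
      ''y'' ::= Var ''e'' \<odot> N ;; find_root ''y'' ;;
      Cond (NEq (Var ''x'') (Var ''y'')) Skip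
       (Cond (NLess (Arr ''rank'' (Var ''y'')) (Arr ''rank'' (Var ''x'')))
          (''z'' ::= Var ''x'' ;; ''x'' ::= Var ''y'' ;; ''y'' ::= Var ''z'') Skip ;;
        Store ''up'' (Var ''x'') (Var ''y'') ;;
        Store ''rank'' (Var ''y'') (Arr ''rank'' (Var ''y'') \<oplus> Arr ''rank'' (Var ''x'')) ;;
        Store ''child'' (Var ''acc'') (Var ''x'') ;;
        Store ''parent'' (Var ''acc'') (Var ''y'') ;;
        Store ''buf'' (Var ''acc'') (Var ''e'') ;;
        ''acc'' ::= Var ''acc'' \<oplus> Lit 1)) ;;
    ''cnt'' ::= Var ''acc''"

text \<open>
  The two-hop edges with common neighbour \<open>b\<close> form a clique on the neighbours of \<open>b\<close>, and as the
  weight of \<open>{a, c}\<close> is the sum of two centralities, the star at a neighbour \<open>m\<close> of least centrality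
  is a minimum spanning tree of that clique. The edges of these stars are streamed into a buffer of
  length \<open>2 n\<close>; whenever it is full it is reduced to a minimum spanning forest of its contents. So
  neither \<open>F\<close> nor the candidate edges are ever stored. In the end \<open>H\<close> is the list of the first
  \<open>cnt\<close> entries of the buffer.
\<close>

definition build_H :: com where
  "build_H =
    ''cnt'' ::= Lit 0 ;;
    For ''b'' (Lit 0) N
     (''first'' ::= In ''off'' (Var ''b'') ;;
      ''last'' ::= In ''off'' (Var ''b'' \<oplus> Lit 1) ;;
      Cond (NLess (Var ''first'') (Var ''last''))
       (''m'' ::= In ''adj'' (Var ''first'') ;;
        For ''p'' (Var ''first'') (Var ''last'')
         (Cond (RLeq (RIn ''cen'' (Var ''m'')) (RIn ''cen'' (In ''adj'' (Var ''p'')))) Skip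
            (''m'' ::= In ''adj'' (Var ''p''))) ;;
        For ''p'' (Var ''first'') (Var ''last'')
         (''c'' ::= In ''adj'' (Var ''p'') ;;
          Cond (NEq (Var ''c'') (Var ''m'')) Skip
           (Cond (NEq (Var ''cnt'') (Lit 2 \<otimes> N)) kruskal Skip ;;
            Store ''buf'' (Var ''cnt'') (Var ''m'' \<otimes> N \<oplus> Var ''c'') ;;
            ''cnt'' ::= Var ''cnt'' \<oplus> Lit 1)))
       Skip) ;;
    kruskal"

text \<open>Computes in \<open>rep\<close> a representative for the part of each vertex in the partition after \<open>t\<close>
  merges. Only roots are linked below roots, so going through the links backwards meets every parent
  before its children.\<close>

definition build_partition :: "name \<Rightarrow> com" where
  "build_partition t =
    For ''x'' (Lit 0) N (Store ''rep'' (Var ''x'') (Var ''x'')) ;;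
    ''i'' ::= Var t ;;
    While (NLess (Lit 0) (Var ''i''))
     (''i'' ::= Var ''i'' \<ominus> Lit 1 ;;
      Store ''rep'' (Arr ''child'' (Var ''i'')) (Arr ''rep'' (Arr ''parent'' (Var ''i''))))"

text \<open>
  Performs \<open>act\<close> once for each superedge of the partition in \<open>rep\<close>, with the representatives of its
  end parts in \<open>r\<close> and \<open>q\<close> and with \<open>nSedge\<close> and \<open>Sedge\<close> in \<open>ns\<close> and \<open>se\<close>. The members of each part
  are chained in a linked list (\<open>n\<close> is the null pointer). While part \<open>r\<close> is processed, \<open>edges ! q\<close>
  and \<open>import ! q\<close> collect number and total importance of the edges into part \<open>q\<close>, where
  edges inside part \<open>r\<close> are met twice.
\<close>

definition scan_superedges :: "com \<Rightarrow> com" where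
  "scan_superedges act =
    For ''x'' (Lit 0) N
     (Store ''head'' (Var ''x'') N ;;
      Store ''size'' (Var ''x'') (Lit 0) ;;
      Store ''edges'' (Var ''x'') (Lit 0) ;;
      RStore ''import'' (Var ''x'') (OfNat (Lit 0))) ;;
    For ''x'' (Lit 0) N
     (''r'' ::= Arr ''rep'' (Var ''x'') ;;
      Store ''next'' (Var ''x'') (Arr ''head'' (Var ''r'')) ;;
      Store ''head'' (Var ''r'') (Var ''x'') ;;
      Store ''size'' (Var ''r'') (Arr ''size'' (Var ''r'') \<oplus> Lit 1)) ;;
    For ''r'' (Lit 0) N
     (''touched'' ::= Lit 0 ;;
      ''x'' ::= Arr ''head'' (Var ''r'') ;;
      While (BNot (NEq (Var ''x'') N))
       (For ''p'' (In ''off'' (Var ''x'')) (In ''off'' (Var ''x'' \<oplus> Lit 1))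
         (''q'' ::= Arr ''rep'' (In ''adj'' (Var ''p'')) ;;
          Cond (NEq (Arr ''edges'' (Var ''q'')) (Lit 0))
           (Store ''stack'' (Var ''touched'') (Var ''q'') ;;
            ''touched'' ::= Var ''touched'' \<oplus> Lit 1)
           Skip ;;
          Store ''edges'' (Var ''q'') (Arr ''edges'' (Var ''q'') \<oplus> Lit 1) ;;
          RStore ''import'' (Var ''q'')
            (RArr ''import'' (Var ''q'') \<oplus>\<^sub>r RIn ''imp'' (Var ''p''))) ;;
        ''x'' ::= Arr ''next'' (Var ''x'')) ;;
      While (NLess (Lit 0) (Var ''touched''))
       (''touched'' ::= Var ''touched'' \<ominus> Lit 1 ;;
        ''q'' ::= Arr ''stack'' (Var ''touched'') ;;
        Cond (NLeq (Var ''r'') (Var ''q''))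
         (Cond (NEq (Var ''r'') (Var ''q''))
           (''ns'' ::=\<^sub>r RArr ''import'' (Var ''r'') \<oslash>\<^sub>r OfNat (Lit 2) ;;
            ''se'' ::=\<^sub>r RVar ''cs'' \<otimes>\<^sub>r
              OfNat (Arr ''size'' (Var ''r'') \<otimes> (Arr ''size'' (Var ''r'') \<ominus> Lit 1)
                \<ominus> Arr ''edges'' (Var ''r'')) \<oslash>\<^sub>r OfNat (Lit 2))
           (''ns'' ::=\<^sub>r RArr ''import'' (Var ''q'') ;;
            ''se'' ::=\<^sub>r RVar ''cs'' \<otimes>\<^sub>r
              OfNat (Arr ''size'' (Var ''r'') \<otimes> Arr ''size'' (Var ''q'')
                \<ominus> Arr ''edges'' (Var ''q''))) ;;
          Cond (RLeq (RVar ''se'') (RVar ''ns'')) act Skip)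
         Skip ;;
        Store ''edges'' (Var ''q'') (Lit 0) ;;
        RStore ''import'' (Var ''q'') (OfNat (Lit 0))))"

definition compute_utility :: com where
  "compute_utility =
    ''u'' ::=\<^sub>r OfNat (Lit 0) ;;
    scan_superedges (''u'' ::=\<^sub>r RVar ''u'' \<oplus>\<^sub>r (RVar ''ns'' \<ominus>\<^sub>r RVar ''se''))"

text \<open>Binary search for the last \<open>t\<close> with utility at least \<open>\<tau>\<close>.\<close>

definition search :: com where
  "search =
    ''low'' ::= Lit 0 ;;
    ''high'' ::= Var ''cnt'' ;;
    While (NLess (Var ''low'') (Var ''high''))
     (''t'' ::= (Var ''low'' \<oplus> Var ''high'' \<oplus> Lit 1) \<oslash> Lit 2 ;;
      build_partition ''t'' ;;
      compute_utility ;;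
      Cond (RLeq (RIn ''tau'' (Lit 0)) (RVar ''u''))
        (''low'' ::= Var ''t'')
        (''high'' ::= Var ''t'' \<ominus> Lit 1))"

definition output_summary :: "name \<Rightarrow> com" where
  "output_summary t =
    build_partition t ;;
    For ''x'' (Lit 0) N (Emit (Arr ''rep'' (Var ''x''))) ;;
    scan_superedges (Emit (Var ''r'') ;; Emit (Var ''q''))"

text \<open>\<open>off\<close> has twice the number of edges as its last entry, so \<open>d\<close> is twice the number of
  non-adjacent pairs.\<close>

definition prepare :: com where
  "prepare =
    Alloc ''buf'' (Lit 2 \<otimes> N) ;; Alloc ''tmp'' (Lit 2 \<otimes> N) ;;
    Alloc ''up'' N ;; Alloc ''rank'' N ;; Alloc ''child'' N ;; Alloc ''parent'' N ;;
    Alloc ''rep'' N ;; Alloc ''head'' N ;; Alloc ''next'' N ;; Alloc ''size'' N ;;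
    Alloc ''stack'' N ;; Alloc ''edges'' N ;; RAlloc ''import'' N ;;
    ''d'' ::= N \<otimes> (N \<ominus> Lit 1) \<ominus> In ''off'' N ;;
    Cond (NEq (Var ''d'') (Lit 0))
      (''cs'' ::=\<^sub>r OfNat (Lit 0))
      (''cs'' ::=\<^sub>r OfNat (Lit 2) \<oslash>\<^sub>r OfNat (Var ''d''))"

definition t_buds :: com where
  "t_buds = prepare ;; build_H ;; search ;; output_summary ''low''"


section \<open>Input and output encoding\<close>

text \<open>The input holds \<open>n\<close>, \<open>\<tau>\<close>, the centralities and the adjacency lists \<open>ns x\<close> (in any order) one
  after the other in \<open>adj\<close>; the list of \<open>x\<close> starts at position \<open>off ! x\<close>, and \<open>imp\<close> holds the edge
  importances in the same positions.\<close>

definition encodes_input ::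
  "input \<Rightarrow> nat \<Rightarrow> nat set set \<Rightarrow> (nat \<Rightarrow> real) \<Rightarrow> (nat set \<Rightarrow> real) \<Rightarrow> real \<Rightarrow> bool" where
  "encodes_input I n E cen C \<tau> \<longleftrightarrow>
     nat_in I ''n'' = [n] \<and> real_in I ''tau'' = [\<tau>] \<and> real_in I ''cen'' = map cen [0..<n] \<and>
     (\<exists>ns. (\<forall>x<n. distinct (ns x) \<and> set (ns x) = {y. {x, y} \<in> E}) \<and>
        nat_in I ''adj'' = concat (map ns [0..<n]) \<and>
        nat_in I ''off'' = map (\<lambda>x. length (concat (map ns [0..<x]))) [0..<Suc n] \<and>
        real_in I ''imp'' = concat (map (\<lambda>x. map (\<lambda>y. C {x, y}) (ns x)) [0..<n]))"

text \<open>The list \<open>H\<close> stored in the work memory.\<close>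

definition stored_H :: "nat \<Rightarrow> store \<Rightarrow> nat set list" where
  "stored_H n s = map (\<lambda>e. {e div n, e mod n}) (take (nat_var s ''cnt'') (nat_arr s ''buf''))"

text \<open>A summary is output as a part label for each vertex, followed by the list of all superedges,
  each given once by the labels of its end parts.\<close>

definition encodes_summary :: "nat \<Rightarrow> nat list \<Rightarrow> nat summary \<Rightarrow> bool" where
  "encodes_summary n os S \<longleftrightarrow>
     (\<exists>lab es. os = map lab [0..<n] @ concat (map (\<lambda>(r, q). [r, q]) es) \<and>
        distinct (map (\<lambda>(r, q). {r, q}) es) \<and>
        (let part = (\<lambda>r. {x. x < n \<and> lab x = r})
         in S = (part ` lab ` {..<n}, (\<lambda>(r, q). {part r, part q}) ` set es)))"

end

theory Submission
  imports Defs "HOL-Library.Multiset" "HOL-Library.Transitive_Closure_Table"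
begin

text \<open>
  Call a subset \<open>T\<close> of \<open>F\<close> dominating if the ends of every \<open>e \<in> F\<close> are linked by edges of \<open>T\<close> no heavier
  than \<open>e\<close>. An acyclic dominating set is a minimum spanning forest, because below every weight threshold
  it has as many edges as any acyclic subset of \<open>F\<close> can have. Domination is transitive; the stars at
  neighbours of least centrality dominate the two-hop edges, and Kruskal's algorithm keeps a
  dominating subset of its buffer, so the streamed reductions end in a minimum spanning forest of
  \<open>F\<close>. A reduction leaves fewer than \<open>n\<close> of \<open>2 n\<close> buffered edges, so its cost \<open>O(n lg n)\<close> is paid by
  the at least \<open>n\<close> edges buffered before it, and all of them together cost \<open>O((|E| + n) lg n)\<close>, where
  \<open>|E| \<le> 2 |F| + n\<close>.

  The utility of a partition is the sum, over the classes of vertex pairs joining the same two parts, of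
  the positive part of their total gain. Merging parts adds up gains of classes, hence can only
  decrease the utility, which justifies the binary search.
\<close>

section \<open>Spanning forests\<close>

text \<open>What ties the forest to the summaries is the list of links that the last run of
  union-find leaves in \<open>child\<close> and \<open>parent\<close>. Accepting an edge adds one
  link, and for every \<open>t\<close> the first \<open>t\<close> links induce the components of the
  first \<open>t\<close> edges of \<open>H\<close>, that is P_t. Partitions are therefore never
  stored: any of them is replayed from the links in O(n) time, which is what the search needs. In
  the proofs a partition appears as a labelling of the vertices, with the parts as fibres;
  superedges become sets of one or two labels, and a coarser partition is a labelling that factors
  through a finer one. A scan has to cost O(|E| + n) although the parts may form quadratically many
  pairs. Only labels reached by an edge from the current part are touched, and exactly their
  counters are cleared afterwards. The hypothesis \<tau> \<le> 1 enters because the partition into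
  singletons has utility 1, so that the maximum defining \<open>t_star\<close> ranges over a
  nonempty set. Importances summing to 1 force an edge, hence n \<ge> 2 and log n \<ge> 1, which
  absorbs all additive constants.\<close>

definition pairs :: "'a set \<Rightarrow> 'a set set" where
  "pairs V = {{u, v} |u v. u \<in> V \<and> v \<in> V \<and> u \<noteq> v}"

lemma pairsI: "u \<in> V \<Longrightarrow> v \<in> V \<Longrightarrow> u \<noteq> v \<Longrightarrow> {u, v} \<in> pairs V"
  unfolding pairs_def by blast

lemma pairsE:
  assumes "e \<in> pairs V"
  obtains u v where "e = {u, v}" "u \<in> V" "v \<in> V" "u \<noteq> v"
  using assms unfolding pairs_def by blast

lemma pair_in_pairs: "{u, v} \<in> pairs V \<longleftrightarrow> u \<in> V \<and> v \<in> V \<and> u \<noteq> v"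
  unfolding pairs_def by (auto simp: doubleton_eq_iff)

lemma finite_pairs: "finite V \<Longrightarrow> finite (pairs V)"
  by (rule finite_subset[of _ "Pow V"]) (auto simp: pairs_def)

section \<open>Linkage by paths, and cycles\<close>

lemma linked_refl [simp]: "(x, x) \<in> linked T"
  by (simp add: linked_def)

lemma linked_sym: "(x, y) \<in> linked T \<longleftrightarrow> (y, x) \<in> linked T"
proof -
  have "sym {(x, y). {x, y} \<in> T}" by (auto simp: sym_def insert_commute)
  then show ?thesis unfolding linked_def by (metis sym_rtrancl symE)
qed

lemma linked_trans: "(x, y) \<in> linked T \<Longrightarrow> (y, z) \<in> linked T \<Longrightarrow> (x, z) \<in> linked T"
  by (simp add: linked_def)

lemma linked_symD: "(x, y) \<in> linked T \<Longrightarrow> (y, x) \<in> linked T"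
  by (simp add: linked_sym)

lemma linked_trans': "(x, y) \<in> linked T \<Longrightarrow> (x, z) \<in> linked T \<Longrightarrow> (y, z) \<in> linked T"
  by (rule linked_trans[OF linked_symD])

lemma linked_cong: "(x, y) \<in> linked T \<Longrightarrow> (x, z) \<in> linked T \<longleftrightarrow> (y, z) \<in> linked T"
  by (auto intro: linked_trans linked_trans')

lemma linked_edge: "{x, y} \<in> T \<Longrightarrow> (x, y) \<in> linked T"
  by (auto simp: linked_def)

lemma linked_mono: "S \<subseteq> T \<Longrightarrow> linked S \<subseteq> linked T"
  unfolding linked_def by (rule rtrancl_mono) auto

lemma linked_subset_if_edges:
  assumes "\<And>x y. {x, y} \<in> S \<Longrightarrow> (x, y) \<in> linked T"
  shows "linked S \<subseteq> linked T"
proof clarify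
  fix x y assume "(x, y) \<in> linked S"
  then show "(x, y) \<in> linked T" unfolding linked_def[of S]
    by (induction rule: rtrancl_induct) (auto dest: assms linked_trans)
qed

lemma linked_empty [simp]: "linked {} = Id"
  by (simp add: linked_def)

text \<open>A path through the new edge can be cut so as to cross it once, in one of two directions.
  Components after an insertion are computed from this.\<close>

lemma linked_insert:
  "(x, y) \<in> linked (insert {a, b} T) \<longleftrightarrow> (x, y) \<in> linked T \<or>
    (x, a) \<in> linked T \<and> (b, y) \<in> linked T \<or> (x, b) \<in> linked T \<and> (a, y) \<in> linked T"
    (is "?l \<longleftrightarrow> ?r y")
proof
  assume ?l
  then show "?r y" unfolding linked_def[of "insert _ _"]
  proof (induction rule: rtrancl_induct)
    case base
    then show ?case by simp
  next
    case (step y z)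
    then consider "{y, z} \<in> T" | "y = a" "z = b" | "y = b" "z = a"
      by (auto simp: doubleton_eq_iff)
    then show ?case
      using step.IH
      by cases (use linked_trans linked_edge linked_sym linked_refl in metis)+
  qed
next
  have m: "linked T \<subseteq> linked (insert {a, b} T)" by (rule linked_mono) auto
  have e: "(a, b) \<in> linked (insert {a, b} T)" "(b, a) \<in> linked (insert {a, b} T)"
    by (auto intro!: linked_edge simp: insert_commute)
  assume "?r y"
  then show ?l using m e by (meson linked_trans subset_iff)
qed

lemma linked_insert_linked:
  "(a, b) \<in> linked T \<Longrightarrow> linked (insert {a, b} T) = linked T"
  by (auto simp: linked_insert) (metis linked_trans linked_symD)+

lemma cycle_mono: "cycle S p \<Longrightarrow> S \<subseteq> T \<Longrightarrow> cycle T p"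
  unfolding cycle_def by blast

text \<open>A repetition-free path from \<open>a\<close> to \<open>b\<close> that avoids the edge is
  closed to a cycle by it. This makes a redundant edge visible as a cycle when forest edges are
  counted.\<close>

lemma cycle_if_linked_without:
  assumes e: "{a, b} \<in> T" and ne: "a \<noteq> b" and l: "(a, b) \<in> linked (T - {{a, b}})"
  shows "\<exists>p. cycle T p"
proof -
  let ?r = "\<lambda>x y. {x, y} \<in> T - {{a, b}}"
  have "?r\<^sup>*\<^sup>* a b" using l by (simp add: linked_def rtranclp_rtrancl_eq)
  then obtain xs0 where "rtrancl_path ?r a xs0 b" by (auto simp: rtranclp_eq_rtrancl_path)
  then obtain xs where path: "rtrancl_path ?r a xs b" and dist: "distinct (a # xs)"
    by (rule rtrancl_path_distinct)
  let ?p = "a # xs"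
  have "xs \<noteq> []" using path ne by cases auto
  then have last: "last ?p = b" using rtrancl_path_last[OF path] by simp
  have ne': "xs \<noteq> []" using last ne by auto
  \<comment> \<open>A path of one step would be the removed edge itself, so there is an inner vertex
    and the cycle has the three vertices that \<open>cycle\<close> demands.\<close>
  have "length xs \<noteq> 1"
  proof
    assume "length xs = 1"
    then have "xs = [b]" using last by (cases xs) auto
    then show False using rtrancl_path_nth[OF path, of 0] by simp
  qed
  then have len: "length ?p \<ge> 3" using ne' by (cases xs; cases "tl xs") auto
  have "{?p ! i, ?p ! (Suc i mod length ?p)} \<in> T" if i: "i < length ?p" for i
  proof (cases "i < length xs")
    case True
    then show ?thesis using rtrancl_path_nth[OF path True] by simp
  next
    case False
    then have "i = length xs" using i by simp
    then have "?p ! i = b" using last ne' by (metis last_conv_nth length_Cons diff_Suc_1 list.distinct(1))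
    then show ?thesis using \<open>i = length xs\<close> e by (simp add: insert_commute)
  qed
  then show ?thesis using len dist unfolding cycle_def by blast
qed

lemma linked_along:
  assumes "i \<le> j" "\<And>k. i \<le> k \<Longrightarrow> k < j \<Longrightarrow> {p ! k, p ! Suc k} \<in> T"
  shows "(p ! i, p ! j) \<in> linked T"
  using assms by (induction j rule: dec_induct) (auto intro: linked_trans linked_edge)

text \<open>A cycle in the larger set must cross the new edge, and the rest of the cycle is then a
  walk in \<open>T\<close> between \<open>a\<close> and \<open>b\<close>.\<close>

lemma acyclic_insert:
  assumes T: "\<nexists>p. cycle T p" and ab: "(a, b) \<notin> linked T"
  shows "\<nexists>p. cycle (insert {a, b} T) p"
proof
  assume "\<exists>p. cycle (insert {a, b} T) p"
  then obtain p where p: "cycle (insert {a, b} T) p" ..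
  define k where "k = length p"
  have len: "k \<ge> 3" and dist: "distinct p"
    and ed: "\<And>i. i < k \<Longrightarrow> {p ! i, p ! (Suc i mod k)} \<in> insert {a, b} T"
    using p by (auto simp: cycle_def k_def)
  have "\<not> cycle T p" using T by blast
  then obtain i where i: "i < k" "{p ! i, p ! (Suc i mod k)} \<notin> T"
    using len dist by (auto simp: cycle_def k_def)
  then have ei: "{p ! i, p ! (Suc i mod k)} = {a, b}" using ed by blast
  have modS: "Suc j mod k = (if Suc j = k then 0 else Suc j)" if "j < k" for j
    using that by (cases "Suc j = k") auto
  have inj: "p ! x = p ! y \<longleftrightarrow> x = y" if "x < k" "y < k" for x y
    using that dist by (simp add: k_def nth_eq_iff_index_eq)
  \<comment> \<open>The new edge is crossed only once: positions \<open>i\<close> and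
    \<open>j\<close> with the same pair of vertices would be successors of each other, impossible
    for length at least 3.\<close>
  have other: "{p ! j, p ! (Suc j mod k)} \<in> T" if j: "j < k" "j \<noteq> i" for j
  proof (rule ccontr)
    assume "{p ! j, p ! (Suc j mod k)} \<notin> T"
    then have "{p ! j, p ! (Suc j mod k)} = {p ! i, p ! (Suc i mod k)}" using ed j ei by blast
    moreover have "Suc j mod k < k" "Suc i mod k < k" using len by auto
    ultimately have "j = Suc i mod k \<and> i = Suc j mod k"
      using inj i j by (auto simp: doubleton_eq_iff)
    then have ji: "j = Suc i mod k" and ij: "i = Suc j mod k" by blast+
    show False
    proof (cases "Suc i = k")
      case True
      then have "j = 0" using ji by simp
      then show False using ij True len by simp
    next
      case False
      then have "j = Suc i" using ji i by simp
      then show False using ij len i j modS[of j] by (cases "Suc j = k") auto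
    qed
  qed
  \<comment> \<open>The walk back to \<open>i\<close> along the rest of the cycle: straight if
    \<open>i\<close> is the last position, otherwise through the wrap from \<open>k - 1\<close> to
    \<open>0\<close>.\<close>
  have "(p ! (Suc i mod k), p ! i) \<in> linked T"
  proof (cases "Suc i = k")
    case True
    have "(p ! 0, p ! i) \<in> linked T"
    proof (rule linked_along)
      fix j assume "j < i"
      then show "{p ! j, p ! Suc j} \<in> T" using other[of j] i True by (simp add: modS)
    qed simp
    then show ?thesis using True by simp
  next
    case False
    have "(p ! Suc i, p ! (k - 1)) \<in> linked T"
    proof (rule linked_along)
      fix j assume "Suc i \<le> j" "j < k - 1"
      then show "{p ! j, p ! Suc j} \<in> T" using other[of j] by (simp add: modS)
    qed (use i False in linarith)
    moreover have "(p ! (k - 1), p ! 0) \<in> linked T"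
      using other[of "k - 1"] i False len by (auto intro!: linked_edge)
    moreover have "(p ! 0, p ! i) \<in> linked T"
    proof (rule linked_along)
      fix j assume "j < i"
      then show "{p ! j, p ! Suc j} \<in> T" using other[of j] i by (simp add: modS)
    qed simp
    ultimately show ?thesis using False i by (simp add: modS) (meson linked_trans)
  qed
  then have "(a, b) \<in> linked T" using ei by (auto simp: doubleton_eq_iff) (metis linked_sym)+
  with ab show False ..
qed

section \<open>Components and the number of forest edges\<close>

definition components :: "'a set \<Rightarrow> 'a set set \<Rightarrow> 'a set set" where
  "components V T = (\<lambda>x. {y \<in> V. (x, y) \<in> linked T}) ` V"

lemma component_eq_iff:
  assumes "x \<in> V" "y \<in> V"
  shows "{z \<in> V. (x, z) \<in> linked T} = {z \<in> V. (y, z) \<in> linked T} \<longleftrightarrow> (x, y) \<in> linked T"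
proof
  assume "{z \<in> V. (x, z) \<in> linked T} = {z \<in> V. (y, z) \<in> linked T}"
  then have "y \<in> {z \<in> V. (x, z) \<in> linked T}" using assms by auto
  then show "(x, y) \<in> linked T" by simp
next
  assume "(x, y) \<in> linked T"
  from linked_cong[OF this] show "{z \<in> V. (x, z) \<in> linked T} = {z \<in> V. (y, z) \<in> linked T}"
    by simp
qed

text \<open>Classes that miss both ends survive unchanged, and those of \<open>a\<close> and
  \<open>b\<close> unite. If the ends are linked already, a class is united with itself and nothing
  changes.\<close>

lemma merge_along_components:
  assumes "a \<in> V" "b \<in> V"
  shows "merge_along (components V T) {a, b} = components V (insert {a, b} T)"
proof -
  define cl where "cl x = {y \<in> V. (x, y) \<in> linked T}" for x
  define cl' where "cl' x = {y \<in> V. (x, y) \<in> linked (insert {a, b} T)}" for x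
  have cl: "components V T = cl ` V" by (simp add: components_def cl_def)
  have cl': "components V (insert {a, b} T) = cl' ` V" by (simp add: components_def cl'_def)
  have meets: "cl x \<inter> {a, b} \<noteq> {} \<longleftrightarrow> (x, a) \<in> linked T \<or> (x, b) \<in> linked T" for x
    using assms by (auto simp: cl_def)
  have far: "cl' x = cl x" if "cl x \<inter> {a, b} = {}" for x
    using that meets[of x] by (auto simp: cl'_def cl_def linked_insert)
  have near: "cl' x = cl a \<union> cl b" if "cl x \<inter> {a, b} \<noteq> {}" for x
  proof -
    have "(x, a) \<in> linked T \<or> (x, b) \<in> linked T" using that meets by blast
    then show ?thesis
    proof
      assume "(x, a) \<in> linked T"
      from linked_cong[OF this] show ?thesis
        by (auto simp: cl'_def cl_def linked_insert dest: linked_symD linked_trans)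
    next
      assume "(x, b) \<in> linked T"
      from linked_cong[OF this] show ?thesis
        by (auto simp: cl'_def cl_def linked_insert dest: linked_symD linked_trans)
    qed
  qed
  have eqcl: "cl x = cl y" if "(x, y) \<in> linked T" for x y
    using linked_cong[OF that] by (simp add: cl_def)
  have "{X \<in> cl ` V. X \<inter> {a, b} \<noteq> {}} = {cl a, cl b}"
  proof
    show "{X \<in> cl ` V. X \<inter> {a, b} \<noteq> {}} \<subseteq> {cl a, cl b}" using meets eqcl by blast
    show "{cl a, cl b} \<subseteq> {X \<in> cl ` V. X \<inter> {a, b} \<noteq> {}}" using assms by (auto simp: cl_def)
  qed
  then have U: "\<Union>{X \<in> cl ` V. X \<inter> {a, b} \<noteq> {}} = cl a \<union> cl b" by simp
  have "insert (cl a \<union> cl b) {X \<in> cl ` V. X \<inter> {a, b} = {}} = cl' ` V"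
  proof
    show "insert (cl a \<union> cl b) {X \<in> cl ` V. X \<inter> {a, b} = {}} \<subseteq> cl' ` V"
    proof clarify
      fix X assume X: "X \<in> insert (cl a \<union> cl b) {X \<in> cl ` V. X \<inter> {a, b} = {}}"
      show "X \<in> cl' ` V"
      proof (cases "X = cl a \<union> cl b")
        case True
        moreover have "cl a \<inter> {a, b} \<noteq> {}" using assms by (auto simp: cl_def)
        ultimately have "X = cl' a" using near[of a] by blast
        then show ?thesis using assms by blast
      next
        case False
        then show ?thesis using X far by blast
      qed
    qed
    show "cl' ` V \<subseteq> insert (cl a \<union> cl b) {X \<in> cl ` V. X \<inter> {a, b} = {}}"
    proof
      fix X assume "X \<in> cl' ` V"
      then obtain x where "x \<in> V" "X = cl' x" by auto
      then show "X \<in> insert (cl a \<union> cl b) {X \<in> cl ` V. X \<inter> {a, b} = {}}"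
        using far[of x] near[of x] by (cases "cl x \<inter> {a, b} = {}") auto
    qed
  qed
  then show ?thesis unfolding merge_along_def cl cl' U .
qed

text \<open>Turns the successive merges into a statement on linkage, the form in which the
  union-find links can be compared with P_t.\<close>

lemma partition_at_components:
  assumes "set H \<subseteq> pairs V"
  shows "partition_at V H t = components V (set (take t H))"
proof -
  have "foldl merge_along ((\<lambda>x. {x}) ` V) L = components V (set L)" if "set L \<subseteq> pairs V" for L
    using that
  proof (induction L rule: rev_induct)
    case Nil
    have "{y \<in> V. x = y} = {x}" if "x \<in> V" for x using that by auto
    then show ?case by (simp add: components_def)
  next
    case (snoc e L)
    then obtain a b where e: "e = {a, b}" "a \<in> V" "b \<in> V" by (auto elim: pairsE)
    have "foldl merge_along ((\<lambda>x. {x}) ` V) (L @ [e]) = merge_along (components V (set L)) {a, b}"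
      using snoc e by simp
    also have "\<dots> = components V (insert {a, b} (set L))" by (rule merge_along_components[OF e(2,3)])
    finally show ?case using e by simp
  qed
  from this[of "take t H"] show ?thesis using assms set_take_subset unfolding partition_at_def by fastforce
qed

text \<open>Sending a class of the finer relation to the class of one of its members under the
  coarser relation is onto, whichever member \<open>SOME\<close> picks.\<close>

lemma card_components_mono:
  assumes "finite V" "linked A \<subseteq> linked B"
  shows "card (components V B) \<le> card (components V A)"
proof -
  let ?g = "\<lambda>X. {z \<in> V. (SOME x. x \<in> X, z) \<in> linked B}"
  have "components V B \<subseteq> ?g ` components V A"
  proof
    fix Y assume "Y \<in> components V B"
    then obtain x where x: "x \<in> V" "Y = {z \<in> V. (x, z) \<in> linked B}"
      by (auto simp: components_def)
    let ?X = "{z \<in> V. (x, z) \<in> linked A}"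
    have "(SOME y. y \<in> ?X) \<in> ?X" by (rule someI[of _ x]) (use x in simp)
    then have "(x, SOME y. y \<in> ?X) \<in> linked B" using assms by auto
    from linked_cong[OF this] have "Y = ?g ?X" unfolding x(2) by simp
    moreover have "?X \<in> components V A" using x by (auto simp: components_def)
    ultimately show "Y \<in> ?g ` components V A" by (rule image_eqI)
  qed
  then show ?thesis using assms(1) by (intro surj_card_le) (auto simp: components_def)
qed

lemma card_components_insert:
  assumes V: "finite V" and ab: "a \<in> V" "b \<in> V" "(a, b) \<notin> linked T"
  shows "Suc (card (components V (insert {a, b} T))) = card (components V T)"
proof -
  let ?cl = "\<lambda>x. {y \<in> V. (x, y) \<in> linked T}"
  let ?P = "components V T"
  have fin: "finite ?P" using V by (simp add: components_def)
  have meets: "{X \<in> ?P. X \<inter> {a, b} \<noteq> {}} = {?cl a, ?cl b}"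
  proof
    show "{X \<in> ?P. X \<inter> {a, b} \<noteq> {}} \<subseteq> {?cl a, ?cl b}"
    proof
      fix X assume X: "X \<in> {X \<in> ?P. X \<inter> {a, b} \<noteq> {}}"
      then obtain x where x: "x \<in> V" "X = ?cl x" by (auto simp: components_def)
      have "(x, a) \<in> linked T \<or> (x, b) \<in> linked T" using X x by auto
      then show "X \<in> {?cl a, ?cl b}"
        using component_eq_iff[of x V a T] component_eq_iff[of x V b T] x ab by blast
    qed
    show "{?cl a, ?cl b} \<subseteq> {X \<in> ?P. X \<inter> {a, b} \<noteq> {}}" using ab by (auto simp: components_def)
  qed
  have two: "card {?cl a, ?cl b} = 2" using component_eq_iff[OF ab(1,2), of T] ab(3) by simp
  have new: "?cl a \<union> ?cl b \<notin> {X \<in> ?P. X \<inter> {a, b} = {}}" using ab by auto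
  have split: "?P = {X \<in> ?P. X \<inter> {a, b} \<noteq> {}} \<union> {X \<in> ?P. X \<inter> {a, b} = {}}" by blast
  have "card ?P = card {X \<in> ?P. X \<inter> {a, b} \<noteq> {}} + card {X \<in> ?P. X \<inter> {a, b} = {}}"
    using arg_cong[OF split, of card] by (rule trans, intro card_Un_disjoint) (use fin in auto)
  then have "card ?P = card {?cl a, ?cl b} + card {X \<in> ?P. X \<inter> {a, b} = {}}"
    by (simp only: meets)
  moreover have "components V (insert {a, b} T) = insert (?cl a \<union> ?cl b) {X \<in> ?P. X \<inter> {a, b} = {}}"
    using merge_along_components[OF ab(1,2), of T] meets by (simp add: merge_along_def)
  ultimately show ?thesis using new fin two by simp
qed

text \<open>Euler's relation for forests. A new edge either joins two components, lowering their
  number by one, or lies within one and closes a cycle.\<close>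

lemma card_components_bound:
  assumes V: "finite V" and T: "T \<subseteq> pairs V"
  shows "card V \<le> card (components V T) + card T"
    and "\<nexists>p. cycle T p \<Longrightarrow> card V = card (components V T) + card T"
proof -
  have "finite T" using T V finite_pairs finite_subset by blast
  then have "card V \<le> card (components V T) + card T \<and>
    ((\<nexists>p. cycle T p) \<longrightarrow> card V = card (components V T) + card T)"
    using T
  proof (induction T rule: finite_induct)
    case empty
    have "{y \<in> V. x = y} = {x}" if "x \<in> V" for x using that by auto
    then have "components V {} = (\<lambda>x. {x}) ` V" by (simp add: components_def)
    then show ?case by (simp add: card_image)
  next
    case (insert e T)
    then have "e \<in> pairs V" by blast
    then obtain a b where e: "e = {a, b}" "a \<in> V" "b \<in> V" "a \<noteq> b" by (rule pairsE)
    show ?case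
    proof (cases "(a, b) \<in> linked T")
      case True
      then have "components V (insert e T) = components V T"
        using e by (simp add: components_def linked_insert_linked)
      moreover have "\<exists>p. cycle (insert e T) p"
        using cycle_if_linked_without[of a b "insert e T"] True e insert.hyps by auto
      ultimately show ?thesis using insert by auto
    next
      case False
      have "(\<nexists>p. cycle (insert e T) p) \<longrightarrow> (\<nexists>p. cycle T p)" by (meson cycle_mono subset_insertI)
      then show ?thesis
        using card_components_insert[OF V e(2,3) False] insert e by auto
    qed
  qed
  then show "card V \<le> card (components V T) + card T"
    and "\<nexists>p. cycle T p \<Longrightarrow> card V = card (components V T) + card T" by blast+
qed

text \<open>By Euler's relation the acyclic \<open>A\<close> has exactly |V| minus its number of
  components many edges and \<open>B\<close> at least |V| minus its own number, which is no larger.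
  Applied below each weight threshold, this compares a forest with its rivals.\<close>

lemma card_acyclic_le:
  assumes "finite V" "A \<subseteq> pairs V" "B \<subseteq> pairs V" "\<nexists>p. cycle A p" "linked A \<subseteq> linked B"
  shows "card A \<le> card B"
  using card_components_bound(2)[OF assms(1,2,4)] card_components_bound(1)[OF assms(1,3)]
    card_components_mono[OF assms(1,5)] by linarith

lemma card_forest_less:
  assumes "finite V" "V \<noteq> {}" "T \<subseteq> pairs V" "\<nexists>p. cycle T p"
  shows "card T < card V"
proof -
  have "components V T \<noteq> {}" "finite (components V T)" using assms by (auto simp: components_def)
  then have "card (components V T) > 0" by (simp add: card_gt_0_iff)
  then show ?thesis using card_components_bound(2)[OF assms(1,3,4)] by linarith
qed

section \<open>Domination and minimal weight\<close>

text \<open>The bottleneck form of minimality. Unlike minimality of the total weight it is transitive, and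
  so is inherited from the candidate edges to all two-hop edges.\<close>

definition dominates :: "('a set \<Rightarrow> real) \<Rightarrow> 'a set set \<Rightarrow> 'a set set \<Rightarrow> bool" where
  "dominates w T F \<longleftrightarrow> (\<forall>a c. {a, c} \<in> F \<longrightarrow> (a, c) \<in> linked {f \<in> T. w f \<le> w {a, c}})"

lemma dominates_refl: "F \<subseteq> T \<Longrightarrow> dominates w T F"
  unfolding dominates_def by (auto intro: linked_edge)

lemma dominates_mono: "dominates w T F \<Longrightarrow> T \<subseteq> T' \<Longrightarrow> F' \<subseteq> F \<Longrightarrow> dominates w T' F'"
  unfolding dominates_def
proof (intro allI impI)
  fix a c
  assume "\<forall>a c. {a, c} \<in> F \<longrightarrow> (a, c) \<in> linked {f \<in> T. w f \<le> w {a, c}}"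
    and sub: "T \<subseteq> T'" "F' \<subseteq> F" and "{a, c} \<in> F'"
  then have "(a, c) \<in> linked {f \<in> T. w f \<le> w {a, c}}" by blast
  moreover have "{f \<in> T. w f \<le> w {a, c}} \<subseteq> {f \<in> T'. w f \<le> w {a, c}}" using sub by blast
  ultimately show "(a, c) \<in> linked {f \<in> T'. w f \<le> w {a, c}}" using linked_mono by blast
qed

lemma dominates_Un: "dominates w T F \<Longrightarrow> dominates w T G \<Longrightarrow> dominates w T (F \<union> G)"
  unfolding dominates_def by blast

text \<open>A path replacing an edge uses no heavier edges, so it stays below any threshold that the
  edge respects. Transitivity of domination is the instance with the weight of an edge as
  threshold.\<close>

lemma dominates_linked_le:
  assumes "dominates w T S"
  shows "linked {f \<in> S. w f \<le> u} \<subseteq> linked {f \<in> T. w f \<le> u}"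
proof (rule linked_subset_if_edges)
  fix x y assume "{x, y} \<in> {f \<in> S. w f \<le> u}"
  then have "(x, y) \<in> linked {f \<in> T. w f \<le> w {x, y}}" and "w {x, y} \<le> u"
    using assms by (auto simp: dominates_def)
  moreover from this(2) have "{f \<in> T. w f \<le> w {x, y}} \<subseteq> {f \<in> T. w f \<le> u}" by auto
  ultimately show "(x, y) \<in> linked {f \<in> T. w f \<le> u}" using linked_mono by blast
qed

lemma dominates_trans: "dominates w T S \<Longrightarrow> dominates w S F \<Longrightarrow> dominates w T F"
  using dominates_linked_le unfolding dominates_def by blast

lemma dominates_linked:
  assumes "dominates w T F" "T \<subseteq> F"
  shows "linked T = linked F"
proof
  show "linked T \<subseteq> linked F" using assms(2) by (rule linked_mono)
  show "linked F \<subseteq> linked T"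
  proof (rule linked_subset_if_edges)
    fix x y assume "{x, y} \<in> F"
    then have "(x, y) \<in> linked {f \<in> T. w f \<le> w {x, y}}" using assms by (auto simp: dominates_def)
    then show "(x, y) \<in> linked T" using linked_mono[of "{f \<in> T. w f \<le> w {x, y}}" T] by auto
  qed
qed

lemma obtain_maximal:
  fixes w :: "'a \<Rightarrow> real"
  assumes "finite A" "A \<noteq> {}"
  obtains a where "a \<in> A" "\<And>x. x \<in> A \<Longrightarrow> w x \<le> w a"
proof -
  have "Max (w ` A) \<in> w ` A" using assms by (intro Max_in) auto
  then obtain a where "a \<in> A" "w a = Max (w ` A)" by auto
  then show ?thesis using that[of a] assms by simp
qed

text \<open>In order of weight, the k-th element of \<open>A\<close> is at most the k-th of
  \<open>B\<close>. The induction avoids sorting by removing a heaviest element from each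
  set.\<close>

lemma sum_le_if_threshold_cards:
  fixes w :: "'a \<Rightarrow> real"
  assumes "finite A" "finite B" "card A = card B"
    and "\<And>u. card {b \<in> B. w b \<le> u} \<le> card {a \<in> A. w a \<le> u}"
  shows "sum w A \<le> sum w B"
  using assms
proof (induction "card A" arbitrary: A B)
  case 0
  then show ?case by auto
next
  case (Suc k)
  have ne: "A \<noteq> {}" "B \<noteq> {}" using Suc.hyps(2) Suc.prems by auto
  obtain a where a: "a \<in> A" "\<And>x. x \<in> A \<Longrightarrow> w x \<le> w a"
    using obtain_maximal[of A w] ne Suc.prems by blast
  obtain b where b: "b \<in> B" "\<And>x. x \<in> B \<Longrightarrow> w x \<le> w b"
    using obtain_maximal[of B w] ne Suc.prems by blast
  have "{x \<in> B. w x \<le> w b} = B" using b by auto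
  then have "card A \<le> card {x \<in> A. w x \<le> w b}" using Suc.prems(3) Suc.prems(4)[of "w b"] by simp
  then have "{x \<in> A. w x \<le> w b} = A" using Suc.prems(1) by (intro card_seteq) auto
  then have ab: "w a \<le> w b" using a by blast
  have "sum w (A - {a}) \<le> sum w (B - {b})"
  proof (rule Suc.hyps(1))
    show "k = card (A - {a})" using Suc.hyps(2) a Suc.prems by simp
    show "card (A - {a}) = card (B - {b})" using a b Suc.prems by simp
    \<comment> \<open>If \<open>w a \<le> u\<close>, then all of \<open>A - {a}\<close> counts, as
      many elements as \<open>B - {b}\<close> has; otherwise \<open>a\<close> did not count before
      its removal either.\<close>
    show "card {y \<in> B - {b}. w y \<le> u} \<le> card {y \<in> A - {a}. w y \<le> u}" for u
    proof (cases "w a \<le> u")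
      case True
      then have "{y \<in> A - {a}. w y \<le> u} = A - {a}" using a by force
      then have "card {y \<in> A - {a}. w y \<le> u} = card (B - {b})" using a b Suc.prems by simp
      moreover have "card {y \<in> B - {b}. w y \<le> u} \<le> card (B - {b})"
        using Suc.prems by (intro card_mono) auto
      ultimately show ?thesis by simp
    next
      case False
      then have "{y \<in> A - {a}. w y \<le> u} = {y \<in> A. w y \<le> u}" by auto
      moreover have "card {y \<in> B - {b}. w y \<le> u} \<le> card {y \<in> B. w y \<le> u}"
        using Suc.prems by (intro card_mono) auto
      ultimately show ?thesis using Suc.prems(4)[of u] by simp
    qed
  qed (use Suc.prems in auto)
  then show ?case using ab a b Suc.prems by (simp add: sum.remove)
qed

theorem min_spanning_forest_if_dominates:
  assumes V: "finite V" and F: "F \<subseteq> pairs V" and TF: "T \<subseteq> F"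
    and acyc: "\<nexists>p. cycle T p" and dom: "dominates w T F"
  shows "min_spanning_forest w F T"
proof -
  have lTF: "linked T = linked F" by (rule dominates_linked[OF dom TF])
  have T: "spanning_forest F T" using TF acyc lTF by (simp add: spanning_forest_def)
  have fin: "finite F" using F V finite_pairs finite_subset by blast
  have "sum w T \<le> sum w T'" if "spanning_forest F T'" for T'
  proof (rule sum_le_if_threshold_cards)
    have T': "T' \<subseteq> F" "\<nexists>p. cycle T' p" "linked T' = linked F"
      using that by (auto simp: spanning_forest_def)
    show "finite T" "finite T'" using TF T' fin finite_subset by auto
    show "card T = card T'"
    proof (rule antisym)
      have TV: "T \<subseteq> pairs V" "T' \<subseteq> pairs V" using F TF T' by auto
      show "card T \<le> card T'" by (rule card_acyclic_le[OF V TV acyc]) (simp add: lTF T')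
      show "card T' \<le> card T" by (rule card_acyclic_le[OF V TV(2,1) T'(2)]) (simp add: lTF T')
    qed
    show "card {f \<in> T'. w f \<le> u} \<le> card {f \<in> T. w f \<le> u}" for u
    proof (rule card_acyclic_le[OF V])
      show "{f \<in> T'. w f \<le> u} \<subseteq> pairs V" "{f \<in> T. w f \<le> u} \<subseteq> pairs V" using F TF T' by auto
      show "\<nexists>p. cycle {f \<in> T'. w f \<le> u} p" 
        using T'(2) cycle_mono[of "{f \<in> T'. w f \<le> u}" _ T'] by auto
      \<comment> \<open>Below \<open>u\<close>, the rival links no more than \<open>F\<close> does,
        and \<open>T\<close> links as much as \<open>F\<close> by domination.\<close>
      have "linked {f \<in> T'. w f \<le> u} \<subseteq> linked {f \<in> F. w f \<le> u}" using T' by (intro linked_mono) auto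
      also have "\<dots> \<subseteq> linked {f \<in> T. w f \<le> u}" by (rule dominates_linked_le[OF dom])
      finally show "linked {f \<in> T'. w f \<le> u} \<subseteq> linked {f \<in> T. w f \<le> u}" .
    qed
  qed
  then show ?thesis using T by (simp add: min_spanning_forest_def)
qed

section \<open>Utility\<close>

lemma card_pairs: "finite V \<Longrightarrow> card (pairs V) = card V choose 2"
proof -
  assume "finite V"
  have "pairs V = {B. B \<subseteq> V \<and> card B = 2}"
    by (auto simp: pairs_def card_2_iff)
  then show ?thesis using n_subsets[OF \<open>finite V\<close>, of 2] by simp
qed

lemma simple_graph_pairs: "simple_graph V E \<longleftrightarrow> finite V \<and> E \<subseteq> pairs V"
  by (simp add: simple_graph_def pairs_def)

text \<open>The denominator is the number of non-adjacent pairs; for a complete graph it is 0 and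
  the quotient is 0 by convention.\<close>

lemma spurious_importance_nonneg:
  assumes "finite V" "E \<subseteq> pairs V"
  shows "0 \<le> spurious_importance V E"
proof -
  have "card E \<le> card V choose 2" using card_mono[OF finite_pairs assms(2)] assms card_pairs by metis
  then show ?thesis by (simp add: spurious_importance_def)
qed

section \<open>Labellings, gains of vertex pairs, and utility\<close>

definition part_of :: "'a set \<Rightarrow> ('a \<Rightarrow> 'b) \<Rightarrow> 'b \<Rightarrow> 'a set" where
  "part_of V \<rho> r = {x \<in> V. \<rho> x = r}"

definition gain :: "'a set \<Rightarrow> 'a set set \<Rightarrow> ('a set \<Rightarrow> real) \<Rightarrow> 'a set \<Rightarrow> real" where
  "gain V E C e = (if e \<in> E then C e else - spurious_importance V E)"

text \<open>A set \<open>S\<close> of one or two labels names a pair of parts, the singletons naming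
  loops. Every vertex pair \<open>e\<close> belongs to exactly one class, that of its image under
  \<open>\<rho>\<close>.\<close>

definition net_gain ::
  "'a set \<Rightarrow> 'a set set \<Rightarrow> ('a set \<Rightarrow> real) \<Rightarrow> ('a \<Rightarrow> 'b) \<Rightarrow> 'b set \<Rightarrow> real" where
  "net_gain V E C \<rho> S = (\<Sum>e \<in> {e \<in> pairs V. \<rho> ` e = S}. gain V E C e)"

definition label_superedges ::
  "'a set \<Rightarrow> 'a set set \<Rightarrow> ('a set \<Rightarrow> real) \<Rightarrow> ('a \<Rightarrow> 'b) \<Rightarrow> 'b set set" where
  "label_superedges V E C \<rho> = {S \<in> (`) \<rho> ` E. 0 \<le> net_gain V E C \<rho> S}"

lemma pairs_betweenI: "x \<in> X \<Longrightarrow> y \<in> Y \<Longrightarrow> x \<noteq> y \<Longrightarrow> {x, y} \<in> pairs_between X Y"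
  unfolding pairs_between_def by blast

lemma pairs_between_parts:
  "pairs_between (part_of V \<rho> r) (part_of V \<rho> q) = {e \<in> pairs V. \<rho> ` e = {r, q}}"
proof
  show "pairs_between (part_of V \<rho> r) (part_of V \<rho> q) \<subseteq> {e \<in> pairs V. \<rho> ` e = {r, q}}"
    by (auto simp: pairs_between_def part_of_def intro: pairsI)
  show "{e \<in> pairs V. \<rho> ` e = {r, q}} \<subseteq> pairs_between (part_of V \<rho> r) (part_of V \<rho> q)"
  proof
    fix e assume "e \<in> {e \<in> pairs V. \<rho> ` e = {r, q}}"
    then obtain u v where e: "e = {u, v}" "u \<in> V" "v \<in> V" "u \<noteq> v" and "{\<rho> u, \<rho> v} = {r, q}"
      by (auto elim!: pairsE)
    then consider "\<rho> u = r" "\<rho> v = q" | "\<rho> u = q" "\<rho> v = r" by (auto simp: doubleton_eq_iff)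
    then show "e \<in> pairs_between (part_of V \<rho> r) (part_of V \<rho> q)"
    proof cases
      case 1
      then show ?thesis using e by (auto simp: pairs_between_def part_of_def)
    next
      case 2
      then have "e = {v, u} \<and> v \<in> part_of V \<rho> r \<and> u \<in> part_of V \<rho> q \<and> v \<noteq> u"
        using e by (auto simp: part_of_def)
      then show ?thesis unfolding pairs_between_def by blast
    qed
  qed
qed

lemma nSedge_minus_Sedge:
  assumes "finite V"
  shows "nSedge E C (part_of V \<rho> r) (part_of V \<rho> q) - Sedge V E (part_of V \<rho> r) (part_of V \<rho> q)
    = net_gain V E C \<rho> {r, q}"
proof -
  let ?B = "pairs_between (part_of V \<rho> r) (part_of V \<rho> q)"
  have fin: "finite ?B" unfolding pairs_between_parts by (rule finite_subset[OF _ finite_pairs[OF assms]]) auto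
  have "net_gain V E C \<rho> {r, q} = sum (gain V E C) ?B"
    by (simp add: net_gain_def pairs_between_parts)
  also have "\<dots> = sum (gain V E C) (?B \<inter> E) + sum (gain V E C) (?B - E)"
    using fin by (subst sum.union_disjoint[symmetric]) (auto simp: Int_Diff_Un)
  also have "\<dots> = nSedge E C (part_of V \<rho> r) (part_of V \<rho> q) - Sedge V E (part_of V \<rho> r) (part_of V \<rho> q)"
    by (simp add: nSedge_def Sedge_def gain_def sum_negf)
  finally show ?thesis by simp
qed

lemma inj_on_part_of: "inj_on (part_of V \<rho>) (\<rho> ` V)"
  by (rule inj_onI) (auto simp: part_of_def)

lemma superedges_labels:
  assumes V: "finite V" and E: "E \<subseteq> pairs V"
  shows "superedges V E C (part_of V \<rho> ` \<rho> ` V) = (`) (part_of V \<rho>) ` label_superedges V E C \<rho>"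
proof -
  let ?p = "part_of V \<rho>"
  have iff: "pairs_between (?p r) (?p q) \<inter> E \<noteq> {} \<and> Sedge V E (?p r) (?p q) \<le> nSedge E C (?p r) (?p q)
      \<longleftrightarrow> {r, q} \<in> label_superedges V E C \<rho>" for r q
  proof -
    have "Sedge V E (?p r) (?p q) \<le> nSedge E C (?p r) (?p q) \<longleftrightarrow> 0 \<le> net_gain V E C \<rho> {r, q}"
      using nSedge_minus_Sedge[OF V, of E C \<rho> r q] by linarith
    moreover have "pairs_between (?p r) (?p q) \<inter> E \<noteq> {} \<longleftrightarrow> {r, q} \<in> (`) \<rho> ` E"
      unfolding pairs_between_parts using E by (auto simp: disjoint_iff)
    ultimately show ?thesis by (simp add: label_superedges_def)
  qed
  show ?thesis
  proof
    show "superedges V E C (?p ` \<rho> ` V) \<subseteq> (`) ?p ` label_superedges V E C \<rho>"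
    proof
      fix s assume "s \<in> superedges V E C (?p ` \<rho> ` V)"
      then obtain X Y where "s = {X, Y}" "X \<in> ?p ` \<rho> ` V" "Y \<in> ?p ` \<rho> ` V"
        "pairs_between X Y \<inter> E \<noteq> {}" "Sedge V E X Y \<le> nSedge E C X Y"
        unfolding superedges_def by blast
      then obtain r q where "s = {?p r, ?p q}" "{r, q} \<in> label_superedges V E C \<rho>"
        using iff by blast
      then show "s \<in> (`) ?p ` label_superedges V E C \<rho>"
        by (intro image_eqI[of _ _ "{r, q}"]) auto
    qed
    show "(`) ?p ` label_superedges V E C \<rho> \<subseteq> superedges V E C (?p ` \<rho> ` V)"
    proof clarify
      fix S assume S: "S \<in> label_superedges V E C \<rho>"
      then obtain e where e: "e \<in> E" "S = \<rho> ` e" by (auto simp: label_superedges_def)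
      then obtain u v where uv: "e = {u, v}" "u \<in> V" "v \<in> V" using E by (blast elim: pairsE)
      then have S': "S = {\<rho> u, \<rho> v}" using e by simp
      have "pairs_between (?p (\<rho> u)) (?p (\<rho> v)) \<inter> E \<noteq> {} \<and>
          Sedge V E (?p (\<rho> u)) (?p (\<rho> v)) \<le> nSedge E C (?p (\<rho> u)) (?p (\<rho> v))"
        using iff S S' by blast
      then show "?p ` S \<in> superedges V E C (?p ` \<rho> ` V)"
        unfolding superedges_def S' using uv by auto
    qed
  qed
qed

lemma label_superedges_subset:
  assumes "E \<subseteq> pairs V" "S \<in> label_superedges V E C \<rho>"
  shows "S \<subseteq> \<rho> ` V"
  using assms by (auto simp: label_superedges_def elim!: pairsE dest!: subsetD)

lemma inj_on_image_part_of:
  assumes "E \<subseteq> pairs V"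
  shows "inj_on ((`) (part_of V \<rho>)) (label_superedges V E C \<rho>)"
  by (rule inj_on_subset[OF inj_on_image_Pow[OF inj_on_part_of]])
    (use label_superedges_subset[OF assms] in blast)

lemma utility_labels:
  assumes V: "finite V" and E: "E \<subseteq> pairs V"
  shows "utility V E C (part_of V \<rho> ` \<rho> ` V) = (\<Sum>S \<in> label_superedges V E C \<rho>. net_gain V E C \<rho> S)"
proof -
  let ?p = "part_of V \<rho>"
  have term_eq: "(let (X, Y) = SOME (X, Y). ?p ` S = {X, Y} in nSedge E C X Y - Sedge V E X Y)
      = net_gain V E C \<rho> S" if S: "S \<in> label_superedges V E C \<rho>" for S
  proof -
    obtain e where e: "e \<in> E" "S = \<rho> ` e" using S by (auto simp: label_superedges_def)
    then obtain u v where uv: "e = {u, v}" "u \<in> V" "v \<in> V" using E by (blast elim: pairsE)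
    define r where "r = \<rho> u"
    define q where "q = \<rho> v"
    have S': "S = {r, q}" using e uv by (simp add: r_def q_def)
    obtain X Y where XY: "(SOME (X, Y). ?p ` S = {X, Y}) = (X, Y)" by (meson surj_pair)
    have "(\<lambda>(X, Y). ?p ` S = {X, Y}) (SOME (X, Y). ?p ` S = {X, Y})"
      by (rule someI[of _ "(?p r, ?p q)"]) (simp add: S')
    then have "{?p r, ?p q} = {X, Y}" using XY S' by simp
    \<comment> \<open>The choice operator in \<open>utility\<close> may return the end parts in
      either order; \<open>net_gain\<close> depends on the label set only, so both orders give its
      value.\<close>
    then consider "X = ?p r" "Y = ?p q" | "X = ?p q" "Y = ?p r" by (auto simp: doubleton_eq_iff)
    then have "nSedge E C X Y - Sedge V E X Y = net_gain V E C \<rho> {r, q}"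
      by cases (simp_all add: nSedge_minus_Sedge[OF V] insert_commute)
    then show ?thesis using XY S' by simp
  qed
  show ?thesis
    unfolding utility_def superedges_labels[OF V E]
    by (subst sum.reindex[OF inj_on_image_part_of[OF E]], unfold o_def, rule sum.cong[OF refl term_eq])
qed

text \<open>A class without an edge of the graph consists of spurious pairs and gains at most 0.
  Summing positive parts over all classes thus replaces both conditions on superedges, and the sum
  becomes comparable between partitions.\<close>

lemma utility_max:
  assumes V: "finite V" and E: "E \<subseteq> pairs V"
  shows "utility V E C (part_of V \<rho> ` \<rho> ` V) = (\<Sum>S \<in> (`) \<rho> ` pairs V. max 0 (net_gain V E C \<rho> S))"
proof -
  have nonpos: "net_gain V E C \<rho> S \<le> 0" if "S \<notin> (`) \<rho> ` E" for S
    unfolding net_gain_def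
    by (rule sum_nonpos) (use that spurious_importance_nonneg[OF V E] in \<open>auto simp: gain_def\<close>)
  have "(\<Sum>S \<in> label_superedges V E C \<rho>. net_gain V E C \<rho> S)
      = (\<Sum>S \<in> label_superedges V E C \<rho>. max 0 (net_gain V E C \<rho> S))"
    by (rule sum.cong) (auto simp: label_superedges_def)
  also have "\<dots> = (\<Sum>S \<in> (`) \<rho> ` pairs V. max 0 (net_gain V E C \<rho> S))"
  proof (rule sum.mono_neutral_left)
    show "finite ((`) \<rho> ` pairs V)" using V finite_pairs by blast
    show "label_superedges V E C \<rho> \<subseteq> (`) \<rho> ` pairs V" using E by (auto simp: label_superedges_def)
    show "\<forall>S \<in> (`) \<rho> ` pairs V - label_superedges V E C \<rho>. max 0 (net_gain V E C \<rho> S) = 0"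
    proof
      fix S assume "S \<in> (`) \<rho> ` pairs V - label_superedges V E C \<rho>"
      then have "net_gain V E C \<rho> S \<le> 0" using nonpos[of S] by (auto simp: label_superedges_def)
      then show "max 0 (net_gain V E C \<rho> S) = 0" by simp
    qed
  qed
  finally show ?thesis by (simp add: utility_labels[OF V E])
qed

lemma utility_antimono:
  assumes V: "finite V" and E: "E \<subseteq> pairs V"
    and coarser: "\<And>x y. x \<in> V \<Longrightarrow> y \<in> V \<Longrightarrow> \<rho> x = \<rho> y \<Longrightarrow> \<rho>' x = \<rho>' y"
  shows "utility V E C (part_of V \<rho>' ` \<rho>' ` V) \<le> utility V E C (part_of V \<rho> ` \<rho> ` V)"
proof -
  \<comment> \<open>\<open>\<rho>'\<close> is constant on the fibres of \<open>\<rho>\<close> and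
    hence factors through it; \<open>g\<close> is the factor, read off a chosen vertex of each
    fibre.\<close>
  define g where "g r = \<rho>' (SOME x. x \<in> V \<and> \<rho> x = r)" for r
  have g: "\<rho>' x = g (\<rho> x)" if "x \<in> V" for x
  proof -
    have "(SOME y. y \<in> V \<and> \<rho> y = \<rho> x) \<in> V \<and> \<rho> (SOME y. y \<in> V \<and> \<rho> y = \<rho> x) = \<rho> x"
      by (rule someI[of _ x]) (use that in simp)
    then show ?thesis unfolding g_def using coarser[of "SOME y. y \<in> V \<and> \<rho> y = \<rho> x" x] that by simp
  qed
  have img: "\<rho>' ` e = g ` \<rho> ` e" if "e \<in> pairs V" for e
    using that g by (auto elim!: pairsE)
  let ?A = "(`) \<rho> ` pairs V" and ?A' = "(`) \<rho>' ` pairs V"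
  have fin: "finite ?A" "finite ?A'" using V finite_pairs by blast+
  have A': "?A' = (`) g ` ?A" using img by (auto simp: image_image)
  have net: "net_gain V E C \<rho>' S' = (\<Sum>S \<in> {S \<in> ?A. g ` S = S'}. net_gain V E C \<rho> S)" for S'
  proof -
    have "net_gain V E C \<rho>' S' = (\<Sum>e \<in> {e \<in> pairs V. g ` \<rho> ` e = S'}. gain V E C e)"
      unfolding net_gain_def by (rule sum.cong) (use img in auto)
    also have "\<dots> = (\<Sum>S \<in> (`) \<rho> ` {e \<in> pairs V. g ` \<rho> ` e = S'}.
        \<Sum>e \<in> {e \<in> {e \<in> pairs V. g ` \<rho> ` e = S'}. \<rho> ` e = S}. gain V E C e)"
      by (rule sum.image_gen) (use finite_pairs[OF V] in auto)
    also have "(`) \<rho> ` {e \<in> pairs V. g ` \<rho> ` e = S'} = {S \<in> ?A. g ` S = S'}" by auto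
    also have "(\<Sum>S \<in> {S \<in> ?A. g ` S = S'}.
          \<Sum>e \<in> {e \<in> {e \<in> pairs V. g ` \<rho> ` e = S'}. \<rho> ` e = S}. gain V E C e)
        = (\<Sum>S \<in> {S \<in> ?A. g ` S = S'}. net_gain V E C \<rho> S)"
      unfolding net_gain_def
    proof (intro sum.cong refl)
      fix S assume "S \<in> {S \<in> ?A. g ` S = S'}"
      then show "{e \<in> {e \<in> pairs V. g ` \<rho> ` e = S'}. \<rho> ` e = S} = {e \<in> pairs V. \<rho> ` e = S}"
        by blast
    qed
    finally show ?thesis .
  qed
  have "(\<Sum>S' \<in> ?A'. max 0 (net_gain V E C \<rho>' S'))
      \<le> (\<Sum>S' \<in> (`) g ` ?A. \<Sum>S \<in> {S \<in> ?A. g ` S = S'}. max 0 (net_gain V E C \<rho> S))"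
    unfolding A' net
  \<comment> \<open>The positive part of a sum is at most the sum of the positive parts.\<close>
  proof (rule sum_mono)
    fix S'
    let ?s = "\<Sum>S \<in> {S \<in> ?A. g ` S = S'}. max 0 (net_gain V E C \<rho> S)"
    have "(\<Sum>S \<in> {S \<in> ?A. g ` S = S'}. net_gain V E C \<rho> S) \<le> ?s" by (rule sum_mono) simp
    moreover have "0 \<le> ?s" by (rule sum_nonneg) simp
    ultimately show "max 0 (\<Sum>S \<in> {S \<in> ?A. g ` S = S'}. net_gain V E C \<rho> S) \<le> ?s" by simp
  qed
  also have "\<dots> = (\<Sum>S \<in> ?A. max 0 (net_gain V E C \<rho> S))"
    by (rule sum.image_gen[symmetric]) (rule fin)
  finally show ?thesis by (simp add: utility_max[OF V E])
qed

text \<open>Every class is a single pair, so the positive parts pick out the edges, whose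
  importances sum to 1. With \<tau> \<le> 1 this makes \<open>t = 0\<close> admissible in the
  search.\<close>

lemma utility_singletons:
  assumes V: "finite V" and E: "E \<subseteq> pairs V" and C: "importances E C"
    and inj: "inj_on \<rho> V"
  shows "utility V E C (part_of V \<rho> ` \<rho> ` V) = 1"
proof -
  have inj': "inj_on ((`) \<rho>) (pairs V)"
    by (rule inj_on_subset[OF inj_on_image_Pow[OF inj]]) (auto simp: pairs_def)
  have net: "net_gain V E C \<rho> (\<rho> ` e) = gain V E C e" if "e \<in> pairs V" for e
  proof -
    have "{e' \<in> pairs V. \<rho> ` e' = \<rho> ` e} = {e}" using that inj' by (auto dest: inj_onD)
    then show ?thesis by (simp add: net_gain_def)
  qed
  have "utility V E C (part_of V \<rho> ` \<rho> ` V) = (\<Sum>e \<in> pairs V. max 0 (gain V E C e))"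
    unfolding utility_max[OF V E] by (subst sum.reindex[OF inj']) (simp add: net)
  also have "\<dots> = (\<Sum>e \<in> E. C e)"
  proof (rule sum.mono_neutral_cong_right[OF finite_pairs[OF V] E])
    show "\<forall>e \<in> pairs V - E. max 0 (gain V E C e) = 0"
      using spurious_importance_nonneg[OF V E] by (simp add: gain_def)
    show "\<And>e. e \<in> E \<Longrightarrow> max 0 (gain V E C e) = C e"
      using C by (auto simp: gain_def importances_def less_imp_le)
  qed
  finally show ?thesis using C by (simp add: importances_def)
qed

section \<open>Counting edges and non-adjacent pairs by arcs\<close>

text \<open>The program meets every edge inside a part twice, once from each end.\<close>

lemma sum_arcs_within:
  fixes f :: "'a set \<Rightarrow> real"
  assumes X: "finite X" and E: "E \<subseteq> pairs V"
  shows "(\<Sum>(x, y) \<in> {(x, y) \<in> X \<times> X. {x, y} \<in> E}. f {x, y}) = 2 * (\<Sum>e \<in> pairs_between X X \<inter> E. f e)"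
proof -
  let ?A = "{(x, y) \<in> X \<times> X. {x, y} \<in> E}" and ?h = "\<lambda>(x, y). {x, y}"
  have ne: "x \<noteq> y" if "{x, y} \<in> E" for x y
    using subsetD[OF E that] unfolding pair_in_pairs by blast
  have fin: "finite ?A" by (rule finite_subset[of _ "X \<times> X"]) (use X in auto)
  have im: "?h ` ?A = pairs_between X X \<inter> E"
  proof
    show "?h ` ?A \<subseteq> pairs_between X X \<inter> E" using ne by (auto intro: pairs_betweenI)
    show "pairs_between X X \<inter> E \<subseteq> ?h ` ?A" unfolding pairs_between_def by auto
  qed
  have "(\<Sum>(x, y) \<in> ?A. f {x, y}) = (\<Sum>e \<in> ?h ` ?A. \<Sum>p \<in> {p \<in> ?A. ?h p = e}. f (?h p))"
    using sum.image_gen[OF fin, of "\<lambda>p. f (?h p)" ?h] by (simp add: case_prod_unfold)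
  also have "\<dots> = (\<Sum>e \<in> ?h ` ?A. 2 * f e)"
  proof (rule sum.cong[OF refl])
    fix e assume "e \<in> ?h ` ?A"
    then obtain a b where ab: "e = {a, b}" "a \<in> X" "b \<in> X" "{a, b} \<in> E" by auto
    have ba: "{b, a} \<in> E" using ab(4) by (simp only: insert_commute)
    have "{p \<in> ?A. ?h p = e} = {(a, b), (b, a)}"
    proof (rule set_eqI)
      fix p :: "'a \<times> 'a"
      obtain x y where p: "p = (x, y)" by (cases p)
      show "p \<in> {p \<in> ?A. ?h p = e} \<longleftrightarrow> p \<in> {(a, b), (b, a)}"
        unfolding p ab(1) using ab(2-4) ba by (simp add: doubleton_eq_iff) blast
    qed
    then show "(\<Sum>p \<in> {p \<in> ?A. ?h p = e}. f (?h p)) = 2 * f e"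
      using ne[OF ab(4)] ab(1) by (simp add: insert_commute[of b a])
  qed
  finally show ?thesis unfolding im by (simp add: sum_distrib_left)
qed

lemma sum_arcs_between:
  fixes f :: "'a set \<Rightarrow> real"
  assumes "X \<inter> Y = {}"
  shows "(\<Sum>(x, y) \<in> {(x, y) \<in> X \<times> Y. {x, y} \<in> E}. f {x, y}) = (\<Sum>e \<in> pairs_between X Y \<inter> E. f e)"
proof -
  let ?A = "{(x, y) \<in> X \<times> Y. {x, y} \<in> E}" and ?h = "\<lambda>(x, y). {x, y}"
  have "inj_on ?h ?A" using assms by (auto simp: inj_on_def doubleton_eq_iff)
  moreover have "?h ` ?A = pairs_between X Y \<inter> E"
  proof
    show "?h ` ?A \<subseteq> pairs_between X Y \<inter> E" using assms by (auto intro!: pairs_betweenI)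
    show "pairs_between X Y \<inter> E \<subseteq> ?h ` ?A" unfolding pairs_between_def by auto
  qed
  ultimately show ?thesis
    using sum.reindex[of ?h ?A f] by (simp add: case_prod_unfold)
qed

lemma card_pairs_between:
  assumes "finite X" "finite Y" "X \<inter> Y = {}"
  shows "card (pairs_between X Y) = card X * card Y"
proof -
  have "inj_on (\<lambda>(x, y). {x, y}) (X \<times> Y)" using assms(3) by (auto simp: inj_on_def doubleton_eq_iff)
  moreover have "(\<lambda>(x, y). {x, y}) ` (X \<times> Y) = pairs_between X Y"
  proof
    show "(\<lambda>(x, y). {x, y}) ` (X \<times> Y) \<subseteq> pairs_between X Y"
      using assms(3) by (auto intro!: pairs_betweenI)
    show "pairs_between X Y \<subseteq> (\<lambda>(x, y). {x, y}) ` (X \<times> Y)" unfolding pairs_between_def by auto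
  qed
  ultimately have "bij_betw (\<lambda>(x, y). {x, y}) (X \<times> Y) (pairs_between X Y)"
    by (simp add: bij_betw_def)
  then show ?thesis using bij_betw_same_card assms card_cartesian_product by metis
qed

lemma card_pairs_within: "finite X \<Longrightarrow> 2 * card (pairs_between X X) = card X * (card X - 1)"
proof -
  assume X: "finite X"
  have "pairs_between X X = pairs X" by (simp add: pairs_between_def pairs_def)
  then have "2 * card (pairs_between X X) = 2 * (card X * (card X - 1) div 2)"
    using card_pairs[OF X] by (simp add: choose_two)
  also have "\<dots> = card X * (card X - 1)" by (rule dvd_mult_div_cancel) (cases "card X"; simp)
  finally show ?thesis .
qed

text \<open>The program never enumerates non-adjacent pairs: it subtracts the number of arcs met
  from the product of the part sizes.\<close>

lemma Sedge_between:
  assumes fin: "finite X" "finite Y" and disj: "X \<inter> Y = {}"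
  shows "Sedge V E X Y = spurious_importance V E *
    real (card X * card Y - card {(x, y) \<in> X \<times> Y. {x, y} \<in> E})"
proof -
  let ?B = "pairs_between X Y"
  have finB: "finite ?B" 
    by (rule finite_subset[of _ "(\<lambda>(x, y). {x, y}) ` (X \<times> Y)"]) (use fin in \<open>auto simp: pairs_between_def\<close>)
  have "card {(x, y) \<in> X \<times> Y. {x, y} \<in> E} = card (?B \<inter> E)"
    using sum_arcs_between[OF disj, where f = "\<lambda>_. 1" and E = E] by (simp add: case_prod_unfold)
  moreover have "card (?B - E) = card ?B - card (?B \<inter> E)"
    using finB by (simp add: card_Diff_subset_Int)
  ultimately show ?thesis by (simp add: Sedge_def card_pairs_between[OF fin disj])
qed

text \<open>Inside one part, ordered pairs and arcs both count everything twice, hence the division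
  by 2.\<close>

lemma Sedge_within:
  assumes X: "finite X" and E: "E \<subseteq> pairs V"
  shows "Sedge V E X X = spurious_importance V E *
    real (card X * (card X - 1) - card {(x, y) \<in> X \<times> X. {x, y} \<in> E}) / 2"
proof -
  let ?B = "pairs_between X X"
  have finB: "finite ?B" 
    by (rule finite_subset[of _ "(\<lambda>(x, y). {x, y}) ` (X \<times> X)"]) (use X in \<open>auto simp: pairs_between_def\<close>)
  have "real (card {(x, y) \<in> X \<times> X. {x, y} \<in> E}) = real (2 * card (?B \<inter> E))"
    using sum_arcs_within[OF X E, where f = "\<lambda>_. 1"] by (simp add: case_prod_unfold)
  then have "card {(x, y) \<in> X \<times> X. {x, y} \<in> E} = 2 * card (?B \<inter> E)" by linarith
  moreover have "card (?B - E) = card ?B - card (?B \<inter> E)"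
    using finB by (simp add: card_Diff_subset_Int)
  ultimately have "card X * (card X - 1) - card {(x, y) \<in> X \<times> X. {x, y} \<in> E} = 2 * card (?B - E)"
    using card_pairs_within[OF X] by (simp add: diff_mult_distrib2)
  then show ?thesis by (simp add: Sedge_def)
qed

section \<open>Bounding the edges by the two-hop edges\<close>

text \<open>Each edge has an end \<open>v\<close> whose degree is at most that of the other end, and then \<open>v\<close> has
  at least \<open>deg v - 1\<close> two-hop neighbours.\<close>

lemma two_hop_pairs:
  assumes "E \<subseteq> pairs V"
  shows "two_hop E \<subseteq> pairs V"
proof
  fix e assume "e \<in> two_hop E"
  then obtain a b c where "e = {a, c}" "a \<noteq> c" "{a, b} \<in> E" "{b, c} \<in> E"
    by (auto simp: two_hop_def)
  moreover from this have "{a, b} \<in> pairs V" "{b, c} \<in> pairs V" using assms by blast+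
  ultimately show "e \<in> pairs V" by (simp add: pair_in_pairs)
qed

lemma card_edges_le_two_hop:
  assumes V: "finite V" and E: "E \<subseteq> pairs V"
  shows "card E \<le> 2 * card (two_hop E) + card V"
proof -
  define N where "N v = {y. {v, y} \<in> E}" for v
  define low where "low v = {y \<in> N v. card (N v) \<le> card (N y)}" for v
  define F where "F v = {y. {v, y} \<in> two_hop E}" for v
  have NV: "N v \<subseteq> V" for v using E by (auto simp: N_def pair_in_pairs dest!: subsetD)
  have finN: "finite (N v)" for v using NV V finite_subset by blast
  have two_hop: "two_hop E \<subseteq> pairs V" by (rule two_hop_pairs[OF E])
  have FV: "F v \<subseteq> V" for v using two_hop by (auto simp: F_def pair_in_pairs dest!: subsetD)
  have finF: "finite (F v)" for v using FV V finite_subset by blast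
  have sub: "E \<subseteq> (\<lambda>(v, y). {v, y}) ` (SIGMA v:V. low v)"
  proof
    fix e assume e: "e \<in> E"
    then obtain u v where uv: "e = {u, v}" "u \<in> V" "v \<in> V" using E by (blast elim: pairsE)
    show "e \<in> (\<lambda>(v, y). {v, y}) ` (SIGMA v:V. low v)"
    proof (cases "card (N u) \<le> card (N v)")
      case True
      then show ?thesis using e uv by (intro image_eqI[of _ _ "(u, v)"]) (auto simp: low_def N_def)
    next
      case False
      then show ?thesis using e uv
        by (intro image_eqI[of _ _ "(v, u)"]) (auto simp: low_def N_def insert_commute)
    qed
  qed
  \<comment> \<open>If \<open>low v\<close> contains some \<open>y\<close>, then every neighbour of
    \<open>y\<close> except \<open>v\<close> is a two-hop neighbour of \<open>v\<close>; the
    exception accounts for the \<open>Suc\<close>.\<close>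
  have low: "card (low v) \<le> Suc (card (F v))" for v
  proof (cases "low v = {}")
    case False
    then obtain y where y: "{v, y} \<in> E" "card (N v) \<le> card (N y)" by (auto simp: low_def N_def)
    have "N y - {v} \<subseteq> F v" using y by (auto simp: F_def N_def two_hop_def)
    then have "card (N y - {v}) \<le> card (F v)" by (rule card_mono[OF finF])
    moreover have "card (low v) \<le> card (N v)" by (rule card_mono[OF finN]) (auto simp: low_def)
    ultimately show ?thesis using y finN[of y] by (simp add: card_Diff_singleton_if split: if_splits)
  qed simp
  have fin: "finite (SIGMA v:V. low v)" using V finN by (auto simp: low_def)
  have "card E \<le> card (SIGMA v:V. low v)" by (rule surj_card_le[OF fin sub])
  also have "\<dots> = (\<Sum>v\<in>V. card (low v))" using V finN by (simp add: low_def)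
  also have "\<dots> \<le> (\<Sum>v\<in>V. Suc (card (F v)))" by (rule sum_mono) (rule low)
  also have "\<dots> = card V + (\<Sum>v\<in>V. card (F v))" by (simp add: sum_Suc)
  also have "(\<Sum>v\<in>V. card (F v)) = card (SIGMA v:V. F v)" using V finF by simp
  \<comment> \<open>Each two-hop edge is counted from both of its ends, which gives the factor 2 in
    the claim.\<close>
  also have "(SIGMA v:V. F v) = {(x, y) \<in> V \<times> V. {x, y} \<in> two_hop E}" using FV by (auto simp: F_def)
  also have "card \<dots> = 2 * card (two_hop E)"
  proof -
    have "pairs_between V V \<inter> two_hop E = two_hop E"
      using two_hop by (auto simp: pairs_between_def pairs_def)
    then have "real (card {(x, y) \<in> V \<times> V. {x, y} \<in> two_hop E}) = real (2 * card (two_hop E))"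
      using sum_arcs_within[OF V two_hop, where f = "\<lambda>_. 1"] by (simp add: case_prod_unfold)
    then show ?thesis by linarith
  qed
  finally show ?thesis by simp
qed

section \<open>Program logic\<close>

text \<open>Total correctness with time: an unblocked terminating run exists, and \<open>Q\<close>
  sees its cost. As the language is deterministic, this run is the only one.\<close>

definition wp :: "input \<Rightarrow> com \<Rightarrow> store \<Rightarrow> (nat \<Rightarrow> store \<Rightarrow> bool) \<Rightarrow> bool" where
  "wp I c s Q \<longleftrightarrow> (\<exists>t s'. exec I c s t s' \<and> Q t s')"

inductive_cases SkipE: "exec I Skip s t s'"
inductive_cases AssignE: "exec I (x ::= e) s t s'"
inductive_cases RAssignE: "exec I (x ::=\<^sub>r e) s t s'"
inductive_cases StoreE: "exec I (Store a d e) s t s'"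
inductive_cases RStoreE: "exec I (RStore a d e) s t s'"
inductive_cases AllocE: "exec I (Alloc a e) s t s'"
inductive_cases RAllocE: "exec I (RAlloc a e) s t s'"
inductive_cases EmitE: "exec I (Emit e) s t s'"
inductive_cases SeqE: "exec I (c ;; d) s t s'"
inductive_cases CondE: "exec I (Cond b c d) s t s'"

lemma wp_mono: "wp I c s Q \<Longrightarrow> (\<And>t s'. Q t s' \<Longrightarrow> R t s') \<Longrightarrow> wp I c s R"
  unfolding wp_def by blast

lemma wp_Skip [simp]: "wp I Skip s Q \<longleftrightarrow> Q 1 s"
  unfolding wp_def by (metis SkipE exec.Skip)

lemma wp_Assign [simp]: "wp I (x ::= e) s Q \<longleftrightarrow>
    nsafe I s e \<and> Q (1 + ncost e) (s\<lparr>nat_var := (nat_var s)(x := nval I s e)\<rparr>)"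
  unfolding wp_def by (metis AssignE exec.Assign)

lemma wp_RAssign [simp]: "wp I (x ::=\<^sub>r e) s Q \<longleftrightarrow>
    rsafe I s e \<and> Q (1 + rcost e) (s\<lparr>real_var := (real_var s)(x := rval I s e)\<rparr>)"
  unfolding wp_def by (metis RAssignE exec.RAssign)

lemma wp_Store [simp]: "wp I (Store a d e) s Q \<longleftrightarrow>
    nsafe I s d \<and> nsafe I s e \<and> nval I s d < length (nat_arr s a) \<and>
    Q (1 + ncost d + ncost e) (s\<lparr>nat_arr := (nat_arr s)(a := (nat_arr s a)[nval I s d := nval I s e])\<rparr>)"
  unfolding wp_def by (metis StoreE exec.Store)

lemma wp_RStore [simp]: "wp I (RStore a d e) s Q \<longleftrightarrow>
    nsafe I s d \<and> rsafe I s e \<and> nval I s d < length (real_arr s a) \<and>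
    Q (1 + ncost d + rcost e) (s\<lparr>real_arr := (real_arr s)(a := (real_arr s a)[nval I s d := rval I s e])\<rparr>)"
  unfolding wp_def by (metis RStoreE exec.RStore)

lemma wp_Alloc [simp]: "wp I (Alloc a e) s Q \<longleftrightarrow>
    nsafe I s e \<and> Q (1 + ncost e + nval I s e)
      (s\<lparr>nat_arr := (nat_arr s)(a := replicate (nval I s e) 0), allocated := allocated s + nval I s e\<rparr>)"
  unfolding wp_def by (metis AllocE exec.Alloc)

lemma wp_RAlloc [simp]: "wp I (RAlloc a e) s Q \<longleftrightarrow>
    nsafe I s e \<and> Q (1 + ncost e + nval I s e)
      (s\<lparr>real_arr := (real_arr s)(a := replicate (nval I s e) 0), allocated := allocated s + nval I s e\<rparr>)"
  unfolding wp_def by (metis RAllocE exec.RAlloc)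

lemma wp_Emit [simp]: "wp I (Emit e) s Q \<longleftrightarrow>
    nsafe I s e \<and> Q (1 + ncost e) (s\<lparr>tape := tape s @ [nval I s e]\<rparr>)"
  unfolding wp_def by (metis EmitE exec.Emit)

lemma wp_Seq [simp]: "wp I (c ;; d) s Q \<longleftrightarrow> wp I c s (\<lambda>t s'. wp I d s' (\<lambda>t' s''. Q (t + t') s''))"
  unfolding wp_def by (auto elim!: SeqE) (blast intro: exec.Seq)+

lemma wp_Cond [simp]: "wp I (Cond b c d) s Q \<longleftrightarrow> bsafe I s b \<and>
    (if bval I s b then wp I c s (\<lambda>t s'. Q (1 + bcost b + t) s')
     else wp I d s (\<lambda>t s'. Q (1 + bcost b + t) s'))"
proof (cases "bval I s b")
  case True
  then have "exec I (Cond b c d) s t s' \<longleftrightarrow> bsafe I s b \<and> (\<exists>t'. t = 1 + bcost b + t' \<and> exec I c s t' s')"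
    for t s' by (intro iffI; elim CondE exE conjE) (auto dest: exec.CondTrue[where d = d])
  then show ?thesis using True unfolding wp_def by auto
next
  case False
  then have "exec I (Cond b c d) s t s' \<longleftrightarrow> bsafe I s b \<and> (\<exists>t'. t = 1 + bcost b + t' \<and> exec I d s t' s')"
    for t s' by (intro iffI; elim CondE exE conjE) (auto dest: exec.CondFalse[where c = c])
  then show ?thesis using False unfolding wp_def by auto
qed

section \<open>Frames read off the syntax\<close>

fun nat_vars_of :: "com \<Rightarrow> name set" where
  "nat_vars_of (x ::= e) = {x}"
| "nat_vars_of (c ;; d) = nat_vars_of c \<union> nat_vars_of d"
| "nat_vars_of (Cond b c d) = nat_vars_of c \<union> nat_vars_of d"
| "nat_vars_of (While b c) = nat_vars_of c"
| "nat_vars_of _ = {}"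

fun real_vars_of :: "com \<Rightarrow> name set" where
  "real_vars_of (x ::=\<^sub>r e) = {x}"
| "real_vars_of (c ;; d) = real_vars_of c \<union> real_vars_of d"
| "real_vars_of (Cond b c d) = real_vars_of c \<union> real_vars_of d"
| "real_vars_of (While b c) = real_vars_of c"
| "real_vars_of _ = {}"

fun nat_arrs_of :: "com \<Rightarrow> name set" where
  "nat_arrs_of (Store a d e) = {a}"
| "nat_arrs_of (Alloc a e) = {a}"
| "nat_arrs_of (c ;; d) = nat_arrs_of c \<union> nat_arrs_of d"
| "nat_arrs_of (Cond b c d) = nat_arrs_of c \<union> nat_arrs_of d"
| "nat_arrs_of (While b c) = nat_arrs_of c"
| "nat_arrs_of _ = {}"

fun real_arrs_of :: "com \<Rightarrow> name set" where
  "real_arrs_of (RStore a d e) = {a}"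
| "real_arrs_of (RAlloc a e) = {a}"
| "real_arrs_of (c ;; d) = real_arrs_of c \<union> real_arrs_of d"
| "real_arrs_of (Cond b c d) = real_arrs_of c \<union> real_arrs_of d"
| "real_arrs_of (While b c) = real_arrs_of c"
| "real_arrs_of _ = {}"

fun emits :: "com \<Rightarrow> bool" where
  "emits (Emit e) = True"
| "emits (c ;; d) = (emits c \<or> emits d)"
| "emits (Cond b c d) = (emits c \<or> emits d)"
| "emits (While b c) = emits c"
| "emits _ = False"

fun allocates :: "com \<Rightarrow> bool" where
  "allocates (Alloc a e) = True"
| "allocates (RAlloc a e) = True"
| "allocates (c ;; d) = (allocates c \<or> allocates d)"
| "allocates (Cond b c d) = (allocates c \<or> allocates d)"
| "allocates (While b c) = allocates c"
| "allocates _ = False"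

text \<open>What a command cannot change is read off its syntax, so invariants mention only what a
  loop works on. Without allocations the array lengths persist as well, which keeps bounds checks
  provable.\<close>

definition frame :: "com \<Rightarrow> store \<Rightarrow> store \<Rightarrow> bool" where
  "frame c s s' \<longleftrightarrow>
    (\<forall>x. x \<notin> nat_vars_of c \<longrightarrow> nat_var s' x = nat_var s x) \<and>
    (\<forall>x. x \<notin> real_vars_of c \<longrightarrow> real_var s' x = real_var s x) \<and>
    (\<forall>a. a \<notin> nat_arrs_of c \<longrightarrow> nat_arr s' a = nat_arr s a) \<and>
    (\<forall>a. a \<notin> real_arrs_of c \<longrightarrow> real_arr s' a = real_arr s a) \<and>
    (\<not> emits c \<longrightarrow> tape s' = tape s) \<and>
    (\<not> allocates c \<longrightarrow> allocated s' = allocated s \<and>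
      (\<forall>a. length (nat_arr s' a) = length (nat_arr s a)) \<and>
      (\<forall>a. length (real_arr s' a) = length (real_arr s a)))"

lemma frame_refl [simp]: "frame c s s"
  by (simp add: frame_def)

lemma frame_trans: "frame c s s' \<Longrightarrow> frame c s' s'' \<Longrightarrow> frame c s s''"
  by (simp add: frame_def)

lemma exec_frame: "exec I c s t s' \<Longrightarrow> frame c s s'"
  by (induction rule: exec.induct) (auto simp: frame_def)

lemma frameD:
  assumes "frame c s s'"
  shows "x \<notin> nat_vars_of c \<Longrightarrow> nat_var s' x = nat_var s x"
    and "x \<notin> real_vars_of c \<Longrightarrow> real_var s' x = real_var s x"
    and "a \<notin> nat_arrs_of c \<Longrightarrow> nat_arr s' a = nat_arr s a"
    and "a \<notin> real_arrs_of c \<Longrightarrow> real_arr s' a = real_arr s a"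
    and "\<not> emits c \<Longrightarrow> tape s' = tape s"
    and "\<not> allocates c \<Longrightarrow> allocated s' = allocated s"
    and "\<not> allocates c \<Longrightarrow> length (nat_arr s' a) = length (nat_arr s a)"
    and "\<not> allocates c \<Longrightarrow> length (real_arr s' a) = length (real_arr s a)"
  using assms by (simp_all add: frame_def)

lemma wp_frame:
  assumes "wp I c s Q" "\<And>t s'. Q t s' \<Longrightarrow> frame c s s' \<Longrightarrow> R t s'"
  shows "wp I c s R"
  using assms exec_frame unfolding wp_def by blast

section \<open>Loop rules with time budgets\<close>

text \<open>\<open>k\<close> is the remaining time budget; it also bounds the number of iterations.\<close>

lemma wp_While:
  assumes start: "Inv k s0"
    and safe: "\<And>k s. Inv k s \<Longrightarrow> frame c s0 s \<Longrightarrow> bsafe I s b"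
    and body: "\<And>k s. Inv k s \<Longrightarrow> frame c s0 s \<Longrightarrow> bval I s b \<Longrightarrow>
      wp I c s (\<lambda>t s'. \<exists>k'. Inv k' s' \<and> 1 + bcost b + t + k' \<le> k)"
    and final: "\<And>k s. Inv k s \<Longrightarrow> frame c s0 s \<Longrightarrow> \<not> bval I s b \<Longrightarrow> 1 + bcost b \<le> k \<and> Q s"
  shows "wp I (While b c) s0 (\<lambda>t s'. t \<le> k \<and> Q s' \<and> frame c s0 s')"
proof -
  have "Inv k s \<Longrightarrow> frame c s0 s \<Longrightarrow>
      \<exists>t s'. exec I (While b c) s t s' \<and> t \<le> k \<and> Q s' \<and> frame c s0 s'" for s
  proof (induction k arbitrary: s rule: less_induct)
    case (less k)
    show ?case
    proof (cases "bval I s b")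
      case True
      from body[OF less.prems True] obtain t s' k' where
        1: "exec I c s t s'" "Inv k' s'" "1 + bcost b + t + k' \<le> k" unfolding wp_def by blast
      moreover have "frame c s0 s'" using less.prems exec_frame[OF 1(1)] frame_trans by blast
      ultimately obtain t' s'' where "exec I (While b c) s' t' s''" "t' \<le> k'" "Q s''" "frame c s0 s''"
        using less.IH[of k' s'] by auto
      then show ?thesis
        using exec.WhileTrue[OF safe[OF less.prems] True 1(1)] 1(3)
        by (meson add_left_mono le_trans)
    next
      case False
      then show ?thesis
        using exec.WhileFalse[OF safe[OF less.prems] False] final[OF less.prems False] less.prems by blast
    qed
  qed
  then show ?thesis using start unfolding wp_def by simp
qed

text \<open>An iteration costs \<open>3 + ncost h\<close> for the test and 4 for the increment; the
  loop as a whole adds \<open>1 + ncost l\<close> and a last test. The budget may depend on the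
  store, as the amortized analysis of the buffer requires; \<open>wp_For\<close> is the case of a
  fixed cost per iteration.\<close>

lemma wp_For_budget:
  assumes l: "nsafe I s l" "nval I s l = a" "a \<le> b"
    and start: "Inv a k (s\<lparr>nat_var := (nat_var s)(x := a)\<rparr>)"
    and h: "\<And>i k s'. a \<le> i \<Longrightarrow> i \<le> b \<Longrightarrow> nat_var s' x = i \<Longrightarrow> Inv i k s' \<Longrightarrow>
      frame (For x l h c) s s' \<Longrightarrow> nsafe I s' h \<and> nval I s' h = b"
    and body: "\<And>i k s'. a \<le> i \<Longrightarrow> i < b \<Longrightarrow> nat_var s' x = i \<Longrightarrow> Inv i k s' \<Longrightarrow>
      frame (For x l h c) s s' \<Longrightarrow> wp I c s' (\<lambda>t s''. nat_var s'' x = i \<and>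
        (\<exists>k'. Inv (Suc i) k' (s''\<lparr>nat_var := (nat_var s'')(x := Suc i)\<rparr>) \<and> 7 + ncost h + t + k' \<le> k))"
  shows "wp I (For x l h c) s (\<lambda>t s'. nat_var s' x = b \<and> frame (For x l h c) s s' \<and>
    (\<exists>k'. Inv b k' s' \<and> t + k' \<le> 4 + ncost l + ncost h + k))"
proof -
  let ?F = "For x l h c"
  let ?b = "NLess (Var x) h" and ?c = "c ;; x ::= Var x \<oplus> Lit 1"
  let ?s1 = "s\<lparr>nat_var := (nat_var s)(x := a)\<rparr>"
  have frame: "frame ?F s s'" if "frame ?c ?s1 s'" for s'
    using that by (auto simp: frame_def For_def)
  have "\<exists>t s'. exec I (While ?b ?c) ?s1 t s' \<and> nat_var s' x = b \<and> frame ?c ?s1 s' \<and>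
      (\<exists>k'. Inv b k' s' \<and> t + k' \<le> 3 + ncost h + k)"
  proof -
    have "\<lbrakk>b - i = d; i \<le> b; a \<le> i; nat_var s' x = i; Inv i k s'; frame ?c ?s1 s'\<rbrakk> \<Longrightarrow>
        \<exists>t s''. exec I (While ?b ?c) s' t s'' \<and> nat_var s'' x = b \<and> frame ?c ?s1 s'' \<and>
          (\<exists>k'. Inv b k' s'' \<and> t + k' \<le> 3 + ncost h + k)" for d i k s'
      supply fun_upd_apply [simp del]
    proof (induction d arbitrary: i k s')
      case 0
      then have "i = b" by simp
      have "nsafe I s' h \<and> nval I s' h = b"
        by (rule h[OF 0(3,2,4,5) frame[OF 0(6)]])
      then show ?case
        using exec.WhileFalse[of I s' ?b ?c] 0 \<open>i = b\<close>
        by (intro exI[of _ "3 + ncost h"] exI[of _ s']) (auto simp: numeral_3_eq_3)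
    next
      case (Suc d)
      have hi: "nsafe I s' h \<and> nval I s' h = b"
        by (rule h[OF Suc.prems(3,2,4,5) frame[OF Suc.prems(6)]])
      have ib: "i < b" and d: "b - Suc i = d" using Suc.prems by simp_all
      obtain t s2 k' where 1: "exec I c s' t s2" "nat_var s2 x = i"
        "Inv (Suc i) k' (s2\<lparr>nat_var := (nat_var s2)(x := Suc i)\<rparr>)" "7 + ncost h + t + k' \<le> k"
        using body[of i s' k] Suc.prems ib frame unfolding wp_def by blast
      let ?s3 = "s2\<lparr>nat_var := (nat_var s2)(x := Suc i)\<rparr>"
      have "exec I (x ::= Var x \<oplus> Lit 1) s2 4 ?s3"
        using exec.Assign[of I s2 "Var x \<oplus> Lit 1" x] 1(2) by (simp add: eval_nat_numeral)
      then have 2: "exec I ?c s' (t + 4) ?s3" using exec.Seq[OF 1(1)] by blast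
      have fr: "frame ?c ?s1 ?s3" using Suc.prems exec_frame[OF 2] frame_trans by blast
      obtain t' s4 k'' where 3: "exec I (While ?b ?c) ?s3 t' s4" "nat_var s4 x = b"
        "frame ?c ?s1 s4" "Inv b k'' s4" "t' + k'' \<le> 3 + ncost h + k'"
        using Suc.IH[OF d _ _ _ 1(3) fr] Suc.prems(3) ib by (auto simp: fun_upd_same)
      have "exec I (While ?b ?c) s' (1 + bcost ?b + (t + 4) + t') s4"
        by (rule exec.WhileTrue[OF _ _ 2 3(1)]) (use hi ib Suc.prems in auto)
      moreover have "1 + bcost ?b + (t + 4) + t' + k'' \<le> 3 + ncost h + k" using 3(5) 1(4) by simp
      ultimately show ?case using 3 by blast
    qed
    then show ?thesis using start l by simp
  qed
  then obtain t s' k' where 1: "exec I (While ?b ?c) ?s1 t s'" "nat_var s' x = b" "frame ?c ?s1 s'"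
    "Inv b k' s'" "t + k' \<le> 3 + ncost h + k" by blast
  have "exec I (x ::= l) s (1 + ncost l) ?s1" using exec.Assign[OF l(1), of x] l(2) by simp
  from exec.Seq[OF this 1(1)] have "exec I ?F s (1 + ncost l + t) s'" by (simp add: For_def)
  moreover have "1 + ncost l + t + k' \<le> 4 + ncost l + ncost h + k" using 1(5) by simp
  ultimately show ?thesis unfolding wp_def using 1 frame by blast
qed

lemma wp_For:
  assumes l: "nsafe I s l" "nval I s l = a" "a \<le> b"
    and start: "Inv a (s\<lparr>nat_var := (nat_var s)(x := a)\<rparr>)"
    and h: "\<And>i s'. a \<le> i \<Longrightarrow> i \<le> b \<Longrightarrow> nat_var s' x = i \<Longrightarrow> Inv i s' \<Longrightarrow>
      frame (For x l h c) s s' \<Longrightarrow> nsafe I s' h \<and> nval I s' h = b"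
    and body: "\<And>i s'. a \<le> i \<Longrightarrow> i < b \<Longrightarrow> nat_var s' x = i \<Longrightarrow> Inv i s' \<Longrightarrow>
      frame (For x l h c) s s' \<Longrightarrow> wp I c s' (\<lambda>t s''. t \<le> m \<and> nat_var s'' x = i \<and>
        Inv (Suc i) (s''\<lparr>nat_var := (nat_var s'')(x := Suc i)\<rparr>))"
  shows "wp I (For x l h c) s (\<lambda>t s'. t \<le> (b - a) * (m + 7 + ncost h) + 4 + ncost l + ncost h \<and>
    nat_var s' x = b \<and> frame (For x l h c) s s' \<and> Inv b s')"
proof (rule wp_mono)
  let ?m = "m + 7 + ncost h"
  let ?Inv = "\<lambda>i k s'. Inv i s' \<and> k = (b - i) * ?m"
  show "wp I (For x l h c) s (\<lambda>t s'. nat_var s' x = b \<and> frame (For x l h c) s s' \<and>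
    (\<exists>k'. ?Inv b k' s' \<and> t + k' \<le> 4 + ncost l + ncost h + (b - a) * ?m))"
  proof (rule wp_For_budget[where Inv = ?Inv, OF l])
    fix i k s' assume *: "a \<le> i" "i < b" "nat_var s' x = i" "?Inv i k s'" "frame (For x l h c) s s'"
    have "b - i = Suc (b - Suc i)" using *(2) by simp
    then have "(b - i) * ?m = (b - Suc i) * ?m + ?m" by simp
    then show "wp I c s' (\<lambda>t s''. nat_var s'' x = i \<and>
        (\<exists>k'. ?Inv (Suc i) k' (s''\<lparr>nat_var := (nat_var s'')(x := Suc i)\<rparr>) \<and> 7 + ncost h + t + k' \<le> k))"
      using * by (intro wp_mono[OF body[of i s']]) auto
  qed (use start h in auto)
qed auto

lemma For_effects [simp]:
  "nat_vars_of (For x l h c) = insert x (nat_vars_of c)"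
  "real_vars_of (For x l h c) = real_vars_of c"
  "nat_arrs_of (For x l h c) = nat_arrs_of c"
  "real_arrs_of (For x l h c) = real_arrs_of c"
  "emits (For x l h c) = emits c"
  "allocates (For x l h c) = allocates c"
  by (auto simp: For_def)

text \<open>Fixes one admissible input and names the adjacency lists \<open>ns\<close> whose
  existence the encoding asserts. \<open>0 < n\<close> is derived in the end from the importances,
  since the empty sum is not 1.\<close>

locale encoded =
  fixes I :: input and n :: nat and E :: "nat set set" and cen :: "nat \<Rightarrow> real"
    and C :: "nat set \<Rightarrow> real" and \<tau> :: real and ns :: "nat \<Rightarrow> nat list"
  assumes n_in: "nat_in I ''n'' = [n]"
    and tau_in: "real_in I ''tau'' = [\<tau>]"
    and cen_in: "real_in I ''cen'' = map cen [0..<n]"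
    and ns: "\<And>x. x < n \<Longrightarrow> distinct (ns x) \<and> set (ns x) = {y. {x, y} \<in> E}"
    and adj_in: "nat_in I ''adj'' = concat (map ns [0..<n])"
    and off_in: "nat_in I ''off'' = map (\<lambda>x. length (concat (map ns [0..<x]))) [0..<Suc n]"
    and imp_in: "real_in I ''imp'' = concat (map (\<lambda>x. map (\<lambda>y. C {x, y}) (ns x)) [0..<n])"
    and E_pairs: "E \<subseteq> pairs {..<n}"
    and C_imp: "importances E C"
    and n_pos: "0 < n"
begin

definition ckey :: "nat \<Rightarrow> real" where
  "ckey e = cen (e div n) + cen (e mod n)"

lemma div_less: "e < n * n \<Longrightarrow> e div n < n"
  by (simp add: less_mult_imp_div_less)

lemma rval_key: "nval I s e < n * n \<Longrightarrow> rval I s (key e) = ckey (nval I s e)"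
  using n_pos by (simp add: key_def ckey_def cen_in n_in div_less)

lemma rsafe_key: "nsafe I s e \<Longrightarrow> nval I s e < n * n \<Longrightarrow> rsafe I s (key e)"
  using n_pos by (simp add: key_def cen_in n_in div_less)

lemma rcost_key: "rcost (key e) = 9 + 2 * ncost e"
  by (simp add: key_def)

end

section \<open>Sorting the buffer\<close>

definition slice :: "'a list \<Rightarrow> nat \<Rightarrow> nat \<Rightarrow> 'a list" where
  "slice xs a b = drop a (take b xs)"

lemma length_slice: "length (slice xs a b) = min b (length xs) - a"
  by (simp add: slice_def)

lemma slice_empty [simp]: "b \<le> a \<Longrightarrow> slice xs a b = []"
  by (simp add: slice_def)

lemma slice_snoc: "a \<le> b \<Longrightarrow> b < length xs \<Longrightarrow> slice xs a (Suc b) = slice xs a b @ [xs ! b]"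
  by (simp add: slice_def take_Suc_conv_app_nth)

lemma slice_Cons: "a < b \<Longrightarrow> b \<le> length xs \<Longrightarrow> slice xs a b = xs ! a # slice xs (Suc a) b"
  by (simp add: slice_def Cons_nth_drop_Suc[symmetric])

lemma slice_update_ge: "b \<le> k \<Longrightarrow> slice (xs[k := v]) a b = slice xs a b"
  by (simp add: slice_def)

lemma take_slice: "a \<le> b \<Longrightarrow> take a xs @ slice xs a b = take b xs"
  using append_take_drop_id[of a "take b xs"] by (simp add: slice_def min_def)

lemma slice_append:
  assumes "a \<le> b" "b \<le> c"
  shows "slice xs a b @ slice xs b c = slice xs a c"
proof -
  have "slice xs a c = drop a (take b xs @ slice xs b c)"
    unfolding take_slice[OF assms(2)] by (simp add: slice_def)
  also have "\<dots> = slice xs a b @ slice xs b c"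
  proof (cases "length xs < b")
    case True
    then have "slice xs b c = []" by (simp add: slice_def)
    then show ?thesis by (simp add: slice_def)
  next
    case False
    then show ?thesis using assms(1) by (simp add: slice_def min_def)
  qed
  finally show ?thesis by simp
qed

lemma slice_eq_if_take_eq: "take c xs = take c ys \<Longrightarrow> b \<le> c \<Longrightarrow> slice xs a b = slice ys a b"
  unfolding slice_def by (metis min.absorb1 take_take)

text \<open>Appending a least remaining entry keeps the output sorted and below all that remains.
  One form serves both runs, with \<open>a # A\<close> the run that loses its head.\<close>

lemma merge_step:
  fixes f :: "'a \<Rightarrow> real"
  assumes "sorted (map f D)" "sorted (map f (a # A))"
    and "\<And>x y. x \<in> set D \<Longrightarrow> y \<in> set (a # A) \<union> set B \<Longrightarrow> f x \<le> f y"
    and "\<And>y. y \<in> set B \<Longrightarrow> f a \<le> f y"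
  shows "sorted (map f (D @ [a]))" "\<And>x y. x \<in> set (D @ [a]) \<Longrightarrow> y \<in> set A \<union> set B \<Longrightarrow> f x \<le> f y"
  using assms by (auto simp: sorted_append)

section \<open>Merge sort\<close>

context encoded
begin

text \<open>\<open>k + m = i + j\<close> states without subtraction that the \<open>k - lo\<close>
  entries written are the \<open>i - lo\<close> and \<open>j - m\<close> entries consumed.\<close>

definition merging :: "nat list \<Rightarrow> nat list \<Rightarrow> nat \<Rightarrow> nat \<Rightarrow> nat \<Rightarrow> nat \<Rightarrow> nat \<Rightarrow> nat \<Rightarrow> nat list \<Rightarrow> bool" where
  "merging buf tmp0 lo m h i j k tmp \<longleftrightarrow> lo \<le> i \<and> i \<le> m \<and> m \<le> j \<and> j \<le> h \<and> k + m = i + j \<and>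
     take lo tmp = take lo tmp0 \<and>
     mset (slice tmp lo k) = mset (slice buf lo i) + mset (slice buf m j) \<and>
     sorted (map ckey (slice tmp lo k)) \<and>
     (\<forall>x \<in> set (slice tmp lo k). \<forall>y \<in> set (slice buf i m) \<union> set (slice buf j h). ckey x \<le> ckey y)"

lemma merging_left:
  assumes M: "merging buf tmp0 lo m h i j k tmp" and i: "i < m"
    and len: "h \<le> length buf" "h \<le> length tmp"
    and s: "sorted (map ckey (slice buf i m))" "sorted (map ckey (slice buf j h))"
    and le: "h \<le> j \<or> ckey (buf ! i) \<le> ckey (buf ! j)"
  shows "merging buf tmp0 lo m h (Suc i) j (Suc k) (tmp[k := buf ! i])"
proof -
  have k: "lo \<le> k" "k < h" using M i by (auto simp: merging_def)
  have sl: "slice buf i m = buf ! i # slice buf (Suc i) m" using i M len by (auto simp: merging_def slice_Cons)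
  have new: "slice (tmp[k := buf ! i]) lo (Suc k) = slice tmp lo k @ [buf ! i]"
    using k len by (simp add: slice_snoc slice_update_ge)
  \<comment> \<open>\<open>le\<close> compares two heads only; sortedness of the right run passes it
    on to all its remaining entries.\<close>
  have head: "ckey (buf ! i) \<le> ckey y" if "y \<in> set (slice buf j h)" for y
  proof -
    have j: "j < h" using that by (cases "j < h") auto
    then have "slice buf j h = buf ! j # slice buf (Suc j) h" using len by (simp add: slice_Cons)
    then have "ckey (buf ! j) \<le> ckey y" using that s(2) by auto
    then show ?thesis using le j by auto
  qed
  have "slice buf lo (Suc i) = slice buf lo i @ [buf ! i]"
    using M i len by (auto simp: merging_def slice_snoc)
  then have "mset (slice (tmp[k := buf ! i]) lo (Suc k)) = mset (slice buf lo (Suc i)) + mset (slice buf m j)"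
    using M new by (simp add: merging_def)
  moreover have "sorted (map ckey (slice (tmp[k := buf ! i]) lo (Suc k)))"
    and "\<forall>x \<in> set (slice (tmp[k := buf ! i]) lo (Suc k)).
      \<forall>y \<in> set (slice buf (Suc i) m) \<union> set (slice buf j h). ckey x \<le> ckey y"
    unfolding new
    using merge_step[of ckey "slice tmp lo k" "buf ! i" "slice buf (Suc i) m" "slice buf j h"]
      M s(1) head unfolding merging_def sl by blast+
  ultimately show ?thesis using M i k unfolding merging_def by simp
qed

lemma merging_right:
  assumes M: "merging buf tmp0 lo m h i j k tmp" and j: "j < h"
    and len: "h \<le> length buf" "h \<le> length tmp"
    and s: "sorted (map ckey (slice buf i m))" "sorted (map ckey (slice buf j h))"
    and le: "i = m \<or> ckey (buf ! j) \<le> ckey (buf ! i)"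
  shows "merging buf tmp0 lo m h i (Suc j) (Suc k) (tmp[k := buf ! j])"
proof -
  have k: "lo \<le> k" "k < h" using M j by (auto simp: merging_def)
  have sl: "slice buf j h = buf ! j # slice buf (Suc j) h" using j M len by (auto simp: merging_def slice_Cons)
  have new: "slice (tmp[k := buf ! j]) lo (Suc k) = slice tmp lo k @ [buf ! j]"
    using k len by (simp add: slice_snoc slice_update_ge)
  have head: "ckey (buf ! j) \<le> ckey y" if "y \<in> set (slice buf i m)" for y
  proof -
    have i: "i < m" using that by (cases "i < m") auto
    then have "slice buf i m = buf ! i # slice buf (Suc i) m"
      using len M by (simp add: slice_Cons merging_def)
    then have "ckey (buf ! i) \<le> ckey y" using that s(1) by auto
    then show ?thesis using le i by auto
  qed
  have "slice buf m (Suc j) = slice buf m j @ [buf ! j]"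
    using M j len by (auto simp: merging_def slice_snoc)
  then have "mset (slice (tmp[k := buf ! j]) lo (Suc k)) = mset (slice buf lo i) + mset (slice buf m (Suc j))"
    using M new by (simp add: merging_def)
  moreover have "sorted (map ckey (slice (tmp[k := buf ! j]) lo (Suc k)))"
    and "\<forall>x \<in> set (slice (tmp[k := buf ! j]) lo (Suc k)).
      \<forall>y \<in> set (slice buf i m) \<union> set (slice buf (Suc j) h). ckey x \<le> ckey y"
    unfolding new
    using merge_step[of ckey "slice tmp lo k" "buf ! j" "slice buf (Suc j) h" "slice buf i m"]
      M s(2) head unfolding merging_def sl by blast+
  ultimately show ?thesis using M j k unfolding merging_def by simp
qed

text \<open>Here as for later loop bodies, a name lets invariants and rules refer to the body;
  unfolding it gives back the program text.\<close>

definition merge_body :: com where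
  "merge_body = Cond (BAnd (NLess (Var ''i'') (Var ''mid''))
               (BOr (NLeq (Var ''hi'') (Var ''j''))
                 (RLeq (key (Arr ''buf'' (Var ''i''))) (key (Arr ''buf'' (Var ''j''))))))
         (take_from ''i'')
         (take_from ''j'')"

lemma wp_merge_loop:
  assumes "nat_var s ''lo'' = lo" "nat_var s ''mid'' = m" "nat_var s ''hi'' = h"
    "nat_var s ''i'' = lo" "nat_var s ''j'' = m"
    "nat_arr s ''buf'' = buf" "nat_arr s ''tmp'' = tmp0"
    and ord: "lo \<le> m" "m \<le> h" and len: "h \<le> length buf" "h \<le> length tmp0"
    and codes: "\<And>p. p < h \<Longrightarrow> buf ! p < n * n"
    and sorted: "sorted (map ckey (slice buf lo m))" "sorted (map ckey (slice buf m h))"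
  shows "wp I (For ''k'' (Var ''lo'') (Var ''hi'') merge_body) s (\<lambda>t s'. t \<le> (h - lo) * 60 + 6 \<and>
    take lo (nat_arr s' ''tmp'') = take lo tmp0 \<and>
    mset (slice (nat_arr s' ''tmp'') lo h) = mset (slice buf lo h) \<and>
    sorted (map ckey (slice (nat_arr s' ''tmp'') lo h)))"
proof -
  let ?Inv = "\<lambda>k s'. merging buf tmp0 lo m h (nat_var s' ''i'') (nat_var s' ''j'') k (nat_arr s' ''tmp'')"
  let ?F = "For ''k'' (Var ''lo'') (Var ''hi'') merge_body"
  have suffix: "sorted (map ckey (slice buf i h))" if "sorted (map ckey (slice buf lo h))" "lo \<le> i" for i lo h
  proof -
    have "slice buf i h = drop (i - lo) (slice buf lo h)" using that(2) by (simp add: slice_def)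
    then show ?thesis using that(1) by (simp add: drop_map[symmetric] sorted_wrt_drop)
  qed
  have "wp I ?F s (\<lambda>t s'. t \<le> (h - lo) * (50 + 7 + ncost (Var ''hi'')) + 4 + ncost (Var ''lo'') + ncost (Var ''hi'') \<and>
      nat_var s' ''k'' = h \<and> frame ?F s s' \<and> ?Inv h s')"
  proof (rule wp_For[where Inv = ?Inv and a = lo and b = h])
    show "?Inv lo (s\<lparr>nat_var := (nat_var s)(''k'' := lo)\<rparr>)"
      using assms by (simp add: merging_def)
    fix k s' assume k: "lo \<le> k" "k < h" "nat_var s' ''k'' = k" and inv: "?Inv k s'" and fr: "frame ?F s s'"
    have same: "nat_var s' ''mid'' = m" "nat_var s' ''hi'' = h" "nat_arr s' ''buf'' = buf"
      "length (nat_arr s' ''tmp'') = length tmp0"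
      by (simp_all add: frameD[OF fr] merge_body_def take_from_def assms)
    let ?i = "nat_var s' ''i''" and ?j = "nat_var s' ''j''"
    have ij: "lo \<le> ?i" "?i \<le> m" "m \<le> ?j" "?j \<le> h" "k + m = ?i + ?j" using inv by (auto simp: merging_def)
    have s: "sorted (map ckey (slice buf ?i m))" "sorted (map ckey (slice buf ?j h))"
      using suffix[OF sorted(1) ij(1)] suffix[OF sorted(2) ij(3)] .
    \<comment> \<open>With the left run used up, \<open>k < h\<close> leaves an entry in the right
      one, so the read at \<open>j\<close> is within bounds.\<close>
    have jh: "?j < h" if "?i = m" using that ij k by linarith
    show "wp I merge_body s' (\<lambda>t s''. t \<le> 50 \<and> nat_var s'' ''k'' = k \<and>
        ?Inv (Suc k) (s''\<lparr>nat_var := (nat_var s'')(''k'' := Suc k)\<rparr>))"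
      unfolding merge_body_def take_from_def
      using merging_left[OF inv _ len(1) _ s] merging_right[OF inv _ len(1) _ s] ij k same len codes jh ord
      by (cases "?j < h") (auto simp: rval_key rsafe_key rcost_key not_le)
  qed (use assms in \<open>auto simp: frameD merge_body_def take_from_def\<close>)
  then show ?thesis
  proof (rule wp_mono)
    fix t s' assume "t \<le> (h - lo) * (50 + 7 + ncost (Var ''hi'')) + 4 + ncost (Var ''lo'') + ncost (Var ''hi'') \<and>
      nat_var s' ''k'' = h \<and> frame ?F s s' \<and> ?Inv h s'"
    then have t: "t \<le> (h - lo) * 58 + 6" and inv: "?Inv h s'" by simp_all
    have "nat_var s' ''i'' = m" "nat_var s' ''j'' = h" using inv by (auto simp: merging_def)
    moreover have "mset (slice buf lo m) + mset (slice buf m h) = mset (slice buf lo h)"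
      using slice_append[OF ord, of buf] by (metis mset_append)
    ultimately show "t \<le> (h - lo) * 60 + 6 \<and>
      take lo (nat_arr s' ''tmp'') = take lo tmp0 \<and>
      mset (slice (nat_arr s' ''tmp'') lo h) = mset (slice buf lo h) \<and>
      sorted (map ckey (slice (nat_arr s' ''tmp'') lo h))"
      using t inv by (auto simp: merging_def)
  qed
qed


lemma wp_merge_runs:
  assumes lo: "nat_var s ''lo'' = lo" and w: "nat_var s ''w'' = w" and cnt: "nat_var s ''cnt'' = cnt"
    and m: "m = min (lo + w) cnt" and h: "h = min (lo + w + w) cnt" and "lo < cnt"
    and buf: "nat_arr s ''buf'' = buf" and tmp: "nat_arr s ''tmp'' = tmp0"
    and len: "cnt \<le> length buf" "cnt \<le> length tmp0"
    and codes: "\<And>p. p < cnt \<Longrightarrow> buf ! p < n * n"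
    and sorted: "sorted (map ckey (slice buf lo m))" "sorted (map ckey (slice buf m h))"
  shows "wp I merge_runs s (\<lambda>t s'. t \<le> (h - lo) * 60 + 60 \<and> nat_var s' ''hi'' = h \<and>
    take lo (nat_arr s' ''tmp'') = take lo tmp0 \<and>
    mset (slice (nat_arr s' ''tmp'') lo h) = mset (slice buf lo h) \<and>
    sorted (map ckey (slice (nat_arr s' ''tmp'') lo h)))"
proof -
  let ?F = "For ''k'' (Var ''lo'') (Var ''hi'') merge_body"
  have loop: "wp I ?F s2 Q"
    if "nat_var s2 ''lo'' = lo" "nat_var s2 ''mid'' = m" "nat_var s2 ''hi'' = h"
      "nat_var s2 ''i'' = lo" "nat_var s2 ''j'' = m" "nat_arr s2 ''buf'' = buf" "nat_arr s2 ''tmp'' = tmp0"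
      and Q: "\<And>t s'. t \<le> (h - lo) * 60 + 6 \<and> take lo (nat_arr s' ''tmp'') = take lo tmp0 \<and>
        mset (slice (nat_arr s' ''tmp'') lo h) = mset (slice buf lo h) \<and>
        sorted (map ckey (slice (nat_arr s' ''tmp'') lo h)) \<Longrightarrow> nat_var s' ''hi'' = h \<Longrightarrow> Q t s'" for s2 Q
    by (rule wp_frame[OF wp_merge_loop[OF that(1-7)]])
      (use m h \<open>lo < cnt\<close> len codes sorted that(3) in
        \<open>auto intro!: Q simp: frameD merge_body_def take_from_def\<close>)
  show ?thesis
    unfolding merge_runs_def merge_body_def[symmetric]
    using lo w cnt buf tmp m h by (auto intro!: loop simp: min_def)
qed

text \<open>Blocks that start at or beyond \<open>cnt\<close> are empty slices and count as sorted,
  so the truncated end of the buffer fits the same formula.\<close>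

definition runs :: "nat \<Rightarrow> nat list \<Rightarrow> nat \<Rightarrow> bool" where
  "runs cnt xs w \<longleftrightarrow> (\<forall>q. sorted (map ckey (slice xs (q * w) (min (q * w + w) cnt))))"

lemma wp_merge_pass:
  assumes lo: "nat_var s ''lo'' = 0" and w: "nat_var s ''w'' = w" "0 < w" and cnt: "nat_var s ''cnt'' = cnt"
    and buf: "nat_arr s ''buf'' = buf" and len: "cnt \<le> length buf" "cnt \<le> length (nat_arr s ''tmp'')"
    and codes: "\<And>p. p < cnt \<Longrightarrow> buf ! p < n * n"
    and runs: "runs cnt buf w"
  shows "wp I (While (NLess (Var ''lo'') (Var ''cnt'')) (merge_runs ;; ''lo'' ::= Var ''hi'')) s
    (\<lambda>t s'. t \<le> cnt * 130 + 4 \<and> mset (take cnt (nat_arr s' ''tmp'')) = mset (take cnt buf) \<and>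
      runs cnt (nat_arr s' ''tmp'') (w + w))"
proof -
  let ?b = "NLess (Var ''lo'') (Var ''cnt'')" and ?c = "merge_runs ;; ''lo'' ::= Var ''hi''"
  let ?ww = "w + w"
  let ?Q = "\<lambda>s'. mset (take cnt (nat_arr s' ''tmp'')) = mset (take cnt buf) \<and> runs cnt (nat_arr s' ''tmp'') ?ww"
  define Inv where "Inv k s' \<longleftrightarrow> (\<exists>q. nat_var s' ''lo'' = min (q * ?ww) cnt \<and>
      mset (take (nat_var s' ''lo'') (nat_arr s' ''tmp'')) = mset (take (nat_var s' ''lo'') buf) \<and>
      (\<forall>p<q. sorted (map ckey (slice (nat_arr s' ''tmp'') (p * ?ww) (min (p * ?ww + ?ww) cnt)))) \<and>
      k = (cnt - nat_var s' ''lo'') * 130 + 4)" for k and s' :: store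
  have same: "nat_var s' ''w'' = w" "nat_var s' ''cnt'' = cnt" "nat_arr s' ''buf'' = buf"
    "length (nat_arr s' ''tmp'') = length (nat_arr s ''tmp'')" if "frame ?c s s'" for s'
    by (simp_all add: frameD[OF that] merge_runs_def take_from_def assms)
  have "wp I (While ?b ?c) s (\<lambda>t s'. t \<le> cnt * 130 + 4 \<and> ?Q s' \<and> frame ?c s s')"
  proof (rule wp_While[where Inv = Inv])
    show "Inv (cnt * 130 + 4) s" unfolding Inv_def by (rule exI[of _ 0]) (simp add: lo)
    show "bsafe I s' ?b" for s' by simp
    fix k s' assume inv: "Inv k s'" and fr: "frame ?c s s'"
    from inv obtain q where q: "nat_var s' ''lo'' = min (q * ?ww) cnt"
      and ms: "mset (take (nat_var s' ''lo'') (nat_arr s' ''tmp'')) = mset (take (nat_var s' ''lo'') buf)"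
      and so: "\<And>p. p < q \<Longrightarrow> sorted (map ckey (slice (nat_arr s' ''tmp'') (p * ?ww) (min (p * ?ww + ?ww) cnt)))"
      and k: "k = (cnt - nat_var s' ''lo'') * 130 + 4" unfolding Inv_def by blast
    note same = same[OF fr]
    {
      assume "bval I s' ?b"
      then have less: "nat_var s' ''lo'' < cnt" using same by simp
      let ?lo = "q * ?ww"
      have lo: "nat_var s' ''lo'' = ?lo" using q less by simp
      define m where "m = min (?lo + w) cnt"
      define h where "h = min (?lo + w + w) cnt"
      \<comment> \<open>Block \<open>q\<close> of length \<open>2 * w\<close> consists of the blocks
        \<open>2 * q\<close> and \<open>Suc (2 * q)\<close> of length \<open>w\<close>.\<close>
      have e1: "2 * q * w = ?lo" and e2: "Suc (2 * q) * w = ?lo + w" by (simp_all add: algebra_simps)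
      have s1: "sorted (map ckey (slice buf ?lo m))"
        using runs[unfolded runs_def, rule_format, of "2 * q"] unfolding e1 m_def .
      have s2: "sorted (map ckey (slice buf m h))"
      proof (cases "?lo + w < cnt")
        case True
        then show ?thesis
          using runs[unfolded runs_def, rule_format, of "Suc (2 * q)"] unfolding e2
          by (simp add: m_def h_def)
      qed (simp add: m_def h_def)
      have lh: "?lo < h" "h \<le> cnt" using less lo w(2) by (auto simp: h_def)
      have Inv': "Inv ((cnt - h) * 130 + 4) s''"
        if "nat_var s'' ''lo'' = h" "take ?lo (nat_arr s'' ''tmp'') = take ?lo (nat_arr s' ''tmp'')"
          "mset (slice (nat_arr s'' ''tmp'') ?lo h) = mset (slice buf ?lo h)"
          "sorted (map ckey (slice (nat_arr s'' ''tmp'') ?lo h))" for s''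
      proof -
        have "mset (take h (nat_arr s'' ''tmp'')) = mset (take h buf)"
          using that(2,3) ms lh lo take_slice[of ?lo h] by (metis less_imp_le mset_append)
        moreover have "sorted (map ckey (slice (nat_arr s'' ''tmp'') (p * ?ww) (min (p * ?ww + ?ww) cnt)))"
          if "p < Suc q" for p
        proof (cases "p = q")
          case True
          then show ?thesis using \<open>sorted (map ckey (slice (nat_arr s'' ''tmp'') ?lo h))\<close>
            by (simp add: h_def add.assoc)
        next
          case False
          then have "p < q" using that by simp
          then have "Suc p * ?ww \<le> ?lo" by (intro mult_right_mono) auto
          then have "slice (nat_arr s'' ''tmp'') (p * ?ww) (min (p * ?ww + ?ww) cnt)
              = slice (nat_arr s' ''tmp'') (p * ?ww) (min (p * ?ww + ?ww) cnt)"
            using \<open>take ?lo (nat_arr s'' ''tmp'') = take ?lo (nat_arr s' ''tmp'')\<close>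
            by (intro slice_eq_if_take_eq[of ?lo]) auto
          then show ?thesis using so[OF \<open>p < q\<close>] by simp
        qed
        moreover have "h = min (Suc q * ?ww) cnt" by (simp add: h_def algebra_simps)
        ultimately show ?thesis unfolding Inv_def that(1) by blast
      qed
      have gain: "(h - ?lo) * 130 + (cnt - h) * 130 = (cnt - ?lo) * 130"
        unfolding add_mult_distrib[symmetric] using lh by simp
      \<comment> \<open>A merged block is nonempty, so the fixed overhead of 70 can be charged to
        its entries; this keeps the cost of a pass linear in \<open>cnt\<close> even for many short
        runs.\<close>
      have "(h - ?lo) * 60 + 70 \<le> (h - ?lo) * 130" using lh by linarith
      with gain have time: "1 + bcost ?b + (t + 2) + ((cnt - h) * 130 + 4) \<le> k"
        if "t \<le> (h - ?lo) * 60 + 60" for t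
        using that by (simp add: k lo)
      have "wp I ?c s' (\<lambda>t s''. Inv ((cnt - h) * 130 + 4) s'' \<and>
          1 + bcost ?b + t + ((cnt - h) * 130 + 4) \<le> k)"
        unfolding wp_Seq
        by (rule wp_mono[OF wp_merge_runs[OF lo same(1,2) m_def h_def _ same(3) refl len(1)]])
          (use len same s1 s2 codes less lo Inv' time in auto)
      then show "wp I ?c s' (\<lambda>t s''. \<exists>k'. Inv k' s'' \<and> 1 + bcost ?b + t + k' \<le> k)"
        by (rule wp_mono) blast
    }
    {
      assume "\<not> bval I s' ?b"
      then have lo: "nat_var s' ''lo'' = cnt" using same q by simp
      then have cq: "cnt \<le> q * ?ww" using q by simp
      have "sorted (map ckey (slice (nat_arr s' ''tmp'') (p * ?ww) (min (p * ?ww + ?ww) cnt)))" for p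
      proof (cases "p < q")
        case False
        then have "q * ?ww \<le> p * ?ww" by (intro mult_right_mono) auto
        then have "min (p * ?ww + ?ww) cnt \<le> p * ?ww" using cq by linarith
        then show ?thesis by (simp only: slice_empty list.map sorted_wrt.simps)
      qed (rule so)
      then show "1 + bcost ?b \<le> k \<and> ?Q s'" using ms lo k by (simp add: runs_def)
    }
  qed
  then show ?thesis by (rule wp_mono) simp
qed

lemma runs_one: "runs cnt xs 1"
proof -
  have len: "length (slice xs q (min (q + 1) cnt)) \<le> 1" for q by (simp add: length_slice)
  have "sorted (map ckey (slice xs q (min (q + 1) cnt)))" for q
    using len[of q] by (cases "slice xs q (min (q + 1) cnt)") auto
  then show ?thesis by (simp add: runs_def)
qed

lemma runs_take_eq: "take cnt xs = take cnt ys \<Longrightarrow> runs cnt xs w \<longleftrightarrow> runs cnt ys w"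
  unfolding runs_def using slice_eq_if_take_eq[of cnt xs ys] by simp

lemma wp_copy_back:
  assumes "nat_var s ''cnt'' = cnt" "nat_arr s ''tmp'' = tmp"
    and len: "cnt \<le> length (nat_arr s ''buf'')" "cnt \<le> length tmp"
  shows "wp I (For ''k'' (Lit 0) (Var ''cnt'') (Store ''buf'' (Var ''k'') (Arr ''tmp'' (Var ''k'')))) s
    (\<lambda>t s'. t \<le> cnt * 12 + 6 \<and> take cnt (nat_arr s' ''buf'') = take cnt tmp)"
proof (rule wp_mono)
  let ?c = "Store ''buf'' (Var ''k'') (Arr ''tmp'' (Var ''k''))"
  let ?F = "For ''k'' (Lit 0) (Var ''cnt'') ?c"
  show "wp I ?F s (\<lambda>t s'. t \<le> (cnt - 0) * (4 + 7 + ncost (Var ''cnt'')) + 4 + ncost (Lit 0) + ncost (Var ''cnt'') \<and>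
      nat_var s' ''k'' = cnt \<and> frame ?F s s' \<and> take cnt (nat_arr s' ''buf'') = take cnt tmp)"
  proof (rule wp_For[where Inv = "\<lambda>k s'. take k (nat_arr s' ''buf'') = take k tmp"])
    fix k s' assume k: "k < cnt" "nat_var s' ''k'' = k" and inv: "take k (nat_arr s' ''buf'') = take k tmp"
      and fr: "frame ?F s s'"
    have "nat_arr s' ''tmp'' = tmp" "length (nat_arr s' ''buf'') = length (nat_arr s ''buf'')"
      by (simp_all add: frameD[OF fr] assms)
    then show "wp I ?c s' (\<lambda>t s''. t \<le> 4 \<and> nat_var s'' ''k'' = k \<and>
        take (Suc k) (nat_arr (s''\<lparr>nat_var := (nat_var s'')(''k'' := Suc k)\<rparr>) ''buf'') = take (Suc k) tmp)"
      using k inv len by (simp add: take_Suc_conv_app_nth)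
  qed (auto simp: frameD assms)
qed auto

text \<open>The budget of the outer loop counts the remaining doublings of the run length.\<close>

lemma wp_sort_buffer:
  assumes cnt: "nat_var s ''cnt'' = cnt" "cnt \<le> 2 ^ a"
    and len: "cnt \<le> length (nat_arr s ''buf'')" "cnt \<le> length (nat_arr s ''tmp'')"
    and codes: "\<And>p. p < cnt \<Longrightarrow> nat_arr s ''buf'' ! p < n * n"
  shows "wp I sort_buffer s (\<lambda>t s'. t \<le> a * (cnt * 150 + 30) + 10 \<and>
    mset (take cnt (nat_arr s' ''buf'')) = mset (take cnt (nat_arr s ''buf'')) \<and>
    sorted (map ckey (take cnt (nat_arr s' ''buf''))))"
proof -
  let ?b = "NLess (Var ''w'') (Var ''cnt'')"
  let ?pass = "While (NLess (Var ''lo'') (Var ''cnt'')) (merge_runs ;; ''lo'' ::= Var ''hi'')"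
  let ?copy = "For ''k'' (Lit 0) (Var ''cnt'') (Store ''buf'' (Var ''k'') (Arr ''tmp'' (Var ''k'')))"
  let ?c = "''lo'' ::= Lit 0 ;; ?pass ;; ?copy ;; ''w'' ::= Var ''w'' \<oplus> Var ''w''"
  let ?buf0 = "nat_arr s ''buf''"
  let ?s1 = "s\<lparr>nat_var := (nat_var s)(''w'' := 1)\<rparr>"
  let ?R = "cnt * 150 + 30"
  let ?Q = "\<lambda>s'. mset (take cnt (nat_arr s' ''buf'')) = mset (take cnt ?buf0) \<and>
      sorted (map ckey (take cnt (nat_arr s' ''buf'')))"
  define Inv where "Inv k s' \<longleftrightarrow> (\<exists>a. cnt \<le> 2 ^ a * nat_var s' ''w'' \<and> 0 < nat_var s' ''w'' \<and>
      mset (take cnt (nat_arr s' ''buf'')) = mset (take cnt ?buf0) \<and>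
      runs cnt (nat_arr s' ''buf'') (nat_var s' ''w'') \<and> k = a * ?R + 4)" for k and s' :: store
  have "wp I (While ?b ?c) ?s1 (\<lambda>t s'. t \<le> a * ?R + 4 \<and> ?Q s' \<and> frame ?c ?s1 s')"
  proof (rule wp_While[where Inv = Inv])
    show "Inv (a * ?R + 4) ?s1"
      unfolding Inv_def by (rule exI[of _ a]) (use cnt runs_one in simp)
    show "bsafe I s' ?b" for s' by simp
    fix k s' assume inv: "Inv k s'" and fr: "frame ?c ?s1 s'"
    then obtain a where a: "cnt \<le> 2 ^ a * nat_var s' ''w''" "0 < nat_var s' ''w''"
      and ms: "mset (take cnt (nat_arr s' ''buf'')) = mset (take cnt ?buf0)"
      and runs: "runs cnt (nat_arr s' ''buf'') (nat_var s' ''w'')" and k: "k = a * ?R + 4"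
      unfolding Inv_def by blast
    have same: "nat_var s' ''cnt'' = cnt" "length (nat_arr s' ''buf'') = length ?buf0"
      "length (nat_arr s' ''tmp'') = length (nat_arr s ''tmp'')"
      by (simp_all add: frameD[OF fr] merge_runs_def take_from_def cnt)
    \<comment> \<open>The invariant preserves the multiset, not the positions, so that entries stay
      below \<open>n * n\<close> is argued through sets.\<close>
    have codes': "nat_arr s' ''buf'' ! p < n * n" if "p < cnt" for p
    proof -
      have "set (take cnt (nat_arr s' ''buf'')) = set (take cnt ?buf0)" using ms by (metis set_mset_mset)
      moreover have "nat_arr s' ''buf'' ! p \<in> set (take cnt (nat_arr s' ''buf''))"
        using that same len by (auto simp: in_set_conv_nth intro!: exI[of _ p])
      ultimately show ?thesis using codes by (fastforce simp: in_set_conv_nth)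
    qed
    {
      assume "bval I s' ?b"
      then have less: "nat_var s' ''w'' < cnt" using same by simp
      then obtain a' where a': "a = Suc a'" using a by (cases a) auto
      let ?w = "nat_var s' ''w''"
      let ?s2 = "s'\<lparr>nat_var := (nat_var s')(''lo'' := 0)\<rparr>"
      have "wp I (?copy ;; ''w'' ::= Var ''w'' \<oplus> Var ''w'') s2
          (\<lambda>t s''. t \<le> cnt * 12 + 10 \<and> Inv (a' * ?R + 4) s'')"
        if "nat_var s2 ''w'' = ?w" "nat_var s2 ''cnt'' = cnt" "length (nat_arr s2 ''buf'') = length ?buf0"
          "length (nat_arr s2 ''tmp'') = length (nat_arr s ''tmp'')"
          "mset (take cnt (nat_arr s2 ''tmp'')) = mset (take cnt (nat_arr s' ''buf''))"
          "runs cnt (nat_arr s2 ''tmp'') (?w + ?w)" for s2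
        unfolding wp_Seq
      proof (rule wp_frame[OF wp_copy_back[OF that(2) refl]])
        show "cnt \<le> length (nat_arr s2 ''buf'')" "cnt \<le> length (nat_arr s2 ''tmp'')" using that len by auto
        fix t s3 assume 3: "t \<le> cnt * 12 + 6 \<and> take cnt (nat_arr s3 ''buf'') = take cnt (nat_arr s2 ''tmp'')"
          and fr: "frame ?copy s2 s3"
        have "nat_var s3 ''w'' = ?w" using frameD[OF fr] that by simp
        moreover have "runs cnt (nat_arr s3 ''buf'') (?w + ?w)" using 3 runs_take_eq that by blast
        ultimately have "Inv (a' * ?R + 4) (s3\<lparr>nat_var := (nat_var s3)(''w'' := ?w + ?w)\<rparr>)"
          unfolding Inv_def using 3 that ms a a' by (intro exI[of _ a']) (simp add: algebra_simps)
        then show "wp I (''w'' ::= Var ''w'' \<oplus> Var ''w'') s3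
            (\<lambda>t' s''. t + t' \<le> cnt * 12 + 10 \<and> Inv (a' * ?R + 4) s'')"
          using 3 \<open>nat_var s3 ''w'' = ?w\<close> by simp
      qed
      note tail = this
      have "wp I (?pass ;; ?copy ;; ''w'' ::= Var ''w'' \<oplus> Var ''w'') ?s2
          (\<lambda>t s''. t \<le> cnt * 142 + 14 \<and> Inv (a' * ?R + 4) s'')"
        unfolding wp_Seq[of I ?pass]
      proof (rule wp_frame[OF wp_merge_pass[where w = ?w and cnt = cnt and buf = "nat_arr s' ''buf''"]])
        fix t s3 assume 3: "t \<le> cnt * 130 + 4 \<and> mset (take cnt (nat_arr s3 ''tmp'')) = mset (take cnt (nat_arr s' ''buf'')) \<and>
            runs cnt (nat_arr s3 ''tmp'') (?w + ?w)"
          and fr: "frame ?pass ?s2 s3"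
        show "wp I (?copy ;; ''w'' ::= Var ''w'' \<oplus> Var ''w'') s3
            (\<lambda>t' s''. t + t' \<le> cnt * 142 + 14 \<and> Inv (a' * ?R + 4) s'')"
          by (rule wp_mono[OF tail])
            (use 3 same in \<open>simp_all add: frameD[OF fr] merge_runs_def take_from_def\<close>)
      qed (use same a len codes' runs in auto)
      then have "wp I ?c s' (\<lambda>t s''. t \<le> cnt * 142 + 16 \<and> Inv (a' * ?R + 4) s'')"
        by (simp only: wp_Seq[of I "''lo'' ::= Lit 0"] wp_Assign nsafe.simps nval.simps ncost.simps simp_thms)
          (erule wp_mono, simp)
      then show "wp I ?c s' (\<lambda>t s''. \<exists>k'. Inv k' s'' \<and> 1 + bcost ?b + t + k' \<le> k)"
        by (rule wp_mono) (auto simp: k a')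
    }
    {
      assume "\<not> bval I s' ?b"
      \<comment> \<open>Runs at least as long as the buffer contents leave just one block, all of
        them.\<close>
      then have "cnt \<le> nat_var s' ''w''" using same by simp
      then have "sorted (map ckey (take cnt (nat_arr s' ''buf'')))"
        using runs[unfolded runs_def, rule_format, of 0] by (simp add: slice_def)
      then show "1 + bcost ?b \<le> k \<and> ?Q s'" using ms k by simp
    }
  qed
  then show ?thesis
    unfolding sort_buffer_def by (simp only: wp_Seq[of I "''w'' ::= Lit 1"] wp_Assign nsafe.simps nval.simps ncost.simps simp_thms)
      (erule wp_mono, simp)
qed

end

section \<open>Kruskal's algorithm\<close>

text \<open>The root of a vertex after a sequence of links \<open>(child, parent)\<close>.\<close>

definition collapse :: "('a \<times> 'a) list \<Rightarrow> 'a \<Rightarrow> 'a" where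
  "collapse ps z = foldl (\<lambda>z (c, p). if z = c then p else z) z ps"

lemma collapse_Nil [simp]: "collapse [] z = z"
  by (simp add: collapse_def)

lemma collapse_Cons: "collapse ((c, p) # ps) z = collapse ps (if z = c then p else z)"
  by (simp add: collapse_def)

lemma collapse_snoc: "collapse (ps @ [(c, p)]) z = (if collapse ps z = c then p else collapse ps z)"
  by (simp add: collapse_def)

lemma collapse_append: "collapse (ps @ qs) z = collapse qs (collapse ps z)"
  by (simp add: collapse_def)

text \<open>Union by size keeps the depth of a vertex below the logarithm of the size of its part; the
  depths themselves are not stored by the program.\<close>

definition union_find :: "nat \<Rightarrow> nat list \<Rightarrow> nat list \<Rightarrow> (nat \<times> nat) list \<Rightarrow> nat set set \<Rightarrow> bool" where
  "union_find n up rank ps T \<longleftrightarrow> length up = n \<and> length rank = n \<and>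
    (\<forall>x<n. collapse ps x < n \<and> up ! x < n \<and> collapse ps (up ! x) = collapse ps x \<and>
      up ! collapse ps x = collapse ps x \<and> (up ! x = x \<longrightarrow> collapse ps x = x)) \<and>
    (\<forall>x<n. \<forall>y<n. (x, y) \<in> linked T \<longleftrightarrow> collapse ps x = collapse ps y) \<and>
    (\<forall>x<n. rank ! collapse ps x = card {y. y < n \<and> collapse ps y = collapse ps x}) \<and>
    (\<exists>depth. \<forall>x<n. (if up ! x = x then depth x = 0 else depth (up ! x) < depth x) \<and>
      2 ^ depth x \<le> rank ! collapse ps x)"

lemma union_find_initial: "union_find n [0..<n] (replicate n 1) [] {}"
proof -
  have "{y. y < n \<and> y = x} = {x}" if "x < n" for x using that by auto
  then have "\<forall>x<n. replicate n 1 ! x = card {y. y < n \<and> y = x}" by simp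
  then show ?thesis unfolding union_find_def by (simp add: exI[of _ "\<lambda>_. 0"])
qed

lemma union_find_vertex:
  assumes "union_find n up rank ps T" "x < n"
  shows "collapse ps x < n" "up ! x < n" "collapse ps (up ! x) = collapse ps x"
    "up ! collapse ps x = collapse ps x" "up ! x = x \<Longrightarrow> collapse ps x = x"
    "rank ! collapse ps x = card {y. y < n \<and> collapse ps y = collapse ps x}"
  using assms by (simp_all add: union_find_def)

lemma union_find_linked:
  "union_find n up rank ps T \<Longrightarrow> x < n \<Longrightarrow> y < n \<Longrightarrow>
    (x, y) \<in> linked T \<longleftrightarrow> collapse ps x = collapse ps y"
  by (simp add: union_find_def)

lemma union_find_depth:
  assumes "union_find n up rank ps T"
  obtains depth :: "nat \<Rightarrow> nat" where
    "\<And>x. x < n \<Longrightarrow> up ! x = x \<Longrightarrow> depth x = 0"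
    "\<And>x. x < n \<Longrightarrow> up ! x \<noteq> x \<Longrightarrow> depth (up ! x) < depth x"
    "\<And>x. x < n \<Longrightarrow> 2 ^ depth x \<le> rank ! collapse ps x"
proof -
  obtain depth where d: "\<forall>x<n. (if up ! x = x then depth x = 0 else depth (up ! x) < depth x) \<and>
      2 ^ depth x \<le> rank ! collapse ps x"
    using assms unfolding union_find_def by blast
  show ?thesis
  proof (rule that[of depth])
    fix x assume "x < n"
    with d have *: "if up ! x = x then depth x = 0 else depth (up ! x) < depth x"
      and "2 ^ depth x \<le> rank ! collapse ps x" by blast+
    then show "2 ^ depth x \<le> rank ! collapse ps x" by simp
    show "depth x = 0" if "up ! x = x" using * that by simp
    show "depth (up ! x) < depth x" if "up ! x \<noteq> x" using * that by simp
  qed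
qed

text \<open>\<open>rank\<close> holds sizes of trees. Linking the root \<open>x\<close> of the tree
  that is not larger below \<open>y\<close> pushes only the vertices under \<open>x\<close> down by
  one level, and the tree they belong to at least doubles in size; so \<open>2 ^ depth\<close> stays
  bounded by the size.\<close>

lemma union_find_link:
  assumes uf: "union_find n up rank ps T"
    and ab: "a < n" "b < n" and ne: "collapse ps a \<noteq> collapse ps b"
    and xy: "{x, y} = {collapse ps a, collapse ps b}" and le: "rank ! x \<le> rank ! y"
  shows "union_find n (up[x := y]) (rank[y := rank ! y + rank ! x]) (ps @ [(x, y)]) (insert {a, b} T)"
proof -
  let ?rt = "collapse ps" and ?rt' = "collapse (ps @ [(x, y)])"
  let ?up = "up[x := y]" and ?rank = "rank[y := rank ! y + rank ! x]"
  have len: "length up = n" "length rank = n" using uf by (auto simp: union_find_def)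
  note inv = union_find_vertex[OF uf] and linked = union_find_linked[OF uf]
  note rank = inv(6)
  obtain depth :: "nat \<Rightarrow> nat" where depth:
    "\<And>x. x < n \<Longrightarrow> up ! x = x \<Longrightarrow> depth x = 0"
    "\<And>x. x < n \<Longrightarrow> up ! x \<noteq> x \<Longrightarrow> depth (up ! x) < depth x"
    "\<And>x. x < n \<Longrightarrow> 2 ^ depth x \<le> rank ! ?rt x"
    by (rule union_find_depth[OF uf], rule that) assumption+
  have cases: "x = ?rt a \<and> y = ?rt b \<or> x = ?rt b \<and> y = ?rt a" using xy by (auto simp: doubleton_eq_iff)
  have xn: "x < n" and yn: "y < n" and xy': "x \<noteq> y" and upx: "up ! x = x" and upy: "up ! y = y"
    using cases ab ne inv(1,4) by auto
  have rtx: "?rt x = x" and rty: "?rt y = y" using inv(5) xn yn upx upy by auto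
  have rt': "?rt' z = (if ?rt z = x then y else ?rt z)" for z by (simp add: collapse_snoc)

  have "?rt' z < n \<and> ?up ! z < n \<and> ?rt' (?up ! z) = ?rt' z \<and> ?up ! ?rt' z = ?rt' z \<and>
      (?up ! z = z \<longrightarrow> ?rt' z = z)" if z: "z < n" for z
  proof (cases "z = x")
    case True
    then show ?thesis using xn yn xy' len rtx rty upy by (simp add: rt')
  next
    case False
    then show ?thesis
      using z inv(1-5)[OF z] xn yn xy' len rty upy by (simp add: rt' nth_list_update)
  qed
  moreover have "(u, v) \<in> linked (insert {a, b} T) \<longleftrightarrow> ?rt' u = ?rt' v" if "u < n" "v < n" for u v
    using cases ne by (auto simp: linked_insert rt' linked that ab)
  moreover have "?rank ! ?rt' z = card {u. u < n \<and> ?rt' u = ?rt' z}" if z: "z < n" for z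
  proof (cases "?rt' z = y")
    case True
    have "{u. u < n \<and> ?rt' u = y} = {u. u < n \<and> ?rt u = ?rt y} \<union> {u. u < n \<and> ?rt u = ?rt x}"
      by (auto simp: rt' rtx rty)
    moreover have "card \<dots> = rank ! y + rank ! x"
      by (subst card_Un_disjoint) (use rank[OF yn] rank[OF xn] rtx rty xy' in auto)
    ultimately show ?thesis using True yn len by simp
  next
    case False
    then have "?rt' z = ?rt z" "?rt z \<noteq> x" by (auto simp: rt' split: if_splits)
    moreover have "{u. u < n \<and> ?rt' u = ?rt z} = {u. u < n \<and> ?rt u = ?rt z}"
      using False calculation by (auto simp: rt' split: if_splits)
    ultimately show ?thesis using False rank[OF z] by simp
  qed
  moreover have "\<exists>depth'. \<forall>z<n. (if ?up ! z = z then depth' z = 0 else depth' (?up ! z) < depth' z) \<and>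
      2 ^ depth' z \<le> ?rank ! ?rt' z"
  proof (intro exI[of _ "\<lambda>z. if ?rt z = x then Suc (depth z) else depth z"] allI impI conjI)
    fix z assume z: "z < n"
    let ?d = "\<lambda>z. if ?rt z = x then Suc (depth z) else depth z"
    show "if ?up ! z = z then ?d z = 0 else ?d (?up ! z) < ?d z"
    proof (cases "z = x")
      case True
      then show ?thesis using xn len xy' rtx rty depth(1)[OF yn upy] by simp
    next
      case False
      then have "?up ! z = up ! z" by simp
      moreover have "?rt z \<noteq> x" if "up ! z = z" using inv(5)[OF z that] False by simp
      ultimately show ?thesis using inv(3)[OF z] depth(1,2)[OF z] by simp
    qed
    show "2 ^ ?d z \<le> ?rank ! ?rt' z"
    proof (cases "?rt z = x")
      case True
      then have "2 ^ depth z \<le> rank ! x" using depth(3)[OF z] by simp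
      then show ?thesis using True le yn len by (simp add: rt')
    next
      case False
      then show ?thesis using depth(3)[OF z] yn len by (cases "?rt z = y") (simp_all add: rt')
    qed
  qed
  ultimately show ?thesis unfolding union_find_def using len by (simp del: collapse_Nil)
qed

section \<open>Cost of finding a root\<close>

context encoded
begin

text \<open>The logarithm rounded up to an integer. It bounds tree depths and counts doublings and
  halvings; it is compared with \<open>log\<close> only in the final bound.\<close>

definition lg :: nat where
  "lg = (LEAST k. n \<le> 2 ^ k)"

lemma n_le_lg: "n \<le> 2 ^ lg"
  unfolding lg_def by (rule LeastI_ex) (use less_exp less_imp_le in blast)

lemma union_find_depth_le:
  assumes uf: "union_find n up rank ps T" and x: "x < n" and d: "2 ^ d \<le> rank ! collapse ps x"
  shows "d \<le> lg"
proof -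
  have "rank ! collapse ps x = card {y. y < n \<and> collapse ps y = collapse ps x}"
    by (rule union_find_vertex(6)[OF uf x])
  also have "\<dots> \<le> card {..<n}" by (rule card_mono) auto
  finally have "rank ! collapse ps x \<le> n" by simp
  then have "(2 :: nat) ^ d \<le> 2 ^ lg" using d n_le_lg by linarith
  then show ?thesis by simp
qed

lemma frame_find_root:
  assumes "frame (find_root x) s s'"
  shows "s' = s\<lparr>nat_var := (nat_var s)(x := nat_var s' x)\<rparr>"
proof -
  have "nat_var s' = (nat_var s)(x := nat_var s' x)" "real_var s' = real_var s" "nat_arr s' = nat_arr s"
    "real_arr s' = real_arr s" "tape s' = tape s" "allocated s' = allocated s"
    using assms by (auto simp: frame_def find_root_def)
  then show ?thesis by (cases s; cases s') simp
qed

text \<open>A step upwards lowers the depth and costs 9 units, the last test 6. The postcondition is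
  arbitrary so that the rule can be applied in the middle of a symbolic execution.\<close>

lemma wp_find_root:
  assumes uf: "union_find n (nat_arr s ''up'') rank ps T" and x: "nat_var s x = v" "v < n"
    and Q: "\<And>t. t \<le> 9 * lg + 6 \<Longrightarrow> Q t (s\<lparr>nat_var := (nat_var s)(x := collapse ps v)\<rparr>)"
  shows "wp I (find_root x) s Q"
proof -
  let ?up = "nat_arr s ''up''"
  let ?b = "BNot (NEq (Arr ''up'' (Var x)) (Var x))" and ?c = "x ::= Arr ''up'' (Var x)"
  obtain depth :: "nat \<Rightarrow> nat" where
    "\<And>x. x < n \<Longrightarrow> ?up ! x = x \<Longrightarrow> depth x = 0" and depth:
    "\<And>x. x < n \<Longrightarrow> ?up ! x \<noteq> x \<Longrightarrow> depth (?up ! x) < depth x"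
    "\<And>x. x < n \<Longrightarrow> 2 ^ depth x \<le> rank ! collapse ps x"
    by (rule union_find_depth[OF uf], rule that) assumption+
  note inv = union_find_vertex(2,3,5)[OF uf]
  have len: "length ?up = n" using uf by (simp add: union_find_def)
  let ?Inv = "\<lambda>k s'. nat_var s' x < n \<and> collapse ps (nat_var s' x) = collapse ps v \<and>
    k = 9 * depth (nat_var s' x) + 6"
  have "wp I (While ?b ?c) s (\<lambda>t s'. t \<le> 9 * depth v + 6 \<and> nat_var s' x = collapse ps v \<and> frame ?c s s')"
  proof (rule wp_While[where Inv = ?Inv])
    show "?Inv (9 * depth v + 6) s" using x by simp
    fix k s' assume J: "?Inv k s'" and fr: "frame ?c s s'"
    have up: "nat_arr s' ''up'' = ?up" by (simp add: frameD[OF fr])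
    show "bsafe I s' ?b" using J up len by simp
    show "wp I ?c s' (\<lambda>t s''. \<exists>k'. ?Inv k' s'' \<and> 1 + bcost ?b + t + k' \<le> k)" if "bval I s' ?b"
      using that J up len inv[of "nat_var s' x"] depth(1)[of "nat_var s' x"] by simp
    show "1 + bcost ?b \<le> k \<and> nat_var s' x = collapse ps v" if "\<not> bval I s' ?b"
      using that J up inv[of "nat_var s' x"] by simp
  qed
  moreover have "depth v \<le> lg" by (rule union_find_depth_le[OF uf x(2) depth(2)[OF x(2)]])
  ultimately show ?thesis
  proof (unfold find_root_def, elim wp_frame)
    fix t s' assume "t \<le> 9 * depth v + 6 \<and> nat_var s' x = collapse ps v \<and> frame ?c s s'"
      and "frame (While ?b ?c) s s'"
    then show "Q t s'"
      using Q[of t] \<open>depth v \<le> lg\<close> frame_find_root[of x s s'] by (simp add: find_root_def)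
  qed
qed

section \<open>Edge codes and the invariant of Kruskal's algorithm\<close>

definition edge :: "nat \<Rightarrow> nat set" where
  "edge e = {e div n, e mod n}"

definition codes :: "nat set" where
  "codes = {e. e < n * n \<and> e div n \<noteq> e mod n}"

lemma edge_pairs: "e \<in> codes \<Longrightarrow> edge e \<in> pairs {..<n}"
  using n_pos by (auto simp: codes_def edge_def pair_in_pairs div_less)

lemma weight_edge: "e \<in> codes \<Longrightarrow> weight cen (edge e) = ckey e"
  by (auto simp: codes_def edge_def weight_def ckey_def)

abbreviation edges :: "nat list \<Rightarrow> nat set set" where
  "edges xs \<equiv> edge ` set xs"

lemma edges_pairs: "set A \<subseteq> codes \<Longrightarrow> edges A \<subseteq> pairs {..<n}"
  using edge_pairs by auto

text \<open>Links and edges agree on every prefix, not only as a whole. This allows the partition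
  after any \<open>t\<close> merges to be replayed from the links once the forest is
  complete.\<close>

definition forest_list :: "(nat \<times> nat) list \<Rightarrow> nat list \<Rightarrow> bool" where
  "forest_list ps A \<longleftrightarrow> length ps = length A \<and> set A \<subseteq> codes \<and> set ps \<subseteq> {..<n} \<times> {..<n} \<and>
    (\<nexists>p. cycle (edges A) p) \<and> distinct (map edge A) \<and>
    (\<forall>t \<le> length A. \<forall>x<n. \<forall>y<n. collapse (take t ps) x = collapse (take t ps) y \<longleftrightarrow>
      (x, y) \<in> linked (edges (take t A)))"

lemma forest_list_length:
  assumes "forest_list ps A"
  shows "length A < n"
proof -
  have "card (edges A) < card {..<n}"
    by (rule card_forest_less) (use assms n_pos edges_pairs in \<open>auto simp: forest_list_def\<close>)
  moreover have "card (edges A) = length A"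
    using assms distinct_card[of "map edge A"] by (simp add: forest_list_def)
  ultimately show ?thesis by simp
qed

lemma forest_list_snoc:
  assumes fl: "forest_list ps A" and uf: "union_find n up rank (ps @ [(x, y)]) (insert (edge e) (edges A))"
    and e: "e \<in> codes" and xy: "x < n" "y < n"
    and nl: "collapse ps (e div n) \<noteq> collapse ps (e mod n)"
  shows "forest_list (ps @ [(x, y)]) (A @ [e])"
proof -
  have dm: "e div n < n" "e mod n < n" using e n_pos by (auto simp: codes_def div_less)
  have part: "collapse (take t ps) u = collapse (take t ps) v \<longleftrightarrow> (u, v) \<in> linked (edges (take t A))"
    if "t \<le> length A" "u < n" "v < n" for t u v
    using fl that unfolding forest_list_def by blast
  have len: "length ps = length A" using fl by (simp add: forest_list_def)
  have nlinked: "(e div n, e mod n) \<notin> linked (edges A)"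
    using part[of "length A"] dm nl len by simp
  then have "edge e \<notin> edges A" using linked_edge[of "e div n" "e mod n" "edges A"] by (auto simp: edge_def)
  moreover have "\<nexists>p. cycle (insert (edge e) (edges A)) p"
    unfolding edge_def[of e] using fl by (intro acyclic_insert nlinked) (auto simp: forest_list_def)
  moreover have "collapse (take t (ps @ [(x, y)])) u = collapse (take t (ps @ [(x, y)])) v \<longleftrightarrow>
      (u, v) \<in> linked (edges (take t (A @ [e])))" if "t \<le> Suc (length A)" "u < n" "v < n" for t u v
  proof (cases "t = Suc (length A)")
    case True
    then show ?thesis using uf that len unfolding union_find_def by simp
  next
    case False
    then show ?thesis using part that len by simp
  qed
  ultimately show ?thesis using fl e xy unfolding forest_list_def by simp
qed

text \<open>Accepted edges overwrite the front of the buffer that is still being read;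
  \<open>acc \<le> i\<close> keeps the unread entries of the sorted list \<open>B\<close>
  intact.\<close>

definition kruskal_state :: "nat list \<Rightarrow> nat \<Rightarrow> nat list \<Rightarrow> nat \<Rightarrow> nat list \<Rightarrow> nat list \<Rightarrow>
    nat list \<Rightarrow> nat list \<Rightarrow> bool" where
  "kruskal_state B i buf acc up rank child parent \<longleftrightarrow>
    acc \<le> i \<and> length B \<le> length buf \<and> length child = n \<and> length parent = n \<and>
    (\<forall>p. i \<le> p \<longrightarrow> p < length B \<longrightarrow> buf ! p = B ! p) \<and>
    set (take acc buf) \<subseteq> set (take i B) \<and> sorted (map ckey (take acc buf)) \<and>
    dominates (weight cen) (edges (take acc buf)) (edges (take i B)) \<and>
    (\<exists>ps. union_find n up rank ps (edges (take acc buf)) \<and> forest_list ps (take acc buf) \<and>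
      (\<forall>j<acc. ps ! j = (child ! j, parent ! j)))"

text \<open>The accepted edges come from earlier in the sorted list, so none is heavier than the
  current edge; if they link its ends, they dominate it.\<close>

lemma kruskal_state_skip:
  assumes K: "kruskal_state B i buf acc up rank child parent" and i: "i < length B"
    and B: "set B \<subseteq> codes" "sorted (map ckey B)"
    and lk: "(B ! i div n, B ! i mod n) \<in> linked (edges (take acc buf))"
  shows "kruskal_state B (Suc i) buf acc up rank child parent"
proof -
  let ?A = "take acc buf" and ?e = "B ! i"
  have tk: "set (take (Suc i) B) = insert ?e (set (take i B))" using i by (simp add: take_Suc_conv_app_nth)
  have sub: "set ?A \<subseteq> set (take i B)" using K by (simp add: kruskal_state_def)
  have eB: "?e \<in> codes" using B i by auto
  have "dominates (weight cen) (edges ?A) {edge ?e}"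
    unfolding dominates_def
  proof (intro allI impI)
    fix a c assume "{a, c} \<in> {edge ?e}"
    then have ac: "{a, c} = edge ?e" by simp
    have "weight cen f \<le> weight cen (edge ?e)" if f: "f \<in> edges ?A" for f
    proof -
      obtain g where g: "g \<in> set (take i B)" "f = edge g" using f sub by auto
      then obtain j where j: "j < i" "g = B ! j" "j < length B" by (auto simp: in_set_conv_nth)
      then have "ckey g \<le> ckey ?e" using sorted_nth_mono[OF B(2), of j i] i by simp
      moreover have "g \<in> codes" using j B by auto
      ultimately show ?thesis using g eB by (simp add: weight_edge)
    qed
    then have "{f \<in> edges ?A. weight cen f \<le> weight cen {a, c}} = edges ?A" unfolding ac by auto
    moreover have "(a, c) \<in> linked (edges ?A)"
      using ac lk unfolding edge_def by (auto simp: doubleton_eq_iff dest: linked_symD)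
    ultimately show "(a, c) \<in> linked {f \<in> edges ?A. weight cen f \<le> weight cen {a, c}}" by simp
  qed
  then have "dominates (weight cen) (edges ?A) (edges (take (Suc i) B))"
    using K dominates_Un[of "weight cen" "edges ?A" "{edge ?e}" "edges (take i B)"]
    by (simp add: tk kruskal_state_def)
  then show ?thesis using K tk unfolding kruskal_state_def by auto
qed

lemma kruskal_state_link:
  assumes K: "kruskal_state B i buf acc up rank child parent" and i: "i < length B"
    and B: "set B \<subseteq> codes" "sorted (map ckey B)"
    and e: "e = buf ! i"
    and uf: "union_find n up rank ps (edges (take acc buf))"
    and ne: "collapse ps (e div n) \<noteq> collapse ps (e mod n)"
    and xy: "{x, y} = {collapse ps (e div n), collapse ps (e mod n)}" and le: "rank ! x \<le> rank ! y"
  shows "acc < n \<and> kruskal_state B (Suc i) (buf[acc := e]) (Suc acc) (up[x := y])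
    (rank[y := rank ! y + rank ! x]) (child[acc := x]) (parent[acc := y])"
proof -
  let ?A = "take acc buf"
  have e': "e = B ! i" using K i e by (auto simp: kruskal_state_def)
  have ec: "e \<in> codes" using B i e' by auto
  have dm: "e div n < n" "e mod n < n" using ec n_pos by (auto simp: codes_def div_less)
  obtain qs where qs: "union_find n up rank qs (edges ?A)" "forest_list qs ?A"
    "\<And>j. j < acc \<Longrightarrow> qs ! j = (child ! j, parent ! j)"
    using K unfolding kruskal_state_def by blast
  have len: "acc \<le> i" "length B \<le> length buf" "length child = n" "length parent = n"
    using K by (auto simp: kruskal_state_def)
  have lqs: "length qs = acc" using qs(2) len i by (simp add: forest_list_def min_def)
  note rtn = union_find_vertex(1,4)[OF uf]
  note root = union_find_vertex(5)[OF qs(1)]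
  \<comment> \<open>The links \<open>ps\<close> supplied by the caller and the links
    \<open>qs\<close> hidden in the state describe the same arrays, and a root is its own collapse,
    so both find the same roots.\<close>
  have same: "collapse qs u = collapse ps u" if u: "u < n" for u
  proof -
    have "collapse ps (collapse ps u) = collapse ps u"
      by (rule union_find_vertex(5)[OF uf rtn(1)[OF u] rtn(2)[OF u]])
    then have "(u, collapse ps u) \<in> linked (edges ?A)"
      using union_find_linked[OF uf u rtn(1)[OF u]] by simp
    then have "collapse qs u = collapse qs (collapse ps u)"
      using union_find_linked[OF qs(1) u rtn(1)[OF u]] by simp
    then show ?thesis using root rtn[OF u] by simp
  qed
  have xn: "x < n" "y < n" using xy rtn dm by (auto simp: doubleton_eq_iff)
  have uf': "union_find n (up[x := y]) (rank[y := rank ! y + rank ! x]) (qs @ [(x, y)]) (insert (edge e) (edges ?A))"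
    unfolding edge_def[of e]
    by (rule union_find_link[OF qs(1) dm]) (use ne xy le same dm in auto)
  have fl: "forest_list (qs @ [(x, y)]) (?A @ [e])"
    by (rule forest_list_snoc[OF qs(2) uf' ec xn]) (use same ne dm in simp)
  \<comment> \<open>Even with the new edge the forest has fewer than \<open>n\<close> edges, so
    \<open>child\<close> and \<open>parent\<close> have room at \<open>acc\<close>.\<close>
  have accn: "acc < n" using forest_list_length[OF fl] len i by simp
  have tk: "take (Suc acc) (buf[acc := e]) = ?A @ [e]"
    using len i by (simp add: take_Suc_conv_app_nth)
  have tkB: "take (Suc i) B = take i B @ [e]" using i e' by (simp add: take_Suc_conv_app_nth)
  have sub: "set ?A \<subseteq> set (take i B)" using K by (simp add: kruskal_state_def)
  have "ckey g \<le> ckey e" if "g \<in> set ?A" for g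
  proof -
    have "g \<in> set (take i B)" using that sub by blast
    then obtain j where "j < i" "g = B ! j" "j < length B" by (auto simp: in_set_conv_nth)
    then show ?thesis using sorted_nth_mono[OF B(2), of j i] i e' by simp
  qed
  then have "sorted (map ckey (?A @ [e]))" using K by (simp add: kruskal_state_def sorted_append)
  moreover have "dominates (weight cen) (edges (?A @ [e])) (edges (take (Suc i) B))"
  proof -
    have "dominates (weight cen) (edges (?A @ [e])) (edges (take i B))"
      by (rule dominates_mono[of _ "edges ?A" "edges (take i B)"]) (use K in \<open>auto simp: kruskal_state_def\<close>)
    moreover have "dominates (weight cen) (edges (?A @ [e])) {edge e}" by (rule dominates_refl) auto
    ultimately show ?thesis using dominates_Un tkB by fastforce
  qed
  moreover have "(qs @ [(x, y)]) ! j = (child[acc := x] ! j, parent[acc := y] ! j)" if "j < Suc acc" for j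
    using that qs(3) lqs accn len by (cases "j = acc") (auto simp: nth_append)
  moreover have "buf[acc := e] ! p = B ! p" if "Suc i \<le> p" "p < length B" for p
    using that K len by (auto simp: kruskal_state_def)
  ultimately show ?thesis
    unfolding kruskal_state_def tk using accn len uf' fl tkB sub
    by (intro conjI exI[of _ "qs @ [(x, y)]"]) auto
qed

end

lemma not_cycle_empty: "\<not> cycle {} p"
  by (auto simp: cycle_def intro!: exI[of _ 0])

section \<open>The run of Kruskal's algorithm\<close>

context encoded
begin

abbreviation kruskal_init :: com where
  "kruskal_init \<equiv> For ''x'' (Lit 0) N
     (Store ''up'' (Var ''x'') (Var ''x'') ;; Store ''rank'' (Var ''x'') (Lit 1))"

lemma wp_kruskal_init:
  assumes len: "length (nat_arr s ''up'') = n" "length (nat_arr s ''rank'') = n"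
  shows "wp I kruskal_init s
    (\<lambda>t s'. t \<le> n * 15 + 7 \<and> nat_arr s' ''up'' = [0..<n] \<and> nat_arr s' ''rank'' = replicate n 1)"
proof (rule wp_mono)
  let ?c = "Store ''up'' (Var ''x'') (Var ''x'') ;; Store ''rank'' (Var ''x'') (Lit 1)"
  let ?F = "For ''x'' (Lit 0) N ?c"
  let ?Inv = "\<lambda>x s'. take x (nat_arr s' ''up'') = [0..<x] \<and> take x (nat_arr s' ''rank'') = replicate x 1"
  show "wp I ?F s (\<lambda>t s'. t \<le> (n - 0) * (6 + 7 + ncost N) + 4 + ncost (Lit 0) + ncost N \<and>
      nat_var s' ''x'' = n \<and> frame ?F s s' \<and> ?Inv n s')"
  proof (rule wp_For[where Inv = ?Inv])
    fix x s' assume x: "x < n" "nat_var s' ''x'' = x" and inv: "?Inv x s'" and fr: "frame ?F s s'"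
    have "length (nat_arr s' ''up'') = n" "length (nat_arr s' ''rank'') = n"
      by (simp_all add: frameD[OF fr] len)
    then show "wp I ?c s' (\<lambda>t s''. t \<le> 6 \<and> nat_var s'' ''x'' = x \<and>
        ?Inv (Suc x) (s''\<lparr>nat_var := (nat_var s'')(''x'' := Suc x)\<rparr>))"
      using x inv by (simp add: take_Suc_conv_app_nth replicate_append_same)
  qed (auto simp: n_in)
  fix t s' assume *: "t \<le> (n - 0) * (6 + 7 + ncost N) + 4 + ncost (Lit 0) + ncost N \<and>
      nat_var s' ''x'' = n \<and> frame ?F s s' \<and> ?Inv n s'"
  then have "length (nat_arr s' ''up'') = n" "length (nat_arr s' ''rank'') = n"
    using len by (simp_all add: frame_def)
  then show "t \<le> n * 15 + 7 \<and> nat_arr s' ''up'' = [0..<n] \<and> nat_arr s' ''rank'' = replicate n 1"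
    using * by simp
qed

definition kruskal_body :: com where
  "kruskal_body = (''e'' ::= Arr ''buf'' (Var ''i'') ;;
      ''x'' ::= Var ''e'' \<oslash> N ;; find_root ''x'' ;;
      ''y'' ::= Var ''e'' \<odot> N ;; find_root ''y'' ;;
      Cond (NEq (Var ''x'') (Var ''y'')) Skip
       (Cond (NLess (Arr ''rank'' (Var ''y'')) (Arr ''rank'' (Var ''x'')))
          (''z'' ::= Var ''x'' ;; ''x'' ::= Var ''y'' ;; ''y'' ::= Var ''z'') Skip ;;
        Store ''up'' (Var ''x'') (Var ''y'') ;;
        Store ''rank'' (Var ''y'') (Arr ''rank'' (Var ''y'') \<oplus> Arr ''rank'' (Var ''x'')) ;;
        Store ''child'' (Var ''acc'') (Var ''x'') ;;
        Store ''parent'' (Var ''acc'') (Var ''y'') ;;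
        Store ''buf'' (Var ''acc'') (Var ''e'') ;;
        ''acc'' ::= Var ''acc'' \<oplus> Lit 1))"

definition kruskal_store :: "nat list \<Rightarrow> nat \<Rightarrow> store \<Rightarrow> bool" where
  "kruskal_store B i s \<longleftrightarrow> kruskal_state B i (nat_arr s ''buf'') (nat_var s ''acc'')
    (nat_arr s ''up'') (nat_arr s ''rank'') (nat_arr s ''child'') (nat_arr s ''parent'')"

lemma wp_kruskal_body:
  assumes K: "kruskal_store B i s" and i: "nat_var s ''i'' = i" "i < length B"
    and B: "set B \<subseteq> codes" "sorted (map ckey B)"
  shows "wp I kruskal_body s (\<lambda>t s'. t \<le> 18 * lg + 90 \<and> nat_var s' ''i'' = i \<and>
    kruskal_store B (Suc i) (s'\<lparr>nat_var := (nat_var s')(''i'' := Suc i)\<rparr>))"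
proof -
  let ?A = "take (nat_var s ''acc'') (nat_arr s ''buf'')"
  note K' = K[unfolded kruskal_store_def]
  define e where "e = nat_arr s ''buf'' ! i"
  obtain ps where uf: "union_find n (nat_arr s ''up'') (nat_arr s ''rank'') ps (edges ?A)"
    using K' unfolding kruskal_state_def by blast
  have e: "e = B ! i" and ilen: "i < length (nat_arr s ''buf'')"
    and len: "length (nat_arr s ''child'') = n" "length (nat_arr s ''parent'') = n"
    "nat_var s ''acc'' \<le> i"
    using K' i by (auto simp: kruskal_state_def e_def)
  have lenu: "length (nat_arr s ''up'') = n" "length (nat_arr s ''rank'') = n"
    using uf by (auto simp: union_find_def)
  have "e \<in> codes" using e i B by auto
  then have dm: "e div n < n" "e mod n < n" using n_pos by (auto simp: codes_def div_less)
  let ?x = "collapse ps (e div n)" and ?y = "collapse ps (e mod n)"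
  have xy: "?x < n" "?y < n" using union_find_vertex(1)[OF uf] dm by auto
  have skip: "kruskal_state B (Suc i) (nat_arr s ''buf'') (nat_var s ''acc'')
      (nat_arr s ''up'') (nat_arr s ''rank'') (nat_arr s ''child'') (nat_arr s ''parent'')" if "?x = ?y"
    by (rule kruskal_state_skip[OF K' i(2) B]) (use that union_find_linked[OF uf dm] e in simp)
  note link = kruskal_state_link[OF K' i(2) B e_def uf]
  show ?thesis
    unfolding kruskal_body_def
    apply (simp add: i ilen n_in n_pos flip: e_def)
    apply (rule wp_find_root[where v = "e div n", OF _ _ dm(1)])
      apply (use uf in simp)
     apply simp
    apply (simp add: n_in n_pos)
    apply (rule wp_find_root[where v = "e mod n", OF _ _ dm(2)])
      apply (use uf in simp)
     apply simp
    using xy lenu len ilen link[of ?x ?y] link[of ?y ?x] skip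
    by (auto simp: kruskal_store_def insert_commute i not_less)
qed

lemma wp_kruskal_loop:
  assumes K: "kruskal_store B 0 s" and cnt: "nat_var s ''cnt'' = length B"
    and B: "set B \<subseteq> codes" "sorted (map ckey B)"
  shows "wp I (For ''i'' (Lit 0) (Var ''cnt'') kruskal_body) s
    (\<lambda>t s'. t \<le> length B * (18 * lg + 98) + 6 \<and> kruskal_store B (length B) s')"
proof (rule wp_mono)
  let ?F = "For ''i'' (Lit 0) (Var ''cnt'') kruskal_body"
  show "wp I ?F s (\<lambda>t s'. t \<le> (length B - 0) * (18 * lg + 90 + 7 + ncost (Var ''cnt'')) + 4 + ncost (Lit 0) + ncost (Var ''cnt'') \<and>
      nat_var s' ''i'' = length B \<and> frame ?F s s' \<and> kruskal_store B (length B) s')"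
  proof (rule wp_For[where Inv = "kruskal_store B"])
    show "kruskal_store B 0 (s\<lparr>nat_var := (nat_var s)(''i'' := 0)\<rparr>)"
      using K by (simp add: kruskal_store_def)
    fix i s' assume i: "nat_var s' ''i'' = i" and K: "kruskal_store B i s'" and fr: "frame ?F s s'"
    show "nsafe I s' (Var ''cnt'') \<and> nval I s' (Var ''cnt'') = length B"
      using frameD(1)[OF fr, of "''cnt''"] cnt by (simp add: kruskal_body_def find_root_def)
    show "wp I kruskal_body s' (\<lambda>t s''. t \<le> 18 * lg + 90 \<and> nat_var s'' ''i'' = i \<and>
        kruskal_store B (Suc i) (s''\<lparr>nat_var := (nat_var s'')(''i'' := Suc i)\<rparr>))" if "i < length B"
      by (rule wp_kruskal_body[OF K i that B])
  qed simp_all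
qed (simp add: ac_simps)

text \<open>Besides domination this records the links: those of the last reduction are reused for
  all partitions tried in the search.\<close>

definition reduced :: "nat set \<Rightarrow> nat list \<Rightarrow> nat \<Rightarrow> nat list \<Rightarrow> nat list \<Rightarrow> bool" where
  "reduced X buf cnt child parent \<longleftrightarrow> cnt \<le> length buf \<and> cnt < n \<and> set (take cnt buf) \<subseteq> X \<and>
    sorted (map ckey (take cnt buf)) \<and> dominates (weight cen) (edges (take cnt buf)) (edge ` X) \<and>
    (\<exists>ps. forest_list ps (take cnt buf) \<and> (\<forall>j<cnt. ps ! j = (child ! j, parent ! j)))"

abbreviation reduced_store :: "nat set \<Rightarrow> store \<Rightarrow> bool" where
  "reduced_store X s \<equiv> reduced X (nat_arr s ''buf'') (nat_var s ''cnt'') (nat_arr s ''child'') (nat_arr s ''parent'')"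

definition kruskal_time :: nat where
  "kruskal_time = 2000 * n * (lg + 1)"

lemma wp_kruskal:
  assumes cnt: "nat_var s ''cnt'' = cnt" "cnt \<le> 2 * n"
    and len: "length (nat_arr s ''buf'') = 2 * n" "length (nat_arr s ''tmp'') = 2 * n"
      "length (nat_arr s ''up'') = n" "length (nat_arr s ''rank'') = n"
      "length (nat_arr s ''child'') = n" "length (nat_arr s ''parent'') = n"
    and codes: "set (take cnt (nat_arr s ''buf'')) \<subseteq> codes"
  shows "wp I kruskal s (\<lambda>t s'. t \<le> kruskal_time \<and>
    reduced_store (set (take cnt (nat_arr s ''buf''))) s')"
proof -
  let ?loop = "For ''i'' (Lit 0) (Var ''cnt'') kruskal_body"
  let ?X = "set (take cnt (nat_arr s ''buf''))"
  let ?Q = "\<lambda>t s'. t \<le> kruskal_time \<and> reduced_store ?X s'"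
  \<comment> \<open>Sorting, initialization and the loop, plus 2 for each of the assignments to
    \<open>acc\<close> and \<open>cnt\<close>.\<close>
  have time: "(lg + 1) * (cnt * 150 + 30) + 10 + (n * 15 + 7) + 2 + (cnt * (18 * lg + 98) + 6) + 2 \<le> kruskal_time"
  proof -
    have 1: "(lg + 1) * (cnt * 150 + 30) \<le> (lg + 1) * (n * 330)"
      by (rule mult_left_mono) (use cnt n_pos in simp_all)
    have "cnt * (18 * lg + 98) \<le> (2 * n) * (98 * (lg + 1))"
      by (rule mult_mono) (use cnt in simp_all)
    with 1 show ?thesis using n_pos unfolding kruskal_time_def by (simp add: algebra_simps)
  qed
  have tail: "wp I (kruskal_init ;; ''acc'' ::= Lit 0 ;; ?loop ;; ''cnt'' ::= Var ''acc'') s1 (\<lambda>t s'. ?Q (t1 + t) s')"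
    if t1: "t1 \<le> (lg + 1) * (cnt * 150 + 30) + 10"
      and ms: "mset (take cnt (nat_arr s1 ''buf'')) = mset (take cnt (nat_arr s ''buf''))"
      and so: "sorted (map ckey (take cnt (nat_arr s1 ''buf'')))"
      and cnt1: "nat_var s1 ''cnt'' = cnt" and len1: "\<And>a. length (nat_arr s1 a) = length (nat_arr s a)"
    for t1 s1
  proof -
    define B where "B = take cnt (nat_arr s1 ''buf'')"
    have B: "set B = ?X" "sorted (map ckey B)" "length B = cnt"
      using mset_eq_setD[OF ms] so cnt len len1 by (auto simp: B_def)
    show ?thesis
      unfolding wp_Seq[of I kruskal_init]
    proof (rule wp_frame[OF wp_kruskal_init])
      show "length (nat_arr s1 ''up'') = n" "length (nat_arr s1 ''rank'') = n" using len len1 by auto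
      fix t2 s2 assume 2: "t2 \<le> n * 15 + 7 \<and> nat_arr s2 ''up'' = [0..<n] \<and> nat_arr s2 ''rank'' = replicate n 1"
        and fr: "frame kruskal_init s1 s2"
      let ?s3 = "s2\<lparr>nat_var := (nat_var s2)(''acc'' := 0)\<rparr>"
      have K: "kruskal_store B 0 ?s3"
        using 2 len len1 B union_find_initial[of n] unfolding kruskal_store_def kruskal_state_def
        by (auto simp: frameD[OF fr] B_def forest_list_def not_cycle_empty dominates_def intro!: exI[of _ "[]"])
      have "wp I (?loop ;; ''cnt'' ::= Var ''acc'') ?s3 (\<lambda>t s'. ?Q (t1 + (t2 + (2 + t))) s')"
        unfolding wp_Seq
      proof (rule wp_mono[OF wp_kruskal_loop[OF K]])
        show "nat_var ?s3 ''cnt'' = length B" by (simp add: frameD[OF fr] cnt1 B)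
        show "set B \<subseteq> codes" "sorted (map ckey B)" using B codes by auto
        fix t3 s3 assume 3: "t3 \<le> length B * (18 * lg + 98) + 6 \<and> kruskal_store B (length B) s3"
        have "reduced ?X (nat_arr s3 ''buf'') (nat_var s3 ''acc'') (nat_arr s3 ''child'') (nat_arr s3 ''parent'')"
        proof -
          have K3: "kruskal_state B (length B) (nat_arr s3 ''buf'') (nat_var s3 ''acc'') (nat_arr s3 ''up'')
              (nat_arr s3 ''rank'') (nat_arr s3 ''child'') (nat_arr s3 ''parent'')"
            using 3 by (simp add: kruskal_store_def)
          then have acc: "nat_var s3 ''acc'' \<le> length (nat_arr s3 ''buf'')" by (simp add: kruskal_state_def)
          obtain ps where ps: "forest_list ps (take (nat_var s3 ''acc'') (nat_arr s3 ''buf''))"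
            "\<forall>j<nat_var s3 ''acc''. ps ! j = (nat_arr s3 ''child'' ! j, nat_arr s3 ''parent'' ! j)"
            using K3 unfolding kruskal_state_def by blast
          have "nat_var s3 ''acc'' < n" using forest_list_length[OF ps(1)] acc by simp
          then show ?thesis using K3 acc ps B(1) unfolding reduced_def kruskal_state_def by auto
        qed
        then show "wp I (''cnt'' ::= Var ''acc'') s3 (\<lambda>t' s'. ?Q (t1 + (t2 + (2 + (t3 + t')))) s')"
          using 3 2 t1 time B(3) by simp
      qed
      then show "wp I (''acc'' ::= Lit 0 ;; ?loop ;; ''cnt'' ::= Var ''acc'') s2
          (\<lambda>t s'. ?Q (t1 + (t2 + t)) s')"
        unfolding wp_Seq[of I "''acc'' ::= Lit 0"] by simp
    qed
  qed
  show ?thesis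
    unfolding kruskal_def kruskal_body_def[symmetric] wp_Seq[of I sort_buffer]
  proof (rule wp_frame[OF wp_sort_buffer[OF cnt(1)]])
    \<comment> \<open>The buffer may hold \<open>2 * n\<close> entries, one doubling more than
      \<open>n\<close>.\<close>
    show "cnt \<le> 2 ^ (lg + 1)" using cnt n_le_lg by simp
    show "cnt \<le> length (nat_arr s ''buf'')" "cnt \<le> length (nat_arr s ''tmp'')" using cnt len by auto
    show "nat_arr s ''buf'' ! p < n * n" if "p < cnt" for p
    proof -
      have "nat_arr s ''buf'' ! p \<in> ?X" using that cnt len by (auto simp: in_set_conv_nth)
      then show ?thesis using codes by (auto simp: codes_def)
    qed
    fix t1 s1 assume 1: "t1 \<le> (lg + 1) * (cnt * 150 + 30) + 10 \<and>
        mset (take cnt (nat_arr s1 ''buf'')) = mset (take cnt (nat_arr s ''buf'')) \<and>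
        sorted (map ckey (take cnt (nat_arr s1 ''buf'')))" and fr: "frame sort_buffer s s1"
    have "nat_var s1 ''cnt'' = cnt" "\<And>a. length (nat_arr s1 a) = length (nat_arr s a)"
      by (simp_all add: frameD[OF fr] sort_buffer_def merge_runs_def take_from_def cnt)
    then show "wp I (kruskal_init ;; ''acc'' ::= Lit 0 ;; ?loop ;; ''cnt'' ::= Var ''acc'') s1 (\<lambda>t s'. ?Q (t1 + t) s')"
      using 1 tail by blast
  qed
qed

end

section \<open>Building the forest\<close>

lemma nth_concat_upt:
  assumes "x < m" "i < length (f x)"
  shows "concat (map f [0..<m]) ! (length (concat (map f [0..<x])) + i) = f x ! i"
proof -
  have "[0..<m] = [0..<x] @ x # [Suc x..<m]"
    using assms(1) upt_add_eq_append[of 0 x "m - x"] by (simp add: upt_conv_Cons)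
  then show ?thesis using assms(2) by (simp add: nth_append)
qed

section \<open>Access to the adjacency lists\<close>

context encoded
begin

definition off :: "nat \<Rightarrow> nat" where
  "off x = length (concat (map ns [0..<x]))"

lemma off_0 [simp]: "off 0 = 0"
  by (simp add: off_def)

lemma off_Suc: "off (Suc x) = off x + length (ns x)"
  by (simp add: off_def)

lemma off_mono: "x \<le> y \<Longrightarrow> off x \<le> off y"
  by (induction rule: dec_induct) (auto simp: off_Suc)

lemma off_nth: "x \<le> n \<Longrightarrow> nat_in I ''off'' ! x = off x"
  by (simp add: off_in off_def del: upt_Suc)

lemma off_length: "length (nat_in I ''off'') = Suc n"
  by (simp add: off_in)

lemma adj_length: "length (nat_in I ''adj'') = off n"
  by (simp add: adj_in off_def)

lemma adj_nth:
  assumes "x < n" "off x \<le> p" "p < off (Suc x)"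
  shows "p < off n" "nat_in I ''adj'' ! p = ns x ! (p - off x)"
proof -
  show "p < off n" using off_mono[of "Suc x" n] assms by linarith
  show "nat_in I ''adj'' ! p = ns x ! (p - off x)"
    using nth_concat_upt[OF assms(1), of "p - off x" ns] assms(2,3) by (simp add: adj_in off_def)
qed

lemma imp_nth:
  assumes "x < n" "off x \<le> p" "p < off (Suc x)"
  shows "p < length (real_in I ''imp'')" "real_in I ''imp'' ! p = C {x, ns x ! (p - off x)}"
proof -
  let ?f = "\<lambda>x. map (\<lambda>y. C {x, y}) (ns x)"
  \<comment> \<open>Importances are stored in blocks of the same lengths as the adjacency lists, so
    the offsets are shared.\<close>
  have len: "length (concat (map ?f [0..<k])) = off k" for k
    by (simp add: off_def length_concat o_def)
  show "p < length (real_in I ''imp'')" using adj_nth(1)[OF assms] len imp_in by simp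
  show "real_in I ''imp'' ! p = C {x, ns x ! (p - off x)}"
    using nth_concat_upt[OF assms(1), of "p - off x" ?f] assms(2,3) unfolding len
    by (simp add: imp_in off_Suc)
qed

lemma neighbour: "x < n \<Longrightarrow> y \<in> set (ns x) \<longleftrightarrow> {x, y} \<in> E"
  using ns by blast

lemma edge_less: "{x, y} \<in> E \<Longrightarrow> x < n \<and> y < n \<and> x \<noteq> y"
  using subsetD[OF E_pairs, of "{x, y}"] unfolding pair_in_pairs by simp

lemma neighbour_less: "x < n \<Longrightarrow> y \<in> set (ns x) \<Longrightarrow> y < n \<and> y \<noteq> x"
  using edge_less neighbour by metis

text \<open>The part of F with a common neighbour below \<open>k\<close>; it lets the loop over
  \<open>b\<close> build up F one neighbourhood at a time.\<close>

definition hops :: "nat \<Rightarrow> nat set set" where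
  "hops k = {{a, c} |a c. a \<noteq> c \<and> (\<exists>b<k. {a, b} \<in> E \<and> {b, c} \<in> E)}"

lemma hops_0: "hops 0 = {}"
  by (simp add: hops_def)

lemma hops_n: "hops n = two_hop E"
proof -
  show ?thesis unfolding hops_def two_hop_def using edge_less by blast
qed

section \<open>Stars in place of cliques\<close>

definition star :: "nat \<Rightarrow> nat set \<Rightarrow> nat set set" where
  "star m X = {{m, c} |c. c \<in> X \<and> c \<noteq> m}"

text \<open>An edge between neighbours \<open>a\<close> and \<open>c\<close> is replaced by the path
  through \<open>m\<close>; as \<open>m\<close> has least centrality, each edge of the path weighs
  at most \<open>cen a + cen c\<close>.\<close>

lemma dominates_star:
  assumes b: "b < n" and m: "\<And>y. y \<in> set (ns b) \<Longrightarrow> cen m \<le> cen y"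
  shows "dominates (weight cen) (hops b \<union> star m (set (ns b))) (hops (Suc b))"
proof -
  let ?w = "weight cen" and ?S = "star m (set (ns b))"
  have "dominates ?w ?S {{a, c} |a c. a \<noteq> c \<and> a \<in> set (ns b) \<and> c \<in> set (ns b)}"
    unfolding dominates_def
  proof (intro allI impI)
    fix a c assume "{a, c} \<in> {{a, c} |a c. a \<noteq> c \<and> a \<in> set (ns b) \<and> c \<in> set (ns b)}"
    then obtain a' c' where "{a, c} = {a', c'}" "a' \<noteq> c'" "a' \<in> set (ns b)" "c' \<in> set (ns b)" by blast
    then have ac: "a \<noteq> c" "a \<in> set (ns b)" "c \<in> set (ns b)" unfolding doubleton_eq_iff by metis+
    let ?L = "{f \<in> ?S. ?w f \<le> ?w {a, c}}"
    have "(m, y) \<in> linked ?L" if y: "y = a \<or> y = c" for y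
    proof (cases "y = m")
      case False
      have yb: "y \<in> set (ns b)" using y ac by blast
      have "?w {m, y} = cen m + cen y" "?w {a, c} = cen a + cen c"
        using False ac by (simp_all add: weight_def)
      then have "?w {m, y} \<le> ?w {a, c}" using y ac m by auto
      moreover have "{m, y} \<in> ?S" using yb False unfolding star_def by blast
      ultimately show ?thesis by (intro linked_edge) simp
    qed simp
    from linked_trans'[OF this this] show "(a, c) \<in> linked ?L" by blast
  qed
  moreover have "hops (Suc b) \<subseteq> hops b \<union> {{a, c} |a c. a \<noteq> c \<and> a \<in> set (ns b) \<and> c \<in> set (ns b)}"
  proof
    fix e assume "e \<in> hops (Suc b)"
    then obtain a c b' where e: "e = {a, c}" "a \<noteq> c" "b' < Suc b" "{a, b'} \<in> E" "{b', c} \<in> E"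
      unfolding hops_def by blast
    show "e \<in> hops b \<union> {{a, c} |a c. a \<noteq> c \<and> a \<in> set (ns b) \<and> c \<in> set (ns b)}"
    proof (cases "b' = b")
      case True
      then have "a \<in> set (ns b)" "c \<in> set (ns b)"
        using neighbour[OF b] e insert_commute[of a b "{}"] by simp_all
      then show ?thesis using e by blast
    next
      case False
      then have "b' < b" using e by simp
      then have "e \<in> hops b" unfolding hops_def using e by blast
      then show ?thesis ..
    qed
  qed
  moreover have "dominates ?w (hops b \<union> ?S) (hops b)" by (rule dominates_refl) simp
  moreover have "dominates ?w (hops b \<union> ?S) F" if "dominates ?w ?S F" for F
    using that Un_upper2 order_refl by (rule dominates_mono)
  ultimately show ?thesis by (blast intro: dominates_mono[OF dominates_Un order_refl])
qed

text \<open>\<open>X\<close> is what the buffer holds and \<open>G\<close> what it has to dominate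
  so far: \<open>G\<close> grows during streaming, while reductions may shrink \<open>X\<close> as
  long as it still dominates \<open>G\<close>.\<close>

definition candidates :: "nat set \<Rightarrow> nat set set \<Rightarrow> bool" where
  "candidates X G \<longleftrightarrow> X \<subseteq> codes \<and> edge ` X \<subseteq> two_hop E \<and> dominates (weight cen) (edge ` X) G"

lemma candidates_reduced:
  assumes "candidates X G" "reduced X buf cnt ch pa"
  shows "candidates (set (take cnt buf)) G"
proof -
  have sub: "set (take cnt buf) \<subseteq> X" and "dominates (weight cen) (edges (take cnt buf)) (edge ` X)"
    using assms(2) by (auto simp: reduced_def)
  moreover have "dominates (weight cen) (edge ` X) G" using assms(1) by (simp add: candidates_def)
  ultimately have "dominates (weight cen) (edges (take cnt buf)) G" by (blast intro: dominates_trans)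
  then show ?thesis using assms(1) sub unfolding candidates_def by blast
qed

lemma candidates_hops_Suc:
  assumes "candidates X (hops b \<union> star m (set (ns b)))" "b < n"
    "\<And>y. y \<in> set (ns b) \<Longrightarrow> cen m \<le> cen y"
  shows "candidates X (hops (Suc b))"
  using assms(1) dominates_trans[OF _ dominates_star[OF assms(2,3)]] unfolding candidates_def by simp

lemma candidates_push:
  assumes "candidates X G" and b: "b < n" and mc: "m \<in> set (ns b)" "c \<in> set (ns b)" "m \<noteq> c"
  shows "candidates (insert (m * n + c) X) (insert {m, c} G)"
proof -
  have less: "m < n" "c < n" using neighbour_less b mc by auto
  have div: "(m * n + c) div n = m" "(m * n + c) mod n = c" using less by auto
  have "m * n + c < n * n"
  proof -
    have "m * n + n \<le> n * n" using less(1) mult_le_mono1[of "Suc m" n n] by simp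
    then show ?thesis using less(2) by linarith
  qed
  then have code: "m * n + c \<in> codes" using div mc by (simp add: codes_def)
  have e: "edge (m * n + c) = {m, c}" using div by (simp add: edge_def)
  have "{m, b} \<in> E" "{b, c} \<in> E" using mc neighbour[OF b] by (auto simp: insert_commute)
  then have "{m, c} \<in> two_hop E" using mc unfolding two_hop_def by blast
  moreover have "dominates (weight cen) (insert {m, c} (edge ` X)) (insert {m, c} G)"
  proof -
    have "dominates (weight cen) (insert {m, c} (edge ` X)) G"
      by (rule dominates_mono[of _ "edge ` X" G]) (use assms in \<open>auto simp: candidates_def\<close>)
    moreover have "dominates (weight cen) (insert {m, c} (edge ` X)) {{m, c}}"
      by (rule dominates_refl) simp
    ultimately show ?thesis using dominates_Un by fastforce
  qed
  ultimately show ?thesis using assms(1) code e by (simp add: candidates_def)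
qed

section \<open>Streaming the candidates through the buffer\<close>

definition shaped :: "store \<Rightarrow> bool" where
  "shaped s \<longleftrightarrow>
    (\<forall>a \<in> {''buf'', ''tmp''}. length (nat_arr s a) = 2 * n) \<and>
    (\<forall>a \<in> {''up'', ''rank'', ''child'', ''parent'', ''rep'', ''head'', ''next'', ''size'', ''stack'', ''edges''}.
      length (nat_arr s a) = n) \<and>
    length (real_arr s ''import'') = n"

lemma frame_shaped: "frame c s s' \<Longrightarrow> \<not> allocates c \<Longrightarrow> shaped s' \<longleftrightarrow> shaped s"
  by (simp add: frame_def shaped_def)

abbreviation find_least :: com where
  "find_least \<equiv> For ''p'' (Var ''first'') (Var ''last'')
         (Cond (RLeq (RIn ''cen'' (Var ''m'')) (RIn ''cen'' (In ''adj'' (Var ''p'')))) Skip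
            (''m'' ::= In ''adj'' (Var ''p'')))"

lemma wp_find_least:
  assumes b: "b < n" and fl: "nat_var s ''first'' = off b" "nat_var s ''last'' = off (Suc b)"
    and m: "nat_var s ''m'' \<in> set (ns b)"
  shows "wp I find_least s
    (\<lambda>t s'. t \<le> length (ns b) * 20 + 6 \<and> nat_var s' ''m'' \<in> set (ns b) \<and>
      (\<forall>y \<in> set (ns b). cen (nat_var s' ''m'') \<le> cen y))"
proof (rule wp_mono)
  let ?c = "Cond (RLeq (RIn ''cen'' (Var ''m'')) (RIn ''cen'' (In ''adj'' (Var ''p'')))) Skip
            (''m'' ::= In ''adj'' (Var ''p''))"
  let ?F = "For ''p'' (Var ''first'') (Var ''last'') ?c"
  let ?Inv = "\<lambda>p (s' :: store). nat_var s' ''m'' \<in> set (ns b) \<and>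
    (\<forall>y \<in> set (take (p - off b) (ns b)). cen (nat_var s' ''m'') \<le> cen y)"
  show "wp I ?F s (\<lambda>t s'. t \<le> (off (Suc b) - off b) * (12 + 7 + ncost (Var ''last'')) + 4 + ncost (Var ''first'') + ncost (Var ''last'') \<and>
      nat_var s' ''p'' = off (Suc b) \<and> frame ?F s s' \<and> ?Inv (off (Suc b)) s')"
  proof (rule wp_For[where Inv = ?Inv])
    show "off b \<le> off (Suc b)" by (simp add: off_Suc)
    fix p s' assume p: "off b \<le> p" "p < off (Suc b)" "nat_var s' ''p'' = p" and inv: "?Inv p s'"
    let ?y = "ns b ! (p - off b)"
    have i: "p - off b < length (ns b)" "Suc p - off b = Suc (p - off b)" using p by (auto simp: off_Suc)
    have y: "?y \<in> set (ns b)" using i by simp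
    then show "wp I ?c s' (\<lambda>t s''. t \<le> 12 \<and> nat_var s'' ''p'' = p \<and>
        ?Inv (Suc p) (s''\<lparr>nat_var := (nat_var s'')(''p'' := Suc p)\<rparr>))"
      using p inv i adj_nth[OF b p(1,2)] neighbour_less[OF b, of ?y] neighbour_less[OF b, of "nat_var s' ''m''"]
      by (auto simp: cen_in adj_length take_Suc_conv_app_nth)
  qed (use fl m in \<open>auto simp: frameD\<close>)
qed (auto simp: off_Suc)

definition push_body :: com where
  "push_body = (''c'' ::= In ''adj'' (Var ''p'') ;;
          Cond (NEq (Var ''c'') (Var ''m'')) Skip
           (Cond (NEq (Var ''cnt'') (Lit 2 \<otimes> N)) kruskal Skip ;;
            Store ''buf'' (Var ''cnt'') (Var ''m'' \<otimes> N \<oplus> Var ''c'') ;;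
            ''cnt'' ::= Var ''cnt'' \<oplus> Lit 1))"

text \<open>The cost of one reduction spread over \<open>n\<close> entries, since a full buffer of
  \<open>2 * n\<close> entries shrinks by at least that many.\<close>

definition credit :: nat where
  "credit = 2000 * (lg + 1)"

lemma kruskal_time_credit: "kruskal_time = n * credit"
  by (simp add: kruskal_time_def credit_def algebra_simps)

definition buffered :: "nat set set \<Rightarrow> store \<Rightarrow> bool" where
  "buffered G s \<longleftrightarrow> nat_var s ''cnt'' \<le> 2 * n \<and> candidates (set (take (nat_var s ''cnt'') (nat_arr s ''buf''))) G"

lemma kruskal_effects:
  "nat_vars_of kruskal = {''w'', ''lo'', ''mid'', ''hi'', ''i'', ''j'', ''k'', ''x'', ''y'', ''z'', ''e'', ''acc'', ''cnt''}"
  "real_vars_of kruskal = {}" "real_arrs_of kruskal = {}" "\<not> emits kruskal" "\<not> allocates kruskal"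
  by (auto simp: kruskal_def sort_buffer_def merge_runs_def take_from_def find_root_def)

lemma wp_reduce:
  assumes "shaped s" "buffered G s"
  shows "wp I kruskal s (\<lambda>t s'. t \<le> kruskal_time \<and> buffered G s' \<and> nat_var s' ''cnt'' < n \<and> shaped s' \<and>
    (\<exists>X. candidates X G \<and>
      reduced_store X s'))"
proof (rule wp_frame[OF wp_kruskal[OF refl]])
  show "set (take (nat_var s ''cnt'') (nat_arr s ''buf'')) \<subseteq> codes"
    using assms by (simp add: buffered_def candidates_def)
  fix t s' assume r: "t \<le> kruskal_time \<and> reduced_store (set (take (nat_var s ''cnt'') (nat_arr s ''buf''))) s'"
    and fr: "frame kruskal s s'"
  have "shaped s'" using frame_shaped[OF fr] kruskal_effects assms by simp
  moreover have "candidates (set (take (nat_var s ''cnt'') (nat_arr s ''buf''))) G"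
    using assms by (simp add: buffered_def)
  moreover from this r have "candidates (set (take (nat_var s' ''cnt'') (nat_arr s' ''buf''))) G"
    using candidates_reduced by blast
  moreover have "nat_var s' ''cnt'' < n" using r by (simp add: reduced_def)
  ultimately show "t \<le> kruskal_time \<and> buffered G s' \<and> nat_var s' ''cnt'' < n \<and> shaped s' \<and> (\<exists>X. candidates X G \<and>
      reduced_store X s')"
    using r by (auto simp: buffered_def)
qed (use assms in \<open>auto simp: shaped_def buffered_def\<close>)

text \<open>Amortized analysis: every entry of the buffer carries a credit, so that a full buffer pays for
  its own reduction to fewer than \<open>n\<close> entries.\<close>

lemma wp_push_body:
  assumes b: "b < n" and p: "nat_var s ''p'' = p" "off b \<le> p" "p < off (Suc b)"
    and m: "nat_var s ''m'' = m" "m \<in> set (ns b)"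
    and sh: "shaped s" and buf: "buffered (G \<union> star m (set (take (p - off b) (ns b)))) s"
  shows "wp I push_body s (\<lambda>t s'. nat_var s' ''p'' = p \<and> shaped s' \<and>
    buffered (G \<union> star m (set (take (Suc p - off b) (ns b)))) s' \<and>
    t + nat_var s' ''cnt'' * credit \<le> 40 + credit + nat_var s ''cnt'' * credit)"
proof -
  let ?G = "G \<union> star m (set (take (p - off b) (ns b)))"
  let ?G' = "G \<union> star m (set (take (Suc p - off b) (ns b)))"
  define c where "c = ns b ! (p - off b)"
  have i: "p - off b < length (ns b)" "Suc p - off b = Suc (p - off b)" using p by (auto simp: off_Suc)
  have c: "c \<in> set (ns b)" using i by (simp add: c_def)
  have adj: "nat_in I ''adj'' ! p = c" "p < length (nat_in I ''adj'')"
    using adj_nth[OF b p(2,3)] adj_length by (simp_all add: c_def)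
  have G': "?G' = (if c = m then ?G else insert {m, c} ?G)"
    using i by (auto simp: star_def take_Suc_conv_app_nth c_def)
  let ?store = "Store ''buf'' (Var ''cnt'') (Var ''m'' \<otimes> N \<oplus> Var ''c'') ;; ''cnt'' ::= Var ''cnt'' \<oplus> Lit 1"
  have push: "wp I ?store s1 (\<lambda>t s'. nat_var s' ''p'' = p \<and> shaped s' \<and> buffered ?G' s' \<and>
      t = 12 \<and> nat_var s' ''cnt'' = Suc (nat_var s1 ''cnt''))"
    if "c \<noteq> m" "nat_var s1 ''p'' = p" "nat_var s1 ''m'' = m" "nat_var s1 ''c'' = c" "shaped s1"
      "buffered ?G s1" "nat_var s1 ''cnt'' < 2 * n" for s1
  proof -
    have len: "length (nat_arr s1 ''buf'') = 2 * n" using that by (simp add: shaped_def)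
    have "candidates (insert (m * n + c) (set (take (nat_var s1 ''cnt'') (nat_arr s1 ''buf'')))) ?G'"
      using candidates_push[OF _ b m(2) c, of _ ?G] that G' by (simp add: buffered_def)
    then show ?thesis
      using that len by (auto simp: shaped_def buffered_def take_Suc_conv_app_nth n_in)
  qed
  let ?s1 = "s\<lparr>nat_var := (nat_var s)(''c'' := c)\<rparr>"
  show ?thesis
  proof (cases "c = m")
    case True
    then show ?thesis unfolding push_body_def
      using p m sh buf G' adj by (auto simp: shaped_def buffered_def)
  next
    case ne: False
    show ?thesis
    proof (cases "nat_var s ''cnt'' = 2 * n")
      case False
      then have "wp I ?store ?s1 (\<lambda>t s'. nat_var s' ''p'' = p \<and> shaped s' \<and> buffered ?G' s' \<and>
          t = 12 \<and> nat_var s' ''cnt'' = Suc (nat_var s ''cnt''))"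
        using push[of ?s1] ne p m sh buf by (simp add: shaped_def buffered_def)
      then show ?thesis unfolding push_body_def
        using ne False p m adj
        by (simp add: n_in del: wp_Assign[of _ "''cnt''"] wp_Store) (erule wp_mono, auto)
    next
      case True
      have "wp I (kruskal ;; ?store) ?s1 (\<lambda>t s'. nat_var s' ''p'' = p \<and> shaped s' \<and> buffered ?G' s' \<and>
          t + nat_var s' ''cnt'' * credit \<le> 12 + credit + nat_var s ''cnt'' * credit)"
        unfolding wp_Seq[of I kruskal]
      proof (rule wp_frame[OF wp_reduce])
        show "shaped ?s1" "buffered ?G ?s1" using sh buf by (simp_all add: shaped_def buffered_def)
        fix t s2 assume 2: "t \<le> kruskal_time \<and> buffered ?G s2 \<and> nat_var s2 ''cnt'' < n \<and> shaped s2 \<and>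
            (\<exists>X. candidates X ?G \<and> reduced_store X s2)"
          and fr: "frame kruskal ?s1 s2"
        have "nat_var s2 ''p'' = p" "nat_var s2 ''m'' = m" "nat_var s2 ''c'' = c"
          by (simp_all add: frameD[OF fr] kruskal_effects p m)
        moreover have "t + nat_var s2 ''cnt'' * credit \<le> nat_var s ''cnt'' * credit"
        proof -
          have "nat_var s2 ''cnt'' * credit \<le> n * credit" using 2 by (intro mult_right_mono) auto
          moreover have "nat_var s ''cnt'' * credit = n * credit + n * credit" by (simp add: True)
          ultimately show ?thesis using 2 kruskal_time_credit by linarith
        qed
        ultimately show "wp I ?store s2 (\<lambda>t' s'. nat_var s' ''p'' = p \<and> shaped s' \<and> buffered ?G' s' \<and>
            t + t' + nat_var s' ''cnt'' * credit \<le> 12 + credit + nat_var s ''cnt'' * credit)"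
          by (intro wp_mono[OF push[of s2]]) (use ne 2 in auto)
      qed
      then show ?thesis unfolding push_body_def
        using ne True p m adj
        by (simp add: n_in del: wp_Assign[of _ "''cnt''"] wp_Store) (erule wp_mono, auto)
    qed
  qed
qed


lemma wp_push_loop:
  assumes b: "b < n" "nat_var s ''b'' = b" and fl: "nat_var s ''first'' = off b" "nat_var s ''last'' = off (Suc b)"
    and m: "nat_var s ''m'' = m" "m \<in> set (ns b)" and sh: "shaped s" and buf: "buffered G s"
  shows "wp I (For ''p'' (Var ''first'') (Var ''last'') push_body) s
    (\<lambda>t s'. nat_var s' ''b'' = b \<and> shaped s' \<and> buffered (G \<union> star m (set (ns b))) s' \<and>
      t + nat_var s' ''cnt'' * credit \<le> 6 + length (ns b) * (credit + 48) + nat_var s ''cnt'' * credit)"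
proof (rule wp_mono)
  let ?F = "For ''p'' (Var ''first'') (Var ''last'') push_body"
  let ?Inv = "\<lambda>p k s'. shaped s' \<and> buffered (G \<union> star m (set (take (p - off b) (ns b)))) s' \<and>
    k = (off (Suc b) - p) * (credit + 48) + nat_var s' ''cnt'' * credit"
  let ?K = "length (ns b) * (credit + 48) + nat_var s ''cnt'' * credit"
  show "wp I ?F s (\<lambda>t s'. nat_var s' ''p'' = off (Suc b) \<and> frame ?F s s' \<and>
    (\<exists>k'. ?Inv (off (Suc b)) k' s' \<and> t + k' \<le> 4 + ncost (Var ''first'') + ncost (Var ''last'') + ?K))"
  proof (rule wp_For_budget[where Inv = ?Inv])
    show "off b \<le> off (Suc b)" by (simp add: off_Suc)
    show "?Inv (off b) ?K (s\<lparr>nat_var := (nat_var s)(''p'' := off b)\<rparr>)"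
      using sh buf by (simp add: shaped_def buffered_def star_def off_Suc)
    fix p k s' assume p: "off b \<le> p" "p < off (Suc b)" "nat_var s' ''p'' = p" and inv: "?Inv p k s'"
      and fr: "frame ?F s s'"
    have m': "nat_var s' ''m'' = m" by (simp add: frameD[OF fr] push_body_def kruskal_effects m)
    show "wp I push_body s' (\<lambda>t s''. nat_var s'' ''p'' = p \<and>
        (\<exists>k'. ?Inv (Suc p) k' (s''\<lparr>nat_var := (nat_var s'')(''p'' := Suc p)\<rparr>) \<and>
          7 + ncost (Var ''last'') + t + k' \<le> k))"
    proof (rule wp_mono[OF wp_push_body[OF b(1) p(3,1,2) m' m(2)]])
      show "shaped s'" "buffered (G \<union> star m (set (take (p - off b) (ns b)))) s'" using inv by auto
      fix t s'' assume *: "nat_var s'' ''p'' = p \<and> shaped s'' \<and>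
        buffered (G \<union> star m (set (take (Suc p - off b) (ns b)))) s'' \<and>
        t + nat_var s'' ''cnt'' * credit \<le> 40 + credit + nat_var s' ''cnt'' * credit"
      have "off (Suc b) - p = Suc (off (Suc b) - Suc p)" using p by simp
      then have "k = (off (Suc b) - Suc p) * (credit + 48) + (credit + 48) + nat_var s' ''cnt'' * credit"
        using inv by simp
      then show "nat_var s'' ''p'' = p \<and>
        (\<exists>k'. ?Inv (Suc p) k' (s''\<lparr>nat_var := (nat_var s'')(''p'' := Suc p)\<rparr>) \<and>
          7 + ncost (Var ''last'') + t + k' \<le> k)"
        using * by (simp add: shaped_def buffered_def)
    qed
  qed (use fl in \<open>auto simp: frameD push_body_def kruskal_effects\<close>)
  fix t s' assume *: "nat_var s' ''p'' = off (Suc b) \<and> frame ?F s s' \<and>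
    (\<exists>k'. ?Inv (off (Suc b)) k' s' \<and> t + k' \<le> 4 + ncost (Var ''first'') + ncost (Var ''last'') + ?K)"
  then have "frame ?F s s'" by blast
  then have "nat_var s' ''b'' = b" by (simp add: frameD push_body_def kruskal_effects b)
  then show "nat_var s' ''b'' = b \<and> shaped s' \<and> buffered (G \<union> star m (set (ns b))) s' \<and>
      t + nat_var s' ''cnt'' * credit \<le> 6 + length (ns b) * (credit + 48) + nat_var s ''cnt'' * credit"
    using * by (simp add: off_Suc)
qed

definition scan_neighbours :: com where
  "scan_neighbours = (''first'' ::= In ''off'' (Var ''b'') ;;
      ''last'' ::= In ''off'' (Var ''b'' \<oplus> Lit 1) ;;
      Cond (NLess (Var ''first'') (Var ''last''))
       (''m'' ::= In ''adj'' (Var ''first'') ;;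
        find_least ;;
        For ''p'' (Var ''first'') (Var ''last'') push_body)
       Skip)"

lemma hops_Suc_isolated:
  assumes "b < n" "ns b = []"
  shows "hops (Suc b) = hops b"
proof -
  have "{b, c} \<notin> E" for c using neighbour[of b c] assms by simp
  then have "(\<exists>b'<Suc b. {a, b'} \<in> E \<and> {b', c} \<in> E) \<longleftrightarrow> (\<exists>b'<b. {a, b'} \<in> E \<and> {b', c} \<in> E)" for a c
    using less_Suc_eq by auto
  then show ?thesis unfolding hops_def by simp
qed

lemma wp_scan_neighbours:
  assumes b: "b < n" "nat_var s ''b'' = b" and sh: "shaped s" and buf: "buffered (hops b) s"
  shows "wp I scan_neighbours s
    (\<lambda>t s'. nat_var s' ''b'' = b \<and> shaped s' \<and> buffered (hops (Suc b)) s' \<and>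
      t + nat_var s' ''cnt'' * credit \<le> 50 + length (ns b) * (credit + 70) + nat_var s ''cnt'' * credit)"
proof (cases "ns b = []")
  case True
  then show ?thesis using b sh buf hops_Suc_isolated[OF b(1) True]
    by (simp add: scan_neighbours_def off_nth off_length off_Suc shaped_def buffered_def)
next
  case False
  then have len: "0 < length (ns b)" by simp
  let ?push = "For ''p'' (Var ''first'') (Var ''last'') push_body"
  have ob: "off b \<le> off b" "off b < off (Suc b)" using len by (auto simp: off_Suc)
  have main: "wp I (find_least ;; ?push) s1 (\<lambda>t s'. nat_var s' ''b'' = b \<and> shaped s' \<and> buffered (hops (Suc b)) s' \<and>
      t + nat_var s' ''cnt'' * credit \<le> 12 + length (ns b) * (credit + 68) + nat_var s ''cnt'' * credit)"
    if s1: "nat_var s1 ''b'' = b" "nat_var s1 ''first'' = off b" "nat_var s1 ''last'' = off (Suc b)"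
      "nat_var s1 ''m'' \<in> set (ns b)" "shaped s1" "buffered (hops b) s1" "nat_var s1 ''cnt'' = nat_var s ''cnt''"
    for s1
    unfolding wp_Seq
  proof (rule wp_frame[OF wp_find_least[OF b(1) s1(2,3,4)]])
    fix t s2 assume 2: "t \<le> length (ns b) * 20 + 6 \<and> nat_var s2 ''m'' \<in> set (ns b) \<and>
        (\<forall>y \<in> set (ns b). cen (nat_var s2 ''m'') \<le> cen y)" and fr: "frame find_least s1 s2"
    let ?m = "nat_var s2 ''m''"
    have same: "nat_var s2 ''b'' = b" "nat_var s2 ''first'' = off b" "nat_var s2 ''last'' = off (Suc b)"
      "nat_var s2 ''cnt'' = nat_var s ''cnt''" "nat_arr s2 = nat_arr s1" "shaped s2"
      using s1 frame_shaped[OF fr] by (auto simp: frameD[OF fr])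
    then have "buffered (hops b) s2" using s1 by (simp add: buffered_def)
    show "wp I ?push s2 (\<lambda>t' s'. nat_var s' ''b'' = b \<and> shaped s' \<and> buffered (hops (Suc b)) s' \<and>
      t + t' + nat_var s' ''cnt'' * credit \<le> 12 + length (ns b) * (credit + 68) + nat_var s ''cnt'' * credit)"
    proof (rule wp_mono[OF wp_push_loop[OF b(1) same(1,2,3) refl _ same(6)]])
      show "?m \<in> set (ns b)" "buffered (hops b) s2" using 2 \<open>buffered (hops b) s2\<close> by auto
      fix t' s' assume 3: "nat_var s' ''b'' = b \<and> shaped s' \<and> buffered (hops b \<union> star ?m (set (ns b))) s' \<and>
        t' + nat_var s' ''cnt'' * credit \<le> 6 + length (ns b) * (credit + 48) + nat_var s2 ''cnt'' * credit"
      then have "buffered (hops (Suc b)) s'"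
        using candidates_hops_Suc[OF _ b(1), of _ ?m] 2 by (auto simp: buffered_def)
      moreover have "length (ns b) * (credit + 48) + length (ns b) * 20 = length (ns b) * (credit + 68)"
        by (simp flip: add_mult_distrib2)
      ultimately show "nat_var s' ''b'' = b \<and> shaped s' \<and> buffered (hops (Suc b)) s' \<and>
          t + t' + nat_var s' ''cnt'' * credit \<le> 12 + length (ns b) * (credit + 68) + nat_var s ''cnt'' * credit"
        using 2 3 same(4) by simp
    qed
  qed
  let ?s1 = "s\<lparr>nat_var := (nat_var s)(''first'' := off b, ''last'' := off (Suc b), ''m'' := ns b ! 0)\<rparr>"
  have le: "length (ns b) * (credit + 68) \<le> length (ns b) * (credit + 70)" by simp
  have "wp I (find_least ;; ?push) ?s1 (\<lambda>t s'. nat_var s' ''b'' = b \<and> shaped s' \<and> buffered (hops (Suc b)) s' \<and>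
      t + nat_var s' ''cnt'' * credit \<le> 12 + length (ns b) * (credit + 70) + nat_var s ''cnt'' * credit)"
  proof (rule wp_mono[OF main])
    show "shaped ?s1" "buffered (hops b) ?s1" using sh buf by (simp_all add: shaped_def buffered_def)
  qed (use b len le in \<open>simp_all, linarith\<close>)
  then show ?thesis
    unfolding scan_neighbours_def
    using b adj_nth[OF b(1) ob] adj_length ob
    by (simp add: off_nth off_length) (erule wp_mono, erule wp_mono, simp)
qed

lemma wp_build_H:
  assumes sh: "shaped s"
  shows "wp I build_H s (\<lambda>t s'. t \<le> off n * (credit + 70) + n * 60 + 20 + kruskal_time \<and> shaped s' \<and>
    (\<exists>X. candidates X (two_hop E) \<and>
      reduced_store X s'))"
proof -
  let ?F = "For ''b'' (Lit 0) N scan_neighbours"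
  let ?s0 = "s\<lparr>nat_var := (nat_var s)(''cnt'' := 0)\<rparr>"
  \<comment> \<open>The budget holds a credit and overhead for each arc to come, overhead for each
    vertex to come, and the credits stored with the buffered entries. The reduction after the loop
    is paid separately by \<open>kruskal_time\<close>.\<close>
  let ?Inv = "\<lambda>b k s'. shaped s' \<and> buffered (hops b) s' \<and>
    k = (off n - off b) * (credit + 70) + (n - b) * 60 + nat_var s' ''cnt'' * credit"
  have loop: "wp I ?F ?s0 (\<lambda>t s'. nat_var s' ''b'' = n \<and> frame ?F ?s0 s' \<and>
    (\<exists>k'. ?Inv n k' s' \<and> t + k' \<le> 4 + ncost (Lit 0) + ncost N + (off n * (credit + 70) + n * 60)))"
  proof (rule wp_For_budget[where Inv = ?Inv])
    show "?Inv 0 (off n * (credit + 70) + n * 60) (?s0\<lparr>nat_var := (nat_var ?s0)(''b'' := 0)\<rparr>)"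
      using sh by (simp add: shaped_def buffered_def candidates_def hops_0 dominates_def)
    fix b k s' assume b: "b < n" "nat_var s' ''b'' = b" and inv: "?Inv b k s'"
    show "wp I scan_neighbours s' (\<lambda>t s''. nat_var s'' ''b'' = b \<and>
        (\<exists>k'. ?Inv (Suc b) k' (s''\<lparr>nat_var := (nat_var s'')(''b'' := Suc b)\<rparr>) \<and> 7 + ncost N + t + k' \<le> k))"
    proof (rule wp_mono[OF wp_scan_neighbours[OF b]])
      show "shaped s'" "buffered (hops b) s'" using inv by auto
      fix t s'' assume *: "nat_var s'' ''b'' = b \<and> shaped s'' \<and> buffered (hops (Suc b)) s'' \<and>
        t + nat_var s'' ''cnt'' * credit \<le> 50 + length (ns b) * (credit + 70) + nat_var s' ''cnt'' * credit"
      have "off n - off b = length (ns b) + (off n - off (Suc b))"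
        using off_mono[of "Suc b" n] b by (simp add: off_Suc)
      then have 1: "(off n - off b) * (credit + 70) = length (ns b) * (credit + 70) + (off n - off (Suc b)) * (credit + 70)"
        by (simp only: add_mult_distrib)
      have "n - b = Suc (n - Suc b)" using b by simp
      then have "(n - b) * 60 = 60 + (n - Suc b) * 60" by simp
      with 1 show "nat_var s'' ''b'' = b \<and>
        (\<exists>k'. ?Inv (Suc b) k' (s''\<lparr>nat_var := (nat_var s'')(''b'' := Suc b)\<rparr>) \<and> 7 + ncost N + t + k' \<le> k)"
        using * inv by (simp add: shaped_def buffered_def)
    qed
  qed (auto simp: n_in)
  have "wp I (?F ;; kruskal) ?s0 (\<lambda>t s'. t \<le> off n * (credit + 70) + n * 60 + 18 + kruskal_time \<and> shaped s' \<and>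
      (\<exists>X. candidates X (two_hop E) \<and>
        reduced_store X s'))"
    unfolding wp_Seq
    by (rule wp_mono[OF loop], rule wp_mono[OF wp_reduce[of _ "two_hop E"]]) (auto simp: hops_n)
  then show ?thesis
    unfolding build_H_def push_body_def[symmetric] scan_neighbours_def[symmetric]
    by simp (erule wp_mono, erule wp_mono, simp)
qed

text \<open>Domination passes from the candidates to the accepted edges, and acyclicity comes with
  the list of links; together they are the criterion for minimality.\<close>

lemma sorted_msf_reduced:
  assumes cand: "candidates X (two_hop E)" and red: "reduced X buf cnt ch pa"
  shows "sorted_msf E cen (map edge (take cnt buf))"
proof -
  let ?A = "take cnt buf"
  obtain ps where fl: "forest_list ps ?A" using red by (auto simp: reduced_def)
  have codes: "set ?A \<subseteq> codes" using fl by (simp add: forest_list_def)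
  have "map (weight cen) (map edge ?A) = map ckey ?A"
    using codes by (auto simp: weight_edge)
  then have "sorted (map (weight cen) (map edge ?A))" using red by (simp only: reduced_def)
  moreover have "min_spanning_forest (weight cen) (two_hop E) (edges ?A)"
  proof (rule min_spanning_forest_if_dominates)
    show "finite {..<n}" "two_hop E \<subseteq> pairs {..<n}" using two_hop_pairs E_pairs by auto
    have "set ?A \<subseteq> X" using red by (simp add: reduced_def)
    then show "edges ?A \<subseteq> two_hop E" using cand by (auto simp: candidates_def)
    show "\<nexists>p. cycle (edges ?A) p" using fl by (simp add: forest_list_def)
    show "dominates (weight cen) (edges ?A) (two_hop E)"
      using candidates_reduced[OF cand red] by (simp add: candidates_def)
  qed
  ultimately show ?thesis using fl by (simp add: sorted_msf_def forest_list_def)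
qed

end

section \<open>Scanning the superedges\<close>

primrec chain :: "nat list \<Rightarrow> nat \<Rightarrow> nat \<Rightarrow> nat list \<Rightarrow> bool" where
  "chain next null h [] \<longleftrightarrow> h = null"
| "chain next null h (z # zs) \<longleftrightarrow> h = z \<and> z < null \<and> chain next null (next ! z) zs"

lemma chain_update: "x \<notin> set zs \<Longrightarrow> chain (next[x := v]) null h zs \<longleftrightarrow> chain next null h zs"
  by (induction zs arbitrary: h) auto

text \<open>Reversed because the program puts every vertex at the front of the list of its
  part.\<close>

definition members :: "(nat \<Rightarrow> nat) \<Rightarrow> nat \<Rightarrow> nat \<Rightarrow> nat list" where
  "members \<rho> r m = rev (filter (\<lambda>z. \<rho> z = r) [0..<m])"

lemma members_0 [simp]: "members \<rho> r 0 = []"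
  by (simp add: members_def)

lemma members_Suc: "members \<rho> r (Suc m) = (if \<rho> m = r then m # members \<rho> r m else members \<rho> r m)"
  by (simp add: members_def)

lemma set_members: "set (members \<rho> r m) = part_of {..<m} \<rho> r"
  by (auto simp: members_def part_of_def)

lemma distinct_members [simp]: "distinct (members \<rho> r m)"
  by (simp add: members_def)

lemma length_members: "length (members \<rho> r m) = card (part_of {..<m} \<rho> r)"
  using distinct_card[OF distinct_members] set_members by metis

context encoded
begin

text \<open>When the links from \<open>i\<close> on have been applied, \<open>rep\<close> is the
  collapse along that suffix. Prepending a link changes the value at its child only, to the value at
  its parent, which is the assignment in the loop body.\<close>

lemma wp_build_partition:
  assumes sh: "shaped s" and t: "nat_var s x = t" "x \<noteq> ''x''" "x \<noteq> ''i''" and ps: "t \<le> length ps" "t \<le> n"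
    "set ps \<subseteq> {..<n} \<times> {..<n}" "\<And>j. j < t \<Longrightarrow> ps ! j = (nat_arr s ''child'' ! j, nat_arr s ''parent'' ! j)"
  shows "wp I (build_partition x) s (\<lambda>t' s'. t' \<le> n * 40 + 20 \<and>
    (\<forall>z<n. nat_arr s' ''rep'' ! z = collapse (take t ps) z))"
proof -
  let ?init = "For ''x'' (Lit 0) N (Store ''rep'' (Var ''x'') (Var ''x''))"
  let ?b = "NLess (Lit 0) (Var ''i'')"
  let ?c = "''i'' ::= Var ''i'' \<ominus> Lit 1 ;;
      Store ''rep'' (Arr ''child'' (Var ''i'')) (Arr ''rep'' (Arr ''parent'' (Var ''i'')))"
  let ?qs = "take t ps"
  have init: "wp I ?init s (\<lambda>t' s'. t' \<le> n * 12 + 7 \<and> (\<forall>z<n. nat_arr s' ''rep'' ! z = z))"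
  proof (rule wp_mono)
    show "wp I ?init s (\<lambda>t' s'. t' \<le> (n - 0) * (3 + 7 + ncost N) + 4 + ncost (Lit 0) + ncost N \<and>
        nat_var s' ''x'' = n \<and> frame ?init s s' \<and> (\<forall>z<n. nat_arr s' ''rep'' ! z = z))"
    proof (rule wp_For[where Inv = "\<lambda>x s'. \<forall>z<x. nat_arr s' ''rep'' ! z = z"])
      fix x s' assume x: "x < n" "nat_var s' ''x'' = x" and inv: "\<forall>z<x. nat_arr s' ''rep'' ! z = z"
        and fr: "frame ?init s s'"
      have "length (nat_arr s' ''rep'') = n" using sh by (simp add: frameD[OF fr] shaped_def)
      then show "wp I (Store ''rep'' (Var ''x'') (Var ''x'')) s' (\<lambda>t s''. t \<le> 3 \<and> nat_var s'' ''x'' = x \<and>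
          (\<forall>z<Suc x. nat_arr (s''\<lparr>nat_var := (nat_var s'')(''x'' := Suc x)\<rparr>) ''rep'' ! z = z))"
        using x inv by (auto simp: less_Suc_eq nth_list_update)
    qed (auto simp: n_in)
  qed auto
  have loop: "wp I (While ?b ?c) s1 (\<lambda>t' s'. t' \<le> t * 20 + 4 \<and> (\<forall>z<n. nat_arr s' ''rep'' ! z = collapse ?qs z))"
    if s1: "nat_var s1 ''i'' = t" "\<forall>z<n. nat_arr s1 ''rep'' ! z = z" "shaped s1"
      "nat_arr s1 ''child'' = nat_arr s ''child''" "nat_arr s1 ''parent'' = nat_arr s ''parent''" for s1
  proof (rule wp_mono)
    let ?Inv = "\<lambda>k s'. nat_var s' ''i'' \<le> t \<and>
      (\<forall>z<n. nat_arr s' ''rep'' ! z = collapse (drop (nat_var s' ''i'') ?qs) z) \<and> k = nat_var s' ''i'' * 20 + 4"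
    show "wp I (While ?b ?c) s1 (\<lambda>t' s'. t' \<le> t * 20 + 4 \<and>
        (\<forall>z<n. nat_arr s' ''rep'' ! z = collapse ?qs z) \<and> frame ?c s1 s')"
    proof (rule wp_While[where Inv = ?Inv])
      show "?Inv (t * 20 + 4) s1" using s1 ps by simp
      fix k s' assume inv: "?Inv k s'" and fr: "frame ?c s1 s'"
      show "bsafe I s' ?b" by simp
      show "1 + bcost ?b \<le> k \<and> (\<forall>z<n. nat_arr s' ''rep'' ! z = collapse ?qs z)" if "\<not> bval I s' ?b"
        using inv that by simp
      show "wp I ?c s' (\<lambda>t' s''. \<exists>k'. ?Inv k' s'' \<and> 1 + bcost ?b + t' + k' \<le> k)" if "bval I s' ?b"
      proof -
        have "0 < nat_var s' ''i''" using that by simp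
        then obtain i where i: "nat_var s' ''i'' = Suc i" using gr0_conv_Suc by blast
        then have it: "i < t" using inv by simp
        let ?c0 = "nat_arr s ''child'' ! i" and ?p0 = "nat_arr s ''parent'' ! i"
        have pi: "ps ! i = (?c0, ?p0)" using ps it by simp
        then have cp: "?c0 < n" "?p0 < n" using ps(1,3) it nth_mem[of i ps] by auto
        have same: "nat_arr s' ''child'' = nat_arr s ''child''" "nat_arr s' ''parent'' = nat_arr s ''parent''"
          using s1 by (simp_all add: frameD[OF fr])
        have sh': "shaped s'" using frame_shaped[OF fr] s1 by simp
        have "drop i ?qs = (?c0, ?p0) # drop (Suc i) ?qs"
          using it ps(1) pi by (simp flip: Cons_nth_drop_Suc)
        then show ?thesis
          using i it inv cp same sh' ps(2) by (auto simp: shaped_def collapse_Cons nth_list_update)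
      qed
    qed
  qed auto
  show ?thesis
    unfolding build_partition_def wp_Seq[of I ?init]
  proof (rule wp_frame[OF init])
    fix t1 s1 assume 1: "t1 \<le> n * 12 + 7 \<and> (\<forall>z<n. nat_arr s1 ''rep'' ! z = z)" and fr: "frame ?init s s1"
    let ?s2 = "s1\<lparr>nat_var := (nat_var s1)(''i'' := t)\<rparr>"
    have "shaped s1" using frame_shaped[OF fr] sh by simp
    then have "wp I (While ?b ?c) ?s2 (\<lambda>t' s'. t' \<le> t * 20 + 4 \<and> (\<forall>z<n. nat_arr s' ''rep'' ! z = collapse ?qs z))"
      by (intro loop) (use 1 in \<open>simp_all add: frameD[OF fr] shaped_def\<close>)
    moreover have "nat_var s1 x = t" using t by (simp add: frameD[OF fr])
    ultimately show "wp I (''i'' ::= Var x ;; While ?b ?c) s1 (\<lambda>t' s'. t1 + t' \<le> n * 40 + 20 \<and>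
        (\<forall>z<n. nat_arr s' ''rep'' ! z = collapse ?qs z))"
      using 1 ps(2) by simp (erule wp_mono, simp)
  qed
qed

abbreviation scan_clear :: com where
  "scan_clear \<equiv> For ''x'' (Lit 0) N
     (Store ''head'' (Var ''x'') N ;;
      Store ''size'' (Var ''x'') (Lit 0) ;;
      Store ''edges'' (Var ''x'') (Lit 0) ;;
      RStore ''import'' (Var ''x'') (OfNat (Lit 0)))"

lemma wp_scan_clear:
  assumes sh: "shaped s"
  shows "wp I scan_clear s
    (\<lambda>t s'. t \<le> n * 23 + 7 \<and> (\<forall>z<n. nat_arr s' ''head'' ! z = n \<and> nat_arr s' ''size'' ! z = 0 \<and>
      nat_arr s' ''edges'' ! z = 0 \<and> real_arr s' ''import'' ! z = 0))"
proof (rule wp_mono)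
  let ?c = "Store ''head'' (Var ''x'') N ;; Store ''size'' (Var ''x'') (Lit 0) ;;
      Store ''edges'' (Var ''x'') (Lit 0) ;; RStore ''import'' (Var ''x'') (OfNat (Lit 0))"
  let ?F = "For ''x'' (Lit 0) N ?c"
  let ?Inv = "\<lambda>x (s' :: store). \<forall>z<x. nat_arr s' ''head'' ! z = n \<and> nat_arr s' ''size'' ! z = 0 \<and>
      nat_arr s' ''edges'' ! z = 0 \<and> real_arr s' ''import'' ! z = 0"
  show "wp I ?F s (\<lambda>t s'. t \<le> (n - 0) * (14 + 7 + ncost N) + 4 + ncost (Lit 0) + ncost N \<and>
      nat_var s' ''x'' = n \<and> frame ?F s s' \<and> ?Inv n s')"
  proof (rule wp_For[where Inv = ?Inv])
    fix x s' assume x: "x < n" "nat_var s' ''x'' = x" and inv: "?Inv x s'" and fr: "frame ?F s s'"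
    have "shaped s'" using frame_shaped[OF fr] sh by simp
    then show "wp I ?c s' (\<lambda>t s''. t \<le> 14 \<and> nat_var s'' ''x'' = x \<and>
        ?Inv (Suc x) (s''\<lparr>nat_var := (nat_var s'')(''x'' := Suc x)\<rparr>))"
      using x inv by (auto simp: shaped_def n_in less_Suc_eq nth_list_update)
  qed (auto simp: n_in)
qed auto

abbreviation scan_link :: com where
  "scan_link \<equiv> For ''x'' (Lit 0) N
     (''r'' ::= Arr ''rep'' (Var ''x'') ;;
      Store ''next'' (Var ''x'') (Arr ''head'' (Var ''r'')) ;;
      Store ''head'' (Var ''r'') (Var ''x'') ;;
      Store ''size'' (Var ''r'') (Arr ''size'' (Var ''r'') \<oplus> Lit 1))"

lemma wp_scan_link:
  assumes sh: "shaped s" and rep: "\<And>x. x < n \<Longrightarrow> nat_arr s ''rep'' ! x = \<rho> x" and \<rho>: "\<And>x. x < n \<Longrightarrow> \<rho> x < n"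
    and start: "\<And>z. z < n \<Longrightarrow> nat_arr s ''head'' ! z = n \<and> nat_arr s ''size'' ! z = 0"
  shows "wp I scan_link s
    (\<lambda>t s'. t \<le> n * 29 + 7 \<and> (\<forall>r<n. chain (nat_arr s' ''next'') n (nat_arr s' ''head'' ! r) (members \<rho> r n) \<and>
      nat_arr s' ''size'' ! r = length (members \<rho> r n)))"
proof (rule wp_mono)
  let ?c = "''r'' ::= Arr ''rep'' (Var ''x'') ;;
      Store ''next'' (Var ''x'') (Arr ''head'' (Var ''r'')) ;;
      Store ''head'' (Var ''r'') (Var ''x'') ;;
      Store ''size'' (Var ''r'') (Arr ''size'' (Var ''r'') \<oplus> Lit 1)"
  let ?F = "For ''x'' (Lit 0) N ?c"
  let ?Inv = "\<lambda>x (s' :: store). \<forall>r<n. chain (nat_arr s' ''next'') n (nat_arr s' ''head'' ! r) (members \<rho> r x) \<and>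
      nat_arr s' ''size'' ! r = length (members \<rho> r x)"
  show "wp I ?F s (\<lambda>t s'. t \<le> (n - 0) * (20 + 7 + ncost N) + 4 + ncost (Lit 0) + ncost N \<and>
      nat_var s' ''x'' = n \<and> frame ?F s s' \<and> ?Inv n s')"
  proof (rule wp_For[where Inv = ?Inv])
    fix x s' assume x: "x < n" "nat_var s' ''x'' = x" and inv: "?Inv x s'" and fr: "frame ?F s s'"
    have sh': "shaped s'" using frame_shaped[OF fr] sh by simp
    have "nat_arr s' ''rep'' ! x = \<rho> x" using rep[OF x(1)] by (simp add: frameD[OF fr])
    moreover have "x \<notin> set (members \<rho> r x)" for r by (simp add: set_members part_of_def)
    ultimately show "wp I ?c s' (\<lambda>t s''. t \<le> 20 \<and> nat_var s'' ''x'' = x \<and>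
        ?Inv (Suc x) (s''\<lparr>nat_var := (nat_var s'')(''x'' := Suc x)\<rparr>))"
      using x inv sh' \<rho>[OF x(1)] by (auto simp: shaped_def members_Suc chain_update nth_list_update)
  qed (use start in \<open>auto simp: n_in\<close>)
qed auto

text \<open>Adjacency entries in the order in which the program meets them; an edge inside the part
  occurs in both directions.\<close>

definition arcs_from :: "nat list \<Rightarrow> (nat \<times> nat) list" where
  "arcs_from xs = concat (map (\<lambda>x. map (Pair x) (ns x)) xs)"

lemma arcs_from_snoc: "arcs_from (xs @ [x]) = arcs_from xs @ map (Pair x) (ns x)"
  by (simp add: arcs_from_def)

lemma arcs_from_Nil [simp]: "arcs_from [] = []"
  by (simp add: arcs_from_def)

lemma arcs_from_members:
  "distinct (arcs_from (members \<rho> r n))"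
  "set (arcs_from (members \<rho> r n)) = {(x, y). x \<in> part_of {..<n} \<rho> r \<and> {x, y} \<in> E}"
proof -
  have "distinct (arcs_from xs)" if "distinct xs" "set xs \<subseteq> {..<n}" for xs
    using that by (induction xs) (auto simp: arcs_from_def distinct_map ns intro: inj_onI)
  then show "distinct (arcs_from (members \<rho> r n))" by (simp add: set_members part_of_def subset_iff)
  show "set (arcs_from (members \<rho> r n)) = {(x, y). x \<in> part_of {..<n} \<rho> r \<and> {x, y} \<in> E}"
    by (auto simp: arcs_from_def set_members part_of_def neighbour)
qed

definition arcs_into :: "(nat \<Rightarrow> nat) \<Rightarrow> nat \<Rightarrow> (nat \<times> nat) list \<Rightarrow> (nat \<times> nat) list" where
  "arcs_into \<rho> q zz = filter (\<lambda>a. \<rho> (snd a) = q) zz"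

definition arcs_importance :: "(nat \<times> nat) list \<Rightarrow> real" where
  "arcs_importance zz = sum_list (map (\<lambda>(x, y). C {x, y}) zz)"

abbreviation "part \<rho> r \<equiv> part_of {..<n} \<rho> r"

lemma arcs_into_members:
  fixes \<rho> r q defines "zz \<equiv> arcs_into \<rho> q (arcs_from (members \<rho> r n))"
  shows "length zz = card {(x, y) \<in> part \<rho> r \<times> part \<rho> q. {x, y} \<in> E}"
    "arcs_importance zz = (\<Sum>(x, y) \<in> {(x, y) \<in> part \<rho> r \<times> part \<rho> q. {x, y} \<in> E}. C {x, y})"
proof -
  have d: "distinct zz" using arcs_from_members by (simp add: zz_def arcs_into_def)
  have s: "set zz = {(x, y) \<in> part \<rho> r \<times> part \<rho> q. {x, y} \<in> E}"
    using edge_less by (auto simp: zz_def arcs_into_def arcs_from_members part_of_def)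
  show "length zz = card {(x, y) \<in> part \<rho> r \<times> part \<rho> q. {x, y} \<in> E}"
    using distinct_card[OF d] s by simp
  show "arcs_importance zz = (\<Sum>(x, y) \<in> {(x, y) \<in> part \<rho> r \<times> part \<rho> q. {x, y} \<in> E}. C {x, y})"
    unfolding arcs_importance_def sum_list_distinct_conv_sum_set[OF d] s ..
qed

definition ns_value :: "(nat \<Rightarrow> nat) \<Rightarrow> nat \<Rightarrow> nat \<Rightarrow> real" where
  "ns_value \<rho> r q = nSedge E C (part \<rho> r) (part \<rho> q)"

definition s_value :: "(nat \<Rightarrow> nat) \<Rightarrow> nat \<Rightarrow> nat \<Rightarrow> real" where
  "s_value \<rho> r q = Sedge {..<n} E (part \<rho> r) (part \<rho> q)"

lemma finite_part [simp]: "finite (part \<rho> r)"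
  by (simp add: part_of_def)

lemma part_disjoint: "r \<noteq> q \<Longrightarrow> part \<rho> r \<inter> part \<rho> q = {}"
  by (auto simp: part_of_def)

text \<open>The counters of the program are sums over arcs; within a part they are twice the sums
  over edges, which the divisions by 2 undo.\<close>

lemma values_within:
  fixes \<rho> :: "nat \<Rightarrow> nat"
  defines "zz r \<equiv> arcs_into \<rho> r (arcs_from (members \<rho> r n))" and "k r \<equiv> length (members \<rho> r n)"
  shows "arcs_importance (zz r) / 2 = ns_value \<rho> r r"
    "spurious_importance {..<n} E * real (k r * (k r - 1) - length (zz r)) / 2 = s_value \<rho> r r"
  using sum_arcs_within[OF finite_part[of \<rho> r] E_pairs, where f = C]
    Sedge_within[OF finite_part[of \<rho> r] E_pairs]
  by (simp_all add: zz_def k_def arcs_into_members ns_value_def s_value_def nSedge_def length_members)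

lemma values_between:
  fixes \<rho> :: "nat \<Rightarrow> nat"
  defines "zz r q \<equiv> arcs_into \<rho> q (arcs_from (members \<rho> r n))" and "k r \<equiv> length (members \<rho> r n)"
  assumes "r \<noteq> q"
  shows "arcs_importance (zz r q) = ns_value \<rho> r q"
    "spurious_importance {..<n} E * real (k r * k q - length (zz r q)) = s_value \<rho> r q"
  using sum_arcs_between[OF part_disjoint[OF assms(3), of \<rho>], where E = E and f = C]
    Sedge_between[OF finite_part finite_part part_disjoint[OF assms(3), of \<rho>], where V = "{..<n}" and E = E]
  by (simp_all add: zz_def k_def arcs_into_members ns_value_def s_value_def nSedge_def length_members)


text \<open>A zero counter marks a label that is not yet on the stack. So the stack lists each
  reached label once, and only these have to be cleared.\<close>

definition arc_state :: "(nat \<Rightarrow> nat) \<Rightarrow> (nat \<times> nat) list \<Rightarrow> store \<Rightarrow> bool" where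
  "arc_state \<rho> zz s \<longleftrightarrow>
    (\<forall>q<n. nat_arr s ''edges'' ! q = length (arcs_into \<rho> q zz) \<and>
      real_arr s ''import'' ! q = arcs_importance (arcs_into \<rho> q zz)) \<and>
    nat_var s ''touched'' \<le> n \<and> distinct (take (nat_var s ''touched'') (nat_arr s ''stack'')) \<and>
    set (take (nat_var s ''touched'') (nat_arr s ''stack'')) = (\<lambda>a. \<rho> (snd a)) ` set zz \<and>
    (\<lambda>a. \<rho> (snd a)) ` set zz \<subseteq> {..<n}"

lemma shaped_nat_var [simp]: "shaped (s\<lparr>nat_var := f\<rparr>) \<longleftrightarrow> shaped s"
  by (simp add: shaped_def)

lemma arc_state_nat_var [simp]:
  "arc_state \<rho> zz (s\<lparr>nat_var := (nat_var s)(x := v)\<rparr>) \<longleftrightarrow> arc_state \<rho> zz s" if "x \<noteq> ''touched''"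
  using that by (simp add: arc_state_def)

definition arc_body :: com where
  "arc_body = (''q'' ::= Arr ''rep'' (In ''adj'' (Var ''p'')) ;;
          Cond (NEq (Arr ''edges'' (Var ''q'')) (Lit 0))
           (Store ''stack'' (Var ''touched'') (Var ''q'') ;;
            ''touched'' ::= Var ''touched'' \<oplus> Lit 1)
           Skip ;;
          Store ''edges'' (Var ''q'') (Arr ''edges'' (Var ''q'') \<oplus> Lit 1) ;;
          RStore ''import'' (Var ''q'')
            (RArr ''import'' (Var ''q'') \<oplus>\<^sub>r RIn ''imp'' (Var ''p'')))"

definition labelled :: "(nat \<Rightarrow> nat) \<Rightarrow> store \<Rightarrow> bool" where
  "labelled \<rho> s \<longleftrightarrow> (\<forall>x<n. nat_arr s ''rep'' ! x = \<rho> x \<and> \<rho> x < n)"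

lemma wp_arc_body:
  assumes x: "x < n" and p: "nat_var s ''p'' = p" "off x \<le> p" "p < off (Suc x)"
    and sh: "shaped s" and lab: "labelled \<rho> s" and st: "arc_state \<rho> zz s"
  shows "wp I arc_body s (\<lambda>t s'. t \<le> 40 \<and> nat_var s' ''p'' = p \<and> shaped s' \<and>
    arc_state \<rho> (zz @ [(x, ns x ! (p - off x))]) s')"
proof -
  let ?y = "ns x ! (p - off x)" and ?tc = "nat_var s ''touched''"
  define q where "q = \<rho> ?y"
  have "?y \<in> set (ns x)" using p by (simp add: off_Suc)
  then have y: "?y < n" using neighbour_less[OF x] by blast
  then have q: "q < n" "nat_arr s ''rep'' ! ?y = q" using lab by (simp_all add: labelled_def q_def)
  have adj: "nat_in I ''adj'' ! p = ?y" "p < length (nat_in I ''adj'')"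
    using adj_nth[OF x p(2,3)] adj_length by simp_all
  note imp = imp_nth[OF x p(2,3)]
  have into: "arcs_into \<rho> r (zz @ [(x, ?y)]) = arcs_into \<rho> r zz @ (if r = q then [(x, ?y)] else [])" for r
    by (simp add: arcs_into_def q_def)
  have edges0: "nat_arr s ''edges'' ! q = 0 \<longleftrightarrow> q \<notin> (\<lambda>a. \<rho> (snd a)) ` set zz"
    using st q(1) by (auto simp: arc_state_def arcs_into_def filter_empty_conv)
  \<comment> \<open>Pigeonhole: if \<open>q\<close> is still to be pushed, the distinct labels on
    the stack form a proper subset of those below \<open>n\<close>.\<close>
  have room: "?tc < n" if "nat_arr s ''edges'' ! q = 0"
  proof -
    let ?T = "set (take ?tc (nat_arr s ''stack''))"
    have "q \<notin> ?T" "?T \<subseteq> {..<n}" using that edges0 st by (auto simp: arc_state_def)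
    have "distinct (take ?tc (nat_arr s ''stack''))" "?tc \<le> length (nat_arr s ''stack'')"
      using st sh by (auto simp: arc_state_def shaped_def)
    from distinct_card[OF this(1)] this(2) have "card ?T = ?tc" by simp
    from \<open>q \<notin> ?T\<close> \<open>?T \<subseteq> {..<n}\<close> have "?T \<subset> {..<n}" using q(1) by blast
    then have "card ?T < card {..<n}" by (rule psubset_card_mono[rotated]) simp
    then show ?thesis using \<open>card ?T = ?tc\<close> by simp
  qed
  have img: "(\<lambda>a. \<rho> (snd a)) ` set (zz @ [(x, ?y)]) = insert q ((\<lambda>a. \<rho> (snd a)) ` set zz)"
    by (simp add: q_def)
  have vals: "arcs_importance (as @ [(x, ?y)]) = arcs_importance as + C {x, ?y}" for as
    by (simp add: arcs_importance_def)
  show ?thesis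
  proof (cases "nat_arr s ''edges'' ! q = 0")
    case True
    then show ?thesis
      unfolding arc_body_def
      using p adj imp q y sh st into img vals room edges0
      by (auto simp: arc_state_def shaped_def nth_list_update take_Suc_conv_app_nth)
  next
    case False
    then show ?thesis
      unfolding arc_body_def
      using p adj imp q y sh st into img vals edges0
      by (auto simp: arc_state_def shaped_def nth_list_update)
  qed
qed

lemma wp_arc_loop:
  assumes x: "x < n" "nat_var s ''x'' = x"
    and sh: "shaped s" and lab: "labelled \<rho> s" and st: "arc_state \<rho> zz s"
  shows "wp I (For ''p'' (In ''off'' (Var ''x'')) (In ''off'' (Var ''x'' \<oplus> Lit 1)) arc_body) s
    (\<lambda>t s'. t \<le> length (ns x) * 51 + 10 \<and> shaped s' \<and> arc_state \<rho> (zz @ map (Pair x) (ns x)) s')"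
proof (rule wp_mono)
  let ?F = "For ''p'' (In ''off'' (Var ''x'')) (In ''off'' (Var ''x'' \<oplus> Lit 1)) arc_body"
  let ?Inv = "\<lambda>p (s' :: store). shaped s' \<and> arc_state \<rho> (zz @ map (Pair x) (take (p - off x) (ns x))) s'"
  show "wp I ?F s (\<lambda>t s'. t \<le> (off (Suc x) - off x) * (40 + 7 + ncost (In ''off'' (Var ''x'' \<oplus> Lit 1))) + 4 +
        ncost (In ''off'' (Var ''x'')) + ncost (In ''off'' (Var ''x'' \<oplus> Lit 1)) \<and>
      nat_var s' ''p'' = off (Suc x) \<and> frame ?F s s' \<and> ?Inv (off (Suc x)) s')"
  proof (rule wp_For[where Inv = ?Inv])
    show "off x \<le> off (Suc x)" by (simp add: off_Suc)
    show "nsafe I s (In ''off'' (Var ''x''))" "nval I s (In ''off'' (Var ''x'')) = off x"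
      using x by (simp_all add: off_nth off_length)
    show "?Inv (off x) (s\<lparr>nat_var := (nat_var s)(''p'' := off x)\<rparr>)"
      using sh st by (simp add: shaped_def arc_state_def)
    fix p s' assume p: "off x \<le> p" "nat_var s' ''p'' = p" and inv: "?Inv p s'" and fr: "frame ?F s s'"
    have "nat_var s' ''x'' = x" by (simp add: frameD[OF fr] arc_body_def x)
    then show "nsafe I s' (In ''off'' (Var ''x'' \<oplus> Lit 1)) \<and> nval I s' (In ''off'' (Var ''x'' \<oplus> Lit 1)) = off (Suc x)"
      using x by (simp add: off_nth off_length)
    assume less: "p < off (Suc x)"
    have lab': "labelled \<rho> s'" using lab by (simp add: labelled_def frameD[OF fr] arc_body_def)
    have i: "p - off x < length (ns x)" "Suc p - off x = Suc (p - off x)" using p less by (auto simp: off_Suc)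
    show "wp I arc_body s' (\<lambda>t s''. t \<le> 40 \<and> nat_var s'' ''p'' = p \<and>
        ?Inv (Suc p) (s''\<lparr>nat_var := (nat_var s'')(''p'' := Suc p)\<rparr>))"
    proof (rule wp_mono[OF wp_arc_body[OF x(1) p(2,1) less _ lab']])
      show "shaped s'" "arc_state \<rho> (zz @ map (Pair x) (take (p - off x) (ns x))) s'" using inv by auto
      fix t s'' assume *: "t \<le> 40 \<and> nat_var s'' ''p'' = p \<and> shaped s'' \<and>
        arc_state \<rho> ((zz @ map (Pair x) (take (p - off x) (ns x))) @ [(x, ns x ! (p - off x))]) s''"
      moreover have "(zz @ map (Pair x) (take (p - off x) (ns x))) @ [(x, ns x ! (p - off x))]
          = zz @ map (Pair x) (take (Suc p - off x) (ns x))"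
        using i by (simp add: take_Suc_conv_app_nth)
      ultimately show "t \<le> 40 \<and> nat_var s'' ''p'' = p \<and>
          ?Inv (Suc p) (s''\<lparr>nat_var := (nat_var s'')(''p'' := Suc p)\<rparr>)"
        by (simp only: arc_state_nat_var shaped_nat_var) simp
    qed
  qed
qed (auto simp: off_Suc)

definition part_body :: com where
  "part_body = (For ''p'' (In ''off'' (Var ''x'')) (In ''off'' (Var ''x'' \<oplus> Lit 1)) arc_body ;;
        ''x'' ::= Arr ''next'' (Var ''x''))"

definition part_time :: "nat list \<Rightarrow> nat" where
  "part_time xs = (\<Sum>x\<leftarrow>xs. length (ns x) * 51 + 20)"

lemma wp_part_loop:
  assumes ch: "chain (nat_arr s ''next'') n (nat_var s ''x'') xs"
    and sh: "shaped s" and lab: "labelled \<rho> s" and st: "arc_state \<rho> [] s"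
  shows "wp I (While (BNot (NEq (Var ''x'') N)) part_body) s
    (\<lambda>t s'. t \<le> part_time xs + 6 \<and> shaped s' \<and> arc_state \<rho> (arcs_from xs) s')"
proof (rule wp_mono)
  let ?b = "BNot (NEq (Var ''x'') N)"
  let ?Inv = "\<lambda>k s'. \<exists>ys zs. xs = ys @ zs \<and> chain (nat_arr s ''next'') n (nat_var s' ''x'') zs \<and>
    shaped s' \<and> arc_state \<rho> (arcs_from ys) s' \<and> k = part_time zs + 6"
  show "wp I (While ?b part_body) s (\<lambda>t s'. t \<le> part_time xs + 6 \<and>
      (shaped s' \<and> arc_state \<rho> (arcs_from xs) s') \<and> frame part_body s s')"
  proof (rule wp_While[where Inv = ?Inv])
    show "?Inv (part_time xs + 6) s" by (rule exI[of _ "[]"], rule exI[of _ xs]) (use ch sh st in simp)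
    fix k s' assume inv: "?Inv k s'" and fr: "frame part_body s s'"
    then obtain ys zs where xs: "xs = ys @ zs" and ch': "chain (nat_arr s ''next'') n (nat_var s' ''x'') zs"
      and sh': "shaped s'" and st': "arc_state \<rho> (arcs_from ys) s'" and k: "k = part_time zs + 6" by blast
    show "bsafe I s' ?b" by (simp add: n_in)
    show "1 + bcost ?b \<le> k \<and> shaped s' \<and> arc_state \<rho> (arcs_from xs) s'" if "\<not> bval I s' ?b"
    proof -
      have "nat_var s' ''x'' = n" using that by (simp add: n_in)
      then have "zs = []" using ch' by (cases zs) auto
      then show ?thesis using xs sh' st' k by (simp add: part_time_def)
    qed
    show "wp I part_body s' (\<lambda>t s''. \<exists>k'. ?Inv k' s'' \<and> 1 + bcost ?b + t + k' \<le> k)" if "bval I s' ?b"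
    proof -
      have "nat_var s' ''x'' \<noteq> n" using that by (simp add: n_in)
      then obtain x zs' where zs: "zs = x # zs'" using ch' by (cases zs) auto
      then have x: "x < n" "nat_var s' ''x'' = x" "chain (nat_arr s ''next'') n (nat_arr s ''next'' ! x) zs'"
        using ch' by auto
      have lab': "labelled \<rho> s'" using lab by (simp add: labelled_def frameD[OF fr] part_body_def arc_body_def)
      let ?F = "For ''p'' (In ''off'' (Var ''x'')) (In ''off'' (Var ''x'' \<oplus> Lit 1)) arc_body"
      show ?thesis
        unfolding part_body_def wp_Seq
      proof (rule wp_frame[OF wp_arc_loop[OF x(1,2) sh' lab' st']])
        fix t s2 assume 2: "t \<le> length (ns x) * 51 + 10 \<and> shaped s2 \<and>
          arc_state \<rho> (arcs_from ys @ map (Pair x) (ns x)) s2" and fr2: "frame ?F s' s2"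
        have same: "nat_var s2 ''x'' = x" "nat_arr s2 ''next'' = nat_arr s ''next''"
          using x(2) by (simp_all add: frameD[OF fr2] frameD[OF fr] part_body_def arc_body_def)
        have "?Inv (part_time zs' + 6) (s2\<lparr>nat_var := (nat_var s2)(''x'' := nat_arr s ''next'' ! x)\<rparr>)"
          by (rule exI[of _ "ys @ [x]"], rule exI[of _ zs'])
            (use xs zs x 2 in \<open>simp add: arcs_from_snoc shaped_def arc_state_def\<close>)
        then show "wp I (''x'' ::= Arr ''next'' (Var ''x'')) s2 (\<lambda>t' s''. \<exists>k'. ?Inv k' s'' \<and> 1 + bcost ?b + (t + t') + k' \<le> k)"
          using same x 2 k zs by (simp add: shaped_def part_time_def, intro exI[of _ "part_time zs' + 6"])
            (simp add: part_time_def)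
      qed
    qed
  qed
qed auto


section \<open>Judging and clearing the reached parts\<close>

text \<open>\<open>Acc es u tp\<close> relates the superedges \<open>es\<close> met so far to the utility \<open>u\<close> and the output \<open>tp\<close>, the
  only places where the action leaves a trace.\<close>

definition performs ::
  "com \<Rightarrow> ((nat \<times> nat) list \<Rightarrow> real \<Rightarrow> nat list \<Rightarrow> bool) \<Rightarrow> (nat \<Rightarrow> nat) \<Rightarrow> bool" where
  "performs act Acc \<rho> \<longleftrightarrow> nat_vars_of act = {} \<and> real_vars_of act \<subseteq> {''u''} \<and>
    nat_arrs_of act = {} \<and> real_arrs_of act = {} \<and> \<not> allocates act \<and>
    (\<forall>s es r q. Acc es (real_var s ''u'') (tape s) \<longrightarrow> nat_var s ''r'' = r \<longrightarrow> nat_var s ''q'' = q \<longrightarrow>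
      real_var s ''ns'' = ns_value \<rho> r q \<longrightarrow> real_var s ''se'' = s_value \<rho> r q \<longrightarrow>
      wp I act s (\<lambda>t s'. t \<le> 20 \<and> Acc (es @ [(r, q)]) (real_var s' ''u'') (tape s')))"

lemma performs_step:
  assumes "performs act Acc \<rho>" "Acc es (real_var s ''u'') (tape s)" "nat_var s ''r'' = r" "nat_var s ''q'' = q"
    "real_var s ''ns'' = ns_value \<rho> r q" "real_var s ''se'' = s_value \<rho> r q"
  shows "wp I act s (\<lambda>t s'. t \<le> 20 \<and> Acc (es @ [(r, q)]) (real_var s' ''u'') (tape s'))"
  using assms unfolding performs_def by blast

definition judge :: "com \<Rightarrow> com" where
  "judge act = Cond (NLeq (Var ''r'') (Var ''q''))
         (Cond (NEq (Var ''r'') (Var ''q''))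
           (''ns'' ::=\<^sub>r RArr ''import'' (Var ''r'') \<oslash>\<^sub>r OfNat (Lit 2) ;;
            ''se'' ::=\<^sub>r RVar ''cs'' \<otimes>\<^sub>r
              OfNat (Arr ''size'' (Var ''r'') \<otimes> (Arr ''size'' (Var ''r'') \<ominus> Lit 1)
                \<ominus> Arr ''edges'' (Var ''r'')) \<oslash>\<^sub>r OfNat (Lit 2))
           (''ns'' ::=\<^sub>r RArr ''import'' (Var ''q'') ;;
            ''se'' ::=\<^sub>r RVar ''cs'' \<otimes>\<^sub>r
              OfNat (Arr ''size'' (Var ''r'') \<otimes> Arr ''size'' (Var ''q'')
                \<ominus> Arr ''edges'' (Var ''q''))) ;;
          Cond (RLeq (RVar ''se'') (RVar ''ns'')) act Skip)
         Skip"

text \<open>Two distinct parts joined by an edge meet twice, once from either side;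
  \<open>r \<le> q\<close> keeps one of the meetings.\<close>

definition found :: "(nat \<Rightarrow> nat) \<Rightarrow> nat \<Rightarrow> nat \<Rightarrow> bool" where
  "found \<rho> r q \<longleftrightarrow> r \<le> q \<and> s_value \<rho> r q \<le> ns_value \<rho> r q"

definition sized :: "(nat \<Rightarrow> nat) \<Rightarrow> store \<Rightarrow> bool" where
  "sized \<rho> s \<longleftrightarrow> real_var s ''cs'' = spurious_importance {..<n} E \<and>
    (\<forall>r<n. nat_arr s ''size'' ! r = length (members \<rho> r n))"

lemma wp_judge:
  assumes act: "performs act Acc \<rho>" and r: "nat_var s ''r'' = r" "r < n" and q: "nat_var s ''q'' = q" "q < n"
    and sh: "shaped s" and size: "sized \<rho> s"
    and edges: "nat_arr s ''edges'' ! q = length (arcs_into \<rho> q (arcs_from (members \<rho> r n)))"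
    and imp: "real_arr s ''import'' ! q = arcs_importance (arcs_into \<rho> q (arcs_from (members \<rho> r n)))"
    and acc: "Acc es (real_var s ''u'') (tape s)"
  shows "wp I (judge act) s (\<lambda>t s'. t \<le> 80 \<and>
    Acc (es @ (if found \<rho> r q then [(r, q)] else [])) (real_var s' ''u'') (tape s'))"
proof (cases "r \<le> q")
  case False
  then show ?thesis using r q acc by (simp add: judge_def found_def)
next
  case le: True
  define new where "new = (if found \<rho> r q then [(r, q)] else [])"
  define test where "test = Cond (RLeq (RVar ''se'') (RVar ''ns'')) act Skip"
  let ?s1 = "s\<lparr>real_var := (real_var s)(''ns'' := ns_value \<rho> r q, ''se'' := s_value \<rho> r q)\<rparr>"
  have test: "wp I test ?s1 (\<lambda>t s'. t \<le> 24 \<and> Acc (es @ new) (real_var s' ''u'') (tape s'))"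
  proof (cases "s_value \<rho> r q \<le> ns_value \<rho> r q")
    case True
    have "wp I act ?s1 (\<lambda>t s'. t \<le> 20 \<and> Acc (es @ [(r, q)]) (real_var s' ''u'') (tape s'))"
      by (rule performs_step[OF act]) (use acc r q in simp_all)
    then have "wp I act ?s1 (\<lambda>t s'. 4 + t \<le> 24 \<and> Acc (es @ new) (real_var s' ''u'') (tape s'))"
      by (rule wp_mono) (use True le in \<open>simp add: found_def new_def\<close>)
    then show ?thesis using True by (simp add: test_def)
  next
    case False
    then show ?thesis using acc by (simp add: found_def new_def test_def)
  qed
  have len: "length (nat_arr s ''size'') = n" "length (nat_arr s ''edges'') = n" "length (real_arr s ''import'') = n"
    using sh by (simp_all add: shaped_def)
  have sizes: "nat_arr s ''size'' ! r = length (members \<rho> r n)" "nat_arr s ''size'' ! q = length (members \<rho> q n)"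
    "real_var s ''cs'' = spurious_importance {..<n} E"
    using size r q by (auto simp: sized_def)
  have "wp I (judge act) s (\<lambda>t s'. t \<le> 80 \<and> Acc (es @ new) (real_var s' ''u'') (tape s'))"
  proof (cases "r = q")
    case True
    note v = values_within[of \<rho> r]
    show ?thesis
      unfolding judge_def test_def[symmetric]
      using True r q len sizes edges imp v
      by simp (rule wp_mono[OF test[unfolded True]], simp)
  next
    case False
    note v = values_between[OF False, of \<rho>]
    show ?thesis
      unfolding judge_def test_def[symmetric]
      using False le r q len sizes edges imp v
      by simp (rule wp_mono[OF test], simp)
  qed
  then show ?thesis by (simp add: new_def)
qed

lemma frame_judge:
  assumes "performs act Acc \<rho>" "frame (judge act) s s'"
  shows "nat_var s' = nat_var s" "nat_arr s' = nat_arr s" "real_arr s' = real_arr s"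
    "real_var s' ''cs'' = real_var s ''cs''" "shaped s' \<longleftrightarrow> shaped s"
proof -
  have "real_vars_of act \<subseteq> {''u''}" using assms(1) by (simp add: performs_def)
  then have cs: "''cs'' \<notin> real_vars_of (judge act)" by (auto simp: judge_def)
  show "nat_var s' = nat_var s" "nat_arr s' = nat_arr s" "real_arr s' = real_arr s"
    using assms by (auto simp: performs_def frame_def judge_def)
  show "real_var s' ''cs'' = real_var s ''cs''" using frameD(2)[OF assms(2) cs] .
  show "shaped s' \<longleftrightarrow> shaped s" using frame_shaped[OF assms(2)] assms(1) by (simp add: performs_def judge_def)
qed

definition pop_body :: "com \<Rightarrow> com" where
  "pop_body act = (''touched'' ::= Var ''touched'' \<ominus> Lit 1 ;;
        ''q'' ::= Arr ''stack'' (Var ''touched'') ;;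
        judge act ;;
        Store ''edges'' (Var ''q'') (Lit 0) ;;
        RStore ''import'' (Var ''q'') (OfNat (Lit 0)))"

lemma wp_pop_loop:
  fixes \<rho> r defines "zz \<equiv> arcs_from (members \<rho> r n)"
  assumes act: "performs act Acc \<rho>" and r: "nat_var s ''r'' = r" "r < n"
    and sh: "shaped s" and size: "sized \<rho> s" and st: "arc_state \<rho> zz s"
    and acc: "Acc es (real_var s ''u'') (tape s)"
  shows "wp I (While (NLess (Lit 0) (Var ''touched'')) (pop_body act)) s
    (\<lambda>t s'. t \<le> nat_var s ''touched'' * 110 + 4 \<and> shaped s' \<and>
      (\<forall>q<n. nat_arr s' ''edges'' ! q = 0 \<and> real_arr s' ''import'' ! q = 0) \<and>
      (\<exists>es'. Acc (es @ es') (real_var s' ''u'') (tape s') \<and> distinct es' \<and>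
        set es' = {(r, q) |q. q \<in> (\<lambda>a. \<rho> (snd a)) ` set zz \<and> found \<rho> r q}))"
proof (rule wp_mono)
  let ?b = "NLess (Lit 0) (Var ''touched'')"
  let ?stack = "nat_arr s ''stack''" and ?m0 = "nat_var s ''touched''"
  let ?st = "take ?m0 ?stack"
  have st': "distinct ?st" "set ?st = (\<lambda>a. \<rho> (snd a)) ` set zz" "set ?st \<subseteq> {..<n}" "?m0 \<le> n"
    "length ?st = ?m0" "length ?stack = n"
    using st sh by (auto simp: arc_state_def shaped_def)
  let ?Q = "\<lambda>s'. shaped s' \<and> (\<forall>q<n. nat_arr s' ''edges'' ! q = 0 \<and> real_arr s' ''import'' ! q = 0) \<and>
      (\<exists>es'. Acc (es @ es') (real_var s' ''u'') (tape s') \<and> distinct es' \<and>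
        set es' = {(r, q) |q. q \<in> (\<lambda>a. \<rho> (snd a)) ` set zz \<and> found \<rho> r q})"
  \<comment> \<open>With \<open>m\<close> labels left on the stack, their counters are intact, while
    the labels popped before have been judged and cleared.\<close>
  define popped where "popped m es' s' \<longleftrightarrow> (nat_var s' ''touched'' = m \<and> m \<le> ?m0 \<and>
      nat_var s' ''r'' = r \<and> nat_arr s' ''stack'' = ?stack \<and> shaped s' \<and> sized \<rho> s' \<and>
      (\<forall>q<n. nat_arr s' ''edges'' ! q = (if q \<in> set (take m ?stack) then length (arcs_into \<rho> q zz) else 0) \<and>
        real_arr s' ''import'' ! q = (if q \<in> set (take m ?stack) then arcs_importance (arcs_into \<rho> q zz) else 0)) \<and>
      Acc (es @ es') (real_var s' ''u'') (tape s') \<and> distinct es' \<and>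
      set es' = {(r, q) |q. q \<in> set (drop m ?st) \<and> found \<rho> r q})" for m es' and s' :: store
  define Inv where "Inv k s' \<longleftrightarrow> (\<exists>m es'. popped m es' s' \<and> k = m * 110 + 4)" for k and s' :: store
  show "wp I (While ?b (pop_body act)) s (\<lambda>t s'. t \<le> ?m0 * 110 + 4 \<and> ?Q s' \<and> frame (pop_body act) s s')"
  proof (rule wp_While[where Inv = Inv])
    have "arcs_into \<rho> q zz = []" if "q \<notin> set ?st" for q
      using that st'(2) by (auto simp: arcs_into_def filter_empty_conv)
    then show "Inv (?m0 * 110 + 4) s"
      unfolding Inv_def popped_def using st r sh size acc
      by (intro exI[of _ ?m0] exI[of _ "[]"]) (auto simp: arc_state_def arcs_importance_def)
    fix k s' assume inv: "Inv k s'"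
    show "bsafe I s' ?b" by simp
    obtain m es' where m: "nat_var s' ''touched'' = m" "m \<le> ?m0" "k = m * 110 + 4"
      and r': "nat_var s' ''r'' = r" and stack: "nat_arr s' ''stack'' = ?stack" and sh': "shaped s'"
      and size': "sized \<rho> s'"
      and arr: "\<And>q. q < n \<Longrightarrow> nat_arr s' ''edges'' ! q = (if q \<in> set (take m ?stack) then length (arcs_into \<rho> q zz) else 0)"
        "\<And>q. q < n \<Longrightarrow> real_arr s' ''import'' ! q = (if q \<in> set (take m ?stack) then arcs_importance (arcs_into \<rho> q zz) else 0)"
      and es': "Acc (es @ es') (real_var s' ''u'') (tape s')" "distinct es'"
        "set es' = {(r, q) |q. q \<in> set (drop m ?st) \<and> found \<rho> r q}"
    proof -
      obtain m es' where "popped m es' s'" "k = m * 110 + 4" using inv unfolding Inv_def by blast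
      then show ?thesis using that[of m es'] unfolding popped_def by simp
    qed
    show "1 + bcost ?b \<le> k \<and> ?Q s'" if "\<not> bval I s' ?b"
    proof -
      have "m = 0" using that m by simp
      then show ?thesis using m sh' arr es' st'(2) by auto
    qed
    show "wp I (pop_body act) s' (\<lambda>t s''. \<exists>k'. Inv k' s'' \<and> 1 + bcost ?b + t + k' \<le> k)" if "bval I s' ?b"
    proof -
      have "0 < m" using that m by simp
      then obtain m' where m': "m = Suc m'" using gr0_conv_Suc by blast
      define q where "q = ?stack ! m'"
      have mlt: "m' < length ?st" "m' < ?m0" "m' < n" using m m' st' by auto
      have qst: "?st ! m' = q" using mlt by (simp add: q_def)
      then have "q \<in> set ?st" using mlt nth_mem by blast
      then have qn: "q < n" using st'(3) by auto
      have tk: "take m ?stack = take m' ?stack @ [q]" using mlt st' m' by (simp add: take_Suc_conv_app_nth q_def)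
      have "take m ?st = take m ?stack" using m(2) by simp
      then have "distinct (take m ?stack)" using distinct_take[OF st'(1), of m] by simp
      \<comment> \<open>Labels on the stack are distinct, so clearing \<open>q\<close> does not
        destroy a counter still to be read.\<close>
      then have qnew: "q \<notin> set (take m' ?stack)" using tk by simp
      have dr: "drop m' ?st = q # drop m ?st" using mlt qst m' by (metis Cons_nth_drop_Suc)
      have "distinct (drop m' ?st)" using st'(1) by simp
      then have qd: "q \<notin> set (drop m ?st)" using dr by simp
      let ?s1 = "s'\<lparr>nat_var := (nat_var s')(''touched'' := m', ''q'' := q)\<rparr>"
      let ?es = "if found \<rho> r q then [(r, q)] else []"
      let ?clear = "Store ''edges'' (Var ''q'') (Lit 0) ;; RStore ''import'' (Var ''q'') (OfNat (Lit 0))"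
      have "wp I (judge act) ?s1 (\<lambda>t s2. t \<le> 80 \<and> Acc ((es @ es') @ ?es) (real_var s2 ''u'') (tape s2))"
      proof (rule wp_judge[OF act])
        show "nat_arr ?s1 ''edges'' ! q = length (arcs_into \<rho> q (arcs_from (members \<rho> r n)))"
          "real_arr ?s1 ''import'' ! q = arcs_importance (arcs_into \<rho> q (arcs_from (members \<rho> r n)))"
          using arr[OF qn] tk by (simp_all add: zz_def)
      qed (use r r' qn sh' size' es' in \<open>simp_all add: sized_def\<close>)
      then have "wp I (judge act ;; ?clear) ?s1 (\<lambda>t s''. t \<le> 90 \<and> Inv (m' * 110 + 4) s'')"
        unfolding wp_Seq[of I "judge act"]
      proof (rule wp_frame)
        fix t :: nat and s2 assume 2: "t \<le> 80 \<and> Acc ((es @ es') @ ?es) (real_var s2 ''u'') (tape s2)"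
          and fr: "frame (judge act) ?s1 s2"
        note same = frame_judge[OF act fr]
        have sh2: "shaped s2" using same(5) sh' by simp
        have "length (nat_arr s2 ''edges'') = n" "length (real_arr s2 ''import'') = n" using sh2 by (simp_all add: shaped_def)
        let ?s3 = "s2\<lparr>nat_arr := (nat_arr s2)(''edges'' := (nat_arr s2 ''edges'')[q := 0]),
          real_arr := (real_arr s2)(''import'' := (real_arr s2 ''import'')[q := 0])\<rparr>"
        have "Inv (m' * 110 + 4) ?s3"
          unfolding Inv_def popped_def
        proof (intro exI[of _ m'] exI[of _ "es' @ ?es"] conjI)
          show "shaped ?s3" using sh2 by (simp add: shaped_def)
          show "sized \<rho> ?s3" using size' same by (simp add: sized_def)
          show "distinct (es' @ ?es)" using es' qd by auto
          show "set (es' @ ?es) = {(r, q) |q. q \<in> set (drop m' ?st) \<and> found \<rho> r q}"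
            using es'(3) unfolding dr by auto
          show "Acc (es @ es' @ ?es) (real_var ?s3 ''u'') (tape ?s3)" using 2 by simp
          show "\<forall>p<n. nat_arr ?s3 ''edges'' ! p = (if p \<in> set (take m' ?stack) then length (arcs_into \<rho> p zz) else 0) \<and>
            real_arr ?s3 ''import'' ! p = (if p \<in> set (take m' ?stack) then arcs_importance (arcs_into \<rho> p zz) else 0)"
          proof (intro allI impI)
            fix p assume p: "p < n"
            show "nat_arr ?s3 ''edges'' ! p = (if p \<in> set (take m' ?stack) then length (arcs_into \<rho> p zz) else 0) \<and>
              real_arr ?s3 ''import'' ! p = (if p \<in> set (take m' ?stack) then arcs_importance (arcs_into \<rho> p zz) else 0)"
              using arr[OF p] tk qnew p \<open>length (nat_arr s2 ''edges'') = n\<close> \<open>length (real_arr s2 ''import'') = n\<close> same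
              by (cases "p = q") simp_all
          qed
        qed (use m m' r' stack same in auto)
        moreover have "nat_var s2 ''q'' = q" using same by simp
        ultimately show "wp I ?clear s2 (\<lambda>t' s''. t + t' \<le> 90 \<and> Inv (m' * 110 + 4) s'')"
          using 2 qn \<open>length (nat_arr s2 ''edges'') = n\<close> \<open>length (real_arr s2 ''import'') = n\<close> by simp
      qed
      then have "wp I (judge act ;; ?clear) ?s1 (\<lambda>t s''. Inv (m' * 110 + 4) s'' \<and> 1 + bcost ?b + (7 + t) + (m' * 110 + 4) \<le> k)"
        by (rule wp_mono) (use m m' in simp)
      then have "wp I (judge act ;; ?clear) ?s1 (\<lambda>t s''. \<exists>k'. Inv k' s'' \<and> 1 + bcost ?b + (7 + t) + k' \<le> k)"
        by (rule wp_mono) blast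
      then show ?thesis
        unfolding pop_body_def
        using m m' mlt stack st'
        by (simp add: q_def[symmetric] del: wp_Store wp_RStore) (erule wp_mono, erule wp_mono, erule wp_mono, simp add: ac_simps)
    qed
  qed
qed auto


section \<open>A scan over all parts\<close>

definition region_body :: "com \<Rightarrow> com" where
  "region_body act = (''touched'' ::= Lit 0 ;;
      ''x'' ::= Arr ''head'' (Var ''r'') ;;
      While (BNot (NEq (Var ''x'') N)) part_body ;;
      While (NLess (Lit 0) (Var ''touched'')) (pop_body act))"

lemma scan_superedges_eq: "scan_superedges act =
    scan_clear ;;
    scan_link ;;
    For ''r'' (Lit 0) N (region_body act)"
  by (simp add: scan_superedges_def region_body_def part_body_def arc_body_def pop_body_def judge_def)

definition found_at :: "(nat \<Rightarrow> nat) \<Rightarrow> nat \<Rightarrow> (nat \<times> nat) set" where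
  "found_at \<rho> r = {(r, q) |q. q \<in> (\<lambda>a. \<rho> (snd a)) ` set (arcs_from (members \<rho> r n)) \<and> found \<rho> r q}"

definition cleared :: "store \<Rightarrow> bool" where
  "cleared s \<longleftrightarrow> (\<forall>q<n. nat_arr s ''edges'' ! q = 0 \<and> real_arr s ''import'' ! q = 0)"

definition chained :: "(nat \<Rightarrow> nat) \<Rightarrow> store \<Rightarrow> bool" where
  "chained \<rho> s \<longleftrightarrow> (\<forall>r<n. chain (nat_arr s ''next'') n (nat_arr s ''head'' ! r) (members \<rho> r n))"

text \<open>161 is 51 for scanning an arc plus 110 for the label that it may have put on the stack.
  Summing over members lets the costs of all parts add up over the adjacency lists.\<close>

definition region_time :: "(nat \<Rightarrow> nat) \<Rightarrow> nat \<Rightarrow> nat" where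
  "region_time \<rho> r = (\<Sum>x \<in> part \<rho> r. length (ns x) * 161 + 20) + 20"

lemma frame_part_loop:
  assumes "frame (While b part_body) s s'"
  shows "nat_var s' ''r'' = nat_var s ''r''" "real_var s' = real_var s" "tape s' = tape s"
    "nat_arr s' ''size'' = nat_arr s ''size''"
  using assms by (auto simp: frame_def part_body_def arc_body_def)

lemma touched_le:
  assumes "arc_state \<rho> zz s" "shaped s"
  shows "nat_var s ''touched'' \<le> length zz"
proof -
  let ?T = "take (nat_var s ''touched'') (nat_arr s ''stack'')"
  have "length ?T = nat_var s ''touched''" "distinct ?T" using assms by (auto simp: arc_state_def shaped_def)
  then have "nat_var s ''touched'' = card (set ?T)" using distinct_card by metis
  also have "\<dots> = card ((\<lambda>a. \<rho> (snd a)) ` set zz)" using assms by (simp add: arc_state_def)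
  also have "\<dots> \<le> card (set zz)" by (rule card_image_le) simp
  also have "\<dots> \<le> length zz" by (rule card_length)
  finally show ?thesis .
qed

lemma region_time_bound:
  "part_time (members \<rho> r n) + length (arcs_from (members \<rho> r n)) * 110 + 20 \<le> region_time \<rho> r"
proof -
  have "part_time xs + length (arcs_from xs) * 110 = (\<Sum>x\<leftarrow>xs. length (ns x) * 161 + 20)" for xs
    by (induction xs) (simp_all add: part_time_def arcs_from_def)
  moreover have "(\<Sum>x\<leftarrow>members \<rho> r n. length (ns x) * 161 + 20) = (\<Sum>x \<in> part \<rho> r. length (ns x) * 161 + 20)"
    by (simp add: sum_list_distinct_conv_sum_set set_members)
  ultimately show ?thesis by (simp add: region_time_def)
qed

lemma wp_region_body:
  assumes act: "performs act Acc \<rho>" and r: "nat_var s ''r'' = r" "r < n"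
    and sh: "shaped s" and size: "sized \<rho> s" and lab: "labelled \<rho> s" and ch: "chained \<rho> s"
    and clr: "cleared s" and acc: "Acc es (real_var s ''u'') (tape s)"
  shows "wp I (region_body act) s (\<lambda>t s'. t \<le> region_time \<rho> r \<and> shaped s' \<and> cleared s' \<and> nat_var s' ''r'' = r \<and>
    (\<exists>es'. Acc (es @ es') (real_var s' ''u'') (tape s') \<and> distinct es' \<and> set es' = found_at \<rho> r))"
proof -
  let ?xs = "members \<rho> r n"
  let ?part = "While (BNot (NEq (Var ''x'') N)) part_body"
  let ?pop = "While (NLess (Lit 0) (Var ''touched'')) (pop_body act)"
  let ?Q = "\<lambda>s'. shaped s' \<and> cleared s' \<and> nat_var s' ''r'' = r \<and>
    (\<exists>es'. Acc (es @ es') (real_var s' ''u'') (tape s') \<and> distinct es' \<and> set es' = found_at \<rho> r)"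
  let ?s1 = "s\<lparr>nat_var := (nat_var s)(''touched'' := 0, ''x'' := nat_arr s ''head'' ! r)\<rparr>"
  have len: "length (nat_arr s ''head'') = n" using sh by (simp add: shaped_def)
  have "wp I (?part ;; ?pop) ?s1 (\<lambda>t s'. 5 + t \<le> region_time \<rho> r \<and> ?Q s')"
    unfolding wp_Seq
  proof (rule wp_frame[OF wp_part_loop[where xs = ?xs and \<rho> = \<rho>]])
    show "chain (nat_arr ?s1 ''next'') n (nat_var ?s1 ''x'') ?xs" using ch r by (simp add: chained_def)
    show "shaped ?s1" "labelled \<rho> ?s1" using sh lab by (simp_all add: labelled_def)
    show "arc_state \<rho> [] ?s1" using clr by (simp add: arc_state_def cleared_def arcs_into_def arcs_importance_def)
    fix t s2 assume 2: "t \<le> part_time ?xs + 6 \<and> shaped s2 \<and> arc_state \<rho> (arcs_from ?xs) s2"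
      and fr: "frame ?part ?s1 s2"
    note same = frame_part_loop[OF fr]
    have size2: "sized \<rho> s2" using size same by (simp add: sized_def)
    have r2: "nat_var s2 ''r'' = r" using same r by simp
    show "wp I ?pop s2 (\<lambda>t' s'. 5 + (t + t') \<le> region_time \<rho> r \<and> ?Q s')"
    proof (rule wp_frame[OF wp_pop_loop[OF act r2 r(2) _ size2]])
      show "shaped s2" "arc_state \<rho> (arcs_from ?xs) s2" using 2 by auto
      show "Acc es (real_var s2 ''u'') (tape s2)" using acc same by simp
      fix t' s' assume 3: "t' \<le> nat_var s2 ''touched'' * 110 + 4 \<and> shaped s' \<and>
          (\<forall>q<n. nat_arr s' ''edges'' ! q = 0 \<and> real_arr s' ''import'' ! q = 0) \<and>
          (\<exists>es'. Acc (es @ es') (real_var s' ''u'') (tape s') \<and> distinct es' \<and>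
            set es' = {(r, q) |q. q \<in> (\<lambda>a. \<rho> (snd a)) ` set (arcs_from ?xs) \<and> found \<rho> r q})"
        and fr': "frame ?pop s2 s'"
      have "nat_vars_of act = {}" using act by (simp add: performs_def)
      then have "nat_var s' ''r'' = r" using frameD(1)[OF fr', of "''r''"] r2 by (simp add: pop_body_def judge_def)
      moreover have "nat_var s2 ''touched'' * 110 \<le> length (arcs_from ?xs) * 110"
        using touched_le[of \<rho> "arcs_from ?xs" s2] 2 by (intro mult_right_mono) auto
      ultimately show "5 + (t + t') \<le> region_time \<rho> r \<and> ?Q s'"
        using 2 3 region_time_bound[of \<rho> r] by (simp add: cleared_def found_at_def)
    qed
  qed
  then show ?thesis
    unfolding region_body_def
    using r len by simp (erule wp_mono, erule wp_mono, simp)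
qed

text \<open>The labels lie below \<open>n\<close>, so the parts with \<open>r < n\<close> split the
  vertices and every adjacency list is charged once. A scan is thus linear in the graph however many
  parts there are.\<close>

lemma sum_region_time:
  assumes "labelled \<rho> s"
  shows "(\<Sum>r<n. region_time \<rho> r) = off n * 161 + n * 40"
proof -
  have off: "(\<Sum>x<m. length (ns x)) = off m" for m by (induction m) (simp_all add: off_Suc)
  have "(\<Sum>r<n. \<Sum>x \<in> part \<rho> r. length (ns x) * 161 + 20) = (\<Sum>x<n. length (ns x) * 161 + 20)"
  proof -
    have "\<rho> ` {..<n} \<subseteq> {..<n}" using assms by (auto simp: labelled_def)
    from sum.group[OF _ _ this, of "\<lambda>x. length (ns x) * 161 + 20"] show ?thesis by (simp add: part_of_def)
  qed
  also have "\<dots> = off n * 161 + n * 20" by (simp add: sum.distrib off flip: sum_distrib_right)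
  finally show ?thesis by (simp add: region_time_def sum.distrib)
qed

lemma wp_regions:
  assumes act: "performs act Acc \<rho>"
    and sh: "shaped s" and size: "sized \<rho> s" and lab: "labelled \<rho> s" and ch: "chained \<rho> s"
    and clr: "cleared s" and acc: "Acc [] (real_var s ''u'') (tape s)"
  shows "wp I (For ''r'' (Lit 0) N (region_body act)) s (\<lambda>t s'. t \<le> off n * 161 + n * 50 + 7 \<and> shaped s' \<and>
    (\<exists>es. Acc es (real_var s' ''u'') (tape s') \<and> distinct es \<and> set es = (\<Union>r<n. found_at \<rho> r)))"
proof (rule wp_mono)
  let ?F = "For ''r'' (Lit 0) N (region_body act)"
  let ?Inv = "\<lambda>r k s'. shaped s' \<and> cleared s' \<and> k = (\<Sum>r'=r..<n. region_time \<rho> r' + 9) \<and>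
    (\<exists>es. Acc es (real_var s' ''u'') (tape s') \<and> distinct es \<and> set es = (\<Union>r'<r. found_at \<rho> r'))"
  let ?K = "\<Sum>r'=0..<n. region_time \<rho> r' + 9"
  show "wp I ?F s (\<lambda>t s'. nat_var s' ''r'' = n \<and> frame ?F s s' \<and>
    (\<exists>k'. ?Inv n k' s' \<and> t + k' \<le> 4 + ncost (Lit 0) + ncost N + ?K))"
  proof (rule wp_For_budget[where Inv = ?Inv])
    show "?Inv 0 ?K (s\<lparr>nat_var := (nat_var s)(''r'' := 0)\<rparr>)"
      using sh clr acc by (auto simp: cleared_def intro!: exI[of _ "[]"])
    fix r k s' assume r: "r < n" "nat_var s' ''r'' = r" and inv: "?Inv r k s'" and fr: "frame ?F s s'"
    have eff: "nat_vars_of act = {}" "nat_arrs_of act = {}" "real_arrs_of act = {}" "''cs'' \<notin> real_vars_of act"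
      using act by (auto simp: performs_def)
    have eff': "''rep'' \<notin> nat_arrs_of ?F" "''size'' \<notin> nat_arrs_of ?F" "''next'' \<notin> nat_arrs_of ?F"
      "''head'' \<notin> nat_arrs_of ?F" "''cs'' \<notin> real_vars_of ?F"
      using eff by (auto simp: region_body_def part_body_def arc_body_def pop_body_def judge_def)
    have same: "nat_arr s' ''rep'' = nat_arr s ''rep''" "nat_arr s' ''size'' = nat_arr s ''size''"
      "nat_arr s' ''next'' = nat_arr s ''next''" "nat_arr s' ''head'' = nat_arr s ''head''"
      "real_var s' ''cs'' = real_var s ''cs''"
      using frameD(3)[OF fr eff'(1)] frameD(3)[OF fr eff'(2)] frameD(3)[OF fr eff'(3)] frameD(3)[OF fr eff'(4)]
        frameD(2)[OF fr eff'(5)] by blast+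
    obtain es where es: "Acc es (real_var s' ''u'') (tape s')" "distinct es" "set es = (\<Union>r'<r. found_at \<rho> r')"
      using inv by blast
    show "wp I (region_body act) s' (\<lambda>t s''. nat_var s'' ''r'' = r \<and>
      (\<exists>k'. ?Inv (Suc r) k' (s''\<lparr>nat_var := (nat_var s'')(''r'' := Suc r)\<rparr>) \<and> 7 + ncost N + t + k' \<le> k))"
    proof (rule wp_mono[OF wp_region_body[OF act r(2,1)]])
      show "shaped s'" "cleared s'" "sized \<rho> s'" "labelled \<rho> s'" "chained \<rho> s'" "Acc es (real_var s' ''u'') (tape s')"
        using inv size lab ch same es by (simp_all add: sized_def labelled_def chained_def)
      fix t s'' assume *: "t \<le> region_time \<rho> r \<and> shaped s'' \<and> cleared s'' \<and> nat_var s'' ''r'' = r \<and>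
        (\<exists>es'. Acc (es @ es') (real_var s'' ''u'') (tape s'') \<and> distinct es' \<and> set es' = found_at \<rho> r)"
      then obtain es' where es': "Acc (es @ es') (real_var s'' ''u'') (tape s'')" "distinct es'" "set es' = found_at \<rho> r"
        by blast
      have "distinct (es @ es')" using es es' by (auto simp: found_at_def)
      moreover have "set (es @ es') = (\<Union>r'<Suc r. found_at \<rho> r')" using es es' by (auto simp: lessThan_Suc)
      moreover have "k = (region_time \<rho> r + 9) + (\<Sum>r'=Suc r..<n. region_time \<rho> r' + 9)"
        using inv r by (simp add: sum.atLeast_Suc_lessThan)
      ultimately show "nat_var s'' ''r'' = r \<and>
        (\<exists>k'. ?Inv (Suc r) k' (s''\<lparr>nat_var := (nat_var s'')(''r'' := Suc r)\<rparr>) \<and> 7 + ncost N + t + k' \<le> k)"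
        using * es'(1) by (intro conjI exI[of _ "\<Sum>r'=Suc r..<n. region_time \<rho> r' + 9"])
          (auto simp: cleared_def intro!: exI[of _ "es @ es'"])
    qed
  qed (auto simp: n_in)
  have "?K = off n * 161 + n * 49"
    using sum_region_time[OF lab] by (simp add: sum.distrib atLeast0LessThan)
  then show "\<And>t s'. nat_var s' ''r'' = n \<and> frame ?F s s' \<and>
      (\<exists>k'. ?Inv n k' s' \<and> t + k' \<le> 4 + ncost (Lit 0) + ncost N + ?K) \<Longrightarrow>
      t \<le> off n * 161 + n * 50 + 7 \<and> shaped s' \<and>
      (\<exists>es. Acc es (real_var s' ''u'') (tape s') \<and> distinct es \<and> set es = (\<Union>r<n. found_at \<rho> r))"
    by auto
qed

definition label_pairs :: "(nat \<Rightarrow> nat) \<Rightarrow> (nat \<times> nat) set" where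
  "label_pairs \<rho> = {(r, q). found \<rho> r q \<and> (\<exists>x y. {x, y} \<in> E \<and> \<rho> x = r \<and> \<rho> y = q)}"

lemma Union_found_at:
  assumes "labelled \<rho> s"
  shows "(\<Union>r<n. found_at \<rho> r) = label_pairs \<rho>"
proof -
  have \<rho>: "\<rho> x < n" if "x < n" for x using assms that by (simp add: labelled_def)
  have "(r, q) \<in> (\<Union>r<n. found_at \<rho> r) \<longleftrightarrow> (r, q) \<in> label_pairs \<rho>" for r q
  proof
    assume "(r, q) \<in> (\<Union>r<n. found_at \<rho> r)"
    then obtain x y where "(x, y) \<in> set (arcs_from (members \<rho> r n))" "q = \<rho> y" "found \<rho> r q"
      by (auto simp: found_at_def)
    then show "(r, q) \<in> label_pairs \<rho>"
      unfolding arcs_from_members label_pairs_def part_of_def by blast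
  next
    assume "(r, q) \<in> label_pairs \<rho>"
    then obtain x y where xy: "{x, y} \<in> E" "\<rho> x = r" "\<rho> y = q" "found \<rho> r q" by (auto simp: label_pairs_def)
    then have "(x, y) \<in> set (arcs_from (members \<rho> r n))"
      using edge_less by (auto simp: arcs_from_members part_of_def)
    from imageI[OF this, of "\<lambda>a. \<rho> (snd a)"]
    have "q \<in> (\<lambda>a. \<rho> (snd a)) ` set (arcs_from (members \<rho> r n))" using xy(3) by simp
    moreover have "r < n" using xy edge_less \<rho> by blast
    ultimately show "(r, q) \<in> (\<Union>r<n. found_at \<rho> r)" using xy by (auto simp: found_at_def)
  qed
  then show ?thesis by auto
qed

definition scan_time :: nat where
  "scan_time = off n * 161 + n * 102 + 21"

lemma wp_scan_superedges:
  assumes act: "performs act Acc \<rho>" and sh: "shaped s" and lab: "labelled \<rho> s"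
    and cs: "real_var s ''cs'' = spurious_importance {..<n} E" and acc: "Acc [] (real_var s ''u'') (tape s)"
  shows "wp I (scan_superedges act) s (\<lambda>t s'. t \<le> scan_time \<and> shaped s' \<and>
    (\<exists>es. Acc es (real_var s' ''u'') (tape s') \<and> distinct es \<and> set es = label_pairs \<rho>))"
proof -
  show ?thesis
    unfolding scan_superedges_eq wp_Seq[of I scan_clear]
  proof (rule wp_frame[OF wp_scan_clear[OF sh]])
    fix t1 s1 assume 1: "t1 \<le> n * 23 + 7 \<and> (\<forall>z<n. nat_arr s1 ''head'' ! z = n \<and> nat_arr s1 ''size'' ! z = 0 \<and>
      nat_arr s1 ''edges'' ! z = 0 \<and> real_arr s1 ''import'' ! z = 0)" and fr1: "frame scan_clear s s1"
    have same1: "nat_arr s1 ''rep'' = nat_arr s ''rep''" "real_var s1 = real_var s" "tape s1 = tape s" "shaped s1"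
      using frame_shaped[OF fr1] sh by (simp_all add: frameD[OF fr1] ext)
    show "wp I (scan_link ;; For ''r'' (Lit 0) N (region_body act)) s1 (\<lambda>t s'. t1 + t \<le> scan_time \<and> shaped s' \<and>
        (\<exists>es. Acc es (real_var s' ''u'') (tape s') \<and> distinct es \<and> set es = label_pairs \<rho>))"
      unfolding wp_Seq[of I scan_link]
    proof (rule wp_frame[OF wp_scan_link[where \<rho> = \<rho>]])
      show "shaped s1" by (rule same1)
      show "nat_arr s1 ''rep'' ! x = \<rho> x" "\<rho> x < n" if "x < n" for x
        using lab that same1 by (simp_all add: labelled_def)
      show "nat_arr s1 ''head'' ! z = n \<and> nat_arr s1 ''size'' ! z = 0" if "z < n" for z using 1 that by blast
      fix t2 s2 assume 2: "t2 \<le> n * 29 + 7 \<and> (\<forall>r<n. chain (nat_arr s2 ''next'') n (nat_arr s2 ''head'' ! r) (members \<rho> r n) \<and>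
          nat_arr s2 ''size'' ! r = length (members \<rho> r n))" and fr2: "frame scan_link s1 s2"
      have same2: "nat_arr s2 ''rep'' = nat_arr s ''rep''" "real_var s2 = real_var s" "tape s2 = tape s" "shaped s2"
        "nat_arr s2 ''edges'' = nat_arr s1 ''edges''" "real_arr s2 ''import'' = real_arr s1 ''import''"
        using frame_shaped[OF fr2] by (simp_all add: frameD[OF fr2] same1 ext)
      show "wp I (For ''r'' (Lit 0) N (region_body act)) s2 (\<lambda>t s'. t1 + (t2 + t) \<le> scan_time \<and> shaped s' \<and>
        (\<exists>es. Acc es (real_var s' ''u'') (tape s') \<and> distinct es \<and> set es = label_pairs \<rho>))"
      proof (rule wp_mono[OF wp_regions[OF act]])
        show "shaped s2" "sized \<rho> s2" "labelled \<rho> s2" "chained \<rho> s2" "cleared s2" "Acc [] (real_var s2 ''u'') (tape s2)"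
          using same2 1 2 lab cs acc by (simp_all add: sized_def labelled_def chained_def cleared_def)
        fix t3 s3 assume "t3 \<le> off n * 161 + n * 50 + 7 \<and> shaped s3 \<and>
          (\<exists>es. Acc es (real_var s3 ''u'') (tape s3) \<and> distinct es \<and> set es = (\<Union>r<n. found_at \<rho> r))"
        then show "t1 + (t2 + t3) \<le> scan_time \<and> shaped s3 \<and>
          (\<exists>es. Acc es (real_var s3 ''u'') (tape s3) \<and> distinct es \<and> set es = label_pairs \<rho>)"
          using 1 2 Union_found_at[OF lab] by (simp add: scan_time_def)
      qed
    qed
  qed
qed

end

section \<open>Search and output\<close>

context encoded
begin

text \<open>Pairs with \<open>r \<le> q\<close> represent label sets of one or two elements
  uniquely. So the pairs met by the scan add up to the utility without repetition, and each
  superedge is emitted once.\<close>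

lemma label_pairs_bij:
  "inj_on (\<lambda>(r, q). {r, q}) (label_pairs \<rho>)"
  "(\<lambda>(r, q). {r, q}) ` label_pairs \<rho> = label_superedges {..<n} E C \<rho>"
proof -
  show "inj_on (\<lambda>(r, q). {r, q}) (label_pairs \<rho>)"
    by (auto simp: inj_on_def label_pairs_def found_def doubleton_eq_iff)
  have net: "s_value \<rho> r q \<le> ns_value \<rho> r q \<longleftrightarrow> 0 \<le> net_gain {..<n} E C \<rho> {r, q}" for r q
    using nSedge_minus_Sedge[of "{..<n}" E C \<rho> r q] unfolding s_value_def ns_value_def by simp linarith
  show "(\<lambda>(r, q). {r, q}) ` label_pairs \<rho> = label_superedges {..<n} E C \<rho>"
  proof
    show "(\<lambda>(r, q). {r, q}) ` label_pairs \<rho> \<subseteq> label_superedges {..<n} E C \<rho>"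
    proof clarify
      fix r q assume "(r, q) \<in> label_pairs \<rho>"
      then obtain x y where "{x, y} \<in> E" "{r, q} = \<rho> ` {x, y}" "0 \<le> net_gain {..<n} E C \<rho> {r, q}"
        by (auto simp: label_pairs_def found_def net)
      then show "{r, q} \<in> label_superedges {..<n} E C \<rho>" unfolding label_superedges_def by blast
    qed
    show "label_superedges {..<n} E C \<rho> \<subseteq> (\<lambda>(r, q). {r, q}) ` label_pairs \<rho>"
    proof
      fix S assume "S \<in> label_superedges {..<n} E C \<rho>"
      then obtain e where e: "e \<in> E" "S = \<rho> ` e" "0 \<le> net_gain {..<n} E C \<rho> S" by (auto simp: label_superedges_def)
      then have "e \<in> pairs {..<n}" using E_pairs by blast
      then obtain u v where "e = {u, v}" by (rule pairsE)
      then obtain x y where xy: "e = {x, y}" "\<rho> x \<le> \<rho> y" by (metis insert_commute nat_le_linear)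
      then have "S = {\<rho> x, \<rho> y}" using e by simp
      moreover from this have "(\<rho> x, \<rho> y) \<in> label_pairs \<rho>"
        using e xy net[of "\<rho> x" "\<rho> y"] by (auto simp: label_pairs_def found_def)
      ultimately show "S \<in> (\<lambda>(r, q). {r, q}) ` label_pairs \<rho>" by force
    qed
  qed
qed

lemma utility_label_pairs:
  "utility {..<n} E C (part \<rho> ` \<rho> ` {..<n}) = (\<Sum>(r, q) \<in> label_pairs \<rho>. ns_value \<rho> r q - s_value \<rho> r q)"
proof -
  have "utility {..<n} E C (part \<rho> ` \<rho> ` {..<n}) = (\<Sum>S \<in> (\<lambda>(r, q). {r, q}) ` label_pairs \<rho>. net_gain {..<n} E C \<rho> S)"
    by (simp add: utility_labels[OF _ E_pairs] label_pairs_bij(2))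
  also have "\<dots> = (\<Sum>a \<in> label_pairs \<rho>. net_gain {..<n} E C \<rho> (case a of (r, q) \<Rightarrow> {r, q}))"
    by (subst sum.reindex[OF label_pairs_bij(1)]) simp
  also have "\<dots> = (\<Sum>(r, q) \<in> label_pairs \<rho>. ns_value \<rho> r q - s_value \<rho> r q)"
    by (intro sum.cong refl) (auto simp: ns_value_def s_value_def nSedge_minus_Sedge)
  finally show ?thesis .
qed

lemma wp_compute_utility:
  assumes sh: "shaped s" and lab: "labelled \<rho> s" and cs: "real_var s ''cs'' = spurious_importance {..<n} E"
  shows "wp I compute_utility s (\<lambda>t s'. t \<le> scan_time + 3 \<and> shaped s' \<and>
    real_var s' ''u'' = utility {..<n} E C (part \<rho> ` \<rho> ` {..<n}))"
proof -
  let ?act = "''u'' ::=\<^sub>r RVar ''u'' \<oplus>\<^sub>r (RVar ''ns'' \<ominus>\<^sub>r RVar ''se'')"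
  let ?v = "\<lambda>(r, q). ns_value \<rho> r q - s_value \<rho> r q"
  let ?Acc = "\<lambda>es u (tp :: nat list). u = sum_list (map ?v es)"
  let ?s1 = "s\<lparr>real_var := (real_var s)(''u'' := 0)\<rparr>"
  have "performs ?act ?Acc \<rho>" by (simp add: performs_def)
  then have "wp I (scan_superedges ?act) ?s1 (\<lambda>t s'. t \<le> scan_time \<and> shaped s' \<and>
      (\<exists>es. ?Acc es (real_var s' ''u'') (tape s') \<and> distinct es \<and> set es = label_pairs \<rho>))"
    by (rule wp_scan_superedges) (use sh lab cs in \<open>simp_all add: shaped_def labelled_def\<close>)
  then have "wp I (scan_superedges ?act) ?s1 (\<lambda>t s'. t \<le> scan_time \<and> shaped s' \<and>
      real_var s' ''u'' = utility {..<n} E C (part \<rho> ` \<rho> ` {..<n}))"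
    by (rule wp_mono) (auto simp: utility_label_pairs sum_list_distinct_conv_sum_set)
  then show ?thesis unfolding compute_utility_def by simp
qed

section \<open>Partitions and utilities along the links\<close>

lemma collapse_less: "set ps \<subseteq> {..<n} \<times> {..<n} \<Longrightarrow> x < n \<Longrightarrow> collapse ps x < n"
  by (induction ps arbitrary: x) (auto simp: collapse_Cons)

text \<open>What building the forest leaves behind for search and output; neither of them writes to
  the buffer, the links or \<open>cs\<close>.\<close>

definition solved :: "(nat \<times> nat) list \<Rightarrow> store \<Rightarrow> bool" where
  "solved ps s \<longleftrightarrow> shaped s \<and> nat_var s ''cnt'' < n \<and>
    nat_var s ''cnt'' \<le> length (nat_arr s ''buf'') \<and>
    forest_list ps (take (nat_var s ''cnt'') (nat_arr s ''buf'')) \<and>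
    (\<forall>j<nat_var s ''cnt''. ps ! j = (nat_arr s ''child'' ! j, nat_arr s ''parent'' ! j)) \<and>
    real_var s ''cs'' = spurious_importance {..<n} E"

lemma stored_H_edge: "stored_H n s = map edge (take (nat_var s ''cnt'') (nat_arr s ''buf''))"
  by (simp add: stored_H_def edge_def)

definition labels :: "(nat \<times> nat) list \<Rightarrow> nat \<Rightarrow> nat \<Rightarrow> nat" where
  "labels ps t = collapse (take t ps)"

lemma solved_length: "solved ps s \<Longrightarrow> length ps = nat_var s ''cnt''"
  by (auto simp: solved_def forest_list_def)

lemma solved_labels_less: "solved ps s \<Longrightarrow> x < n \<Longrightarrow> labels ps t x < n"
  unfolding labels_def
  by (rule collapse_less) (use set_take_subset in \<open>fastforce simp: solved_def forest_list_def\<close>)+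

text \<open>P_t consists of the components of the first \<open>t\<close> edges, and by
  \<open>forest_list\<close> the first \<open>t\<close> links identify exactly the vertices linked
  by these edges.\<close>

lemma partition_at_labels:
  assumes s: "solved ps s" and t: "t \<le> nat_var s ''cnt''"
  shows "partition_at {..<n} (stored_H n s) t = part (labels ps t) ` labels ps t ` {..<n}"
proof -
  let ?A = "take (nat_var s ''cnt'') (nat_arr s ''buf'')"
  have fl: "forest_list ps ?A" and len: "length ?A = nat_var s ''cnt''" using s by (auto simp: solved_def)
  have "set (stored_H n s) \<subseteq> pairs {..<n}"
    using fl edges_pairs[of ?A] by (simp add: stored_H_edge forest_list_def)
  then have "partition_at {..<n} (stored_H n s) t = components {..<n} (set (take t (stored_H n s)))"
    by (rule partition_at_components)
  also have "set (take t (stored_H n s)) = edges (take t ?A)" by (simp add: stored_H_edge take_map)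
  also have "components {..<n} (edges (take t ?A)) = (\<lambda>x. part (labels ps t) (labels ps t x)) ` {..<n}"
    unfolding components_def
  proof (rule image_cong[OF refl])
    fix x assume x: "x \<in> {..<n}"
    have "(x, y) \<in> linked (edges (take t ?A)) \<longleftrightarrow> labels ps t x = labels ps t y" if "y < n" for y
      using fl x that t len unfolding forest_list_def labels_def by fastforce
    then show "{y \<in> {..<n}. (x, y) \<in> linked (edges (take t ?A))} = part (labels ps t) (labels ps t x)"
      by (auto simp: part_of_def)
  qed
  finally show ?thesis by (simp add: image_image)
qed

definition util :: "(nat \<times> nat) list \<Rightarrow> nat \<Rightarrow> real" where
  "util ps t = utility {..<n} E C (part (labels ps t) ` labels ps t ` {..<n})"

text \<open>Later links act on the roots found by earlier ones, so \<open>labels ps t'\<close>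
  factors through \<open>labels ps t\<close> and \<open>utility_antimono\<close> applies.\<close>

lemma util_antimono:
  assumes "t \<le> t'"
  shows "util ps t' \<le> util ps t"
  unfolding util_def
proof (rule utility_antimono[OF _ E_pairs])
  fix x y assume "labels ps t x = labels ps t y"
  moreover have "take t' ps = take t ps @ drop t (take t' ps)"
    using append_take_drop_id[of t "take t' ps"] assms by (simp add: min_def)
  ultimately show "labels ps t' x = labels ps t' y"
    unfolding labels_def by (metis collapse_append)
qed simp

lemma util_0: "util ps 0 = 1"
  unfolding util_def by (rule utility_singletons[OF _ E_pairs C_imp]) (auto simp: labels_def inj_on_def)

lemma wp_build_partition_solved:
  assumes s: "solved ps s" and t: "nat_var s x = t" "x \<noteq> ''x''" "x \<noteq> ''i''" "t \<le> nat_var s ''cnt''"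
  shows "wp I (build_partition x) s (\<lambda>t' s'. t' \<le> n * 40 + 20 \<and> labelled (labels ps t) s')"
proof (rule wp_mono[OF wp_build_partition[where ps = ps]])
  show "shaped s" "t \<le> n" "t \<le> length ps" using s t solved_length[OF s] by (auto simp: solved_def)
  show "set ps \<subseteq> {..<n} \<times> {..<n}" using s by (simp add: solved_def forest_list_def)
  show "ps ! j = (nat_arr s ''child'' ! j, nat_arr s ''parent'' ! j)" if "j < t" for j
    using s that t by (simp add: solved_def)
  fix t' and s' :: store
  assume "t' \<le> n * 40 + 20 \<and> (\<forall>z<n. nat_arr s' ''rep'' ! z = collapse (take t ps) z)"
  then show "t' \<le> n * 40 + 20 \<and> labelled (labels ps t) s'"
    using solved_labels_less[OF s] by (simp add: labelled_def labels_def)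
qed (use t in auto)

section \<open>Binary search\<close>

definition search_body :: com where
  "search_body = (''t'' ::= (Var ''low'' \<oplus> Var ''high'' \<oplus> Lit 1) \<oslash> Lit 2 ;;
      build_partition ''t'' ;;
      compute_utility ;;
      Cond (RLeq (RIn ''tau'' (Lit 0)) (RVar ''u''))
        (''low'' ::= Var ''t'')
        (''high'' ::= Var ''t'' \<ominus> Lit 1))"

lemma frame_solved:
  assumes "frame c s s'" "\<not> allocates c" "''cnt'' \<notin> nat_vars_of c" "''buf'' \<notin> nat_arrs_of c"
    "''child'' \<notin> nat_arrs_of c" "''parent'' \<notin> nat_arrs_of c" "''cs'' \<notin> real_vars_of c"
  shows "solved ps s' \<longleftrightarrow> solved ps s"
  using assms frame_shaped[OF assms(1,2)] unfolding solved_def by (simp add: frameD[OF assms(1)])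

lemma wp_search_body:
  assumes s: "solved ps s" and lh: "nat_var s ''low'' = low" "nat_var s ''high'' = high"
    "low < high" "high \<le> nat_var s ''cnt''"
  shows "wp I search_body s (\<lambda>t' s'. t' \<le> n * 40 + scan_time + 60 \<and>
    (let t = (low + high + 1) div 2 in
      if \<tau> \<le> util ps t then nat_var s' ''low'' = t \<and> nat_var s' ''high'' = high
      else nat_var s' ''low'' = low \<and> nat_var s' ''high'' = t - 1))"
proof -
  define t where "t = (low + high + 1) div 2"
  have t: "t \<le> high" using lh unfolding t_def by linarith
  let ?mid = "(Var ''low'' \<oplus> Var ''high'' \<oplus> Lit 1) \<oslash> Lit 2"
  let ?s1 = "s\<lparr>nat_var := (nat_var s)(''t'' := t)\<rparr>"
  let ?cond = "Cond (RLeq (RIn ''tau'' (Lit 0)) (RVar ''u''))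
        (''low'' ::= Var ''t'')
        (''high'' ::= Var ''t'' \<ominus> Lit 1)"
  let ?Q = "\<lambda>s'. if \<tau> \<le> util ps t then nat_var s' ''low'' = t \<and> nat_var s' ''high'' = high
      else nat_var s' ''low'' = low \<and> nat_var s' ''high'' = t - 1"
  have s1: "solved ps ?s1" using s by (simp add: solved_def)
  have "wp I (build_partition ''t'' ;; compute_utility ;; ?cond) ?s1
      (\<lambda>t' s'. t' \<le> n * 40 + scan_time + 40 \<and> ?Q s')"
    unfolding wp_Seq[of I "build_partition ''t''"]
  proof (rule wp_frame[OF wp_build_partition_solved[OF s1, where t = t]])
    fix t1 s2 assume 1: "t1 \<le> n * 40 + 20 \<and> labelled (labels ps t) s2" and fr: "frame (build_partition ''t'') ?s1 s2"
    have s2: "solved ps s2" using frame_solved[OF fr] s1 by (simp add: build_partition_def)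
    have same: "nat_var s2 ''t'' = t" "nat_var s2 ''low'' = low" "nat_var s2 ''high'' = high"
      using lh by (simp_all add: frameD[OF fr] build_partition_def)
    show "wp I (compute_utility ;; ?cond) s2 (\<lambda>t' s'. t1 + t' \<le> n * 40 + scan_time + 40 \<and> ?Q s')"
      unfolding wp_Seq[of I compute_utility]
    proof (rule wp_frame[OF wp_compute_utility])
      show "shaped s2" "labelled (labels ps t) s2" "real_var s2 ''cs'' = spurious_importance {..<n} E"
        using s2 1 by (auto simp: solved_def)
      fix t2 s3 assume 2: "t2 \<le> scan_time + 3 \<and> shaped s3 \<and> real_var s3 ''u'' =
          utility {..<n} E C (part (labels ps t) ` labels ps t ` {..<n})" and fr': "frame compute_utility s2 s3"
      have "nat_var s3 ''t'' = t" "nat_var s3 ''low'' = low" "nat_var s3 ''high'' = high"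
        using same by (simp_all add: frameD[OF fr'] compute_utility_def scan_superedges_def)
      moreover have "real_var s3 ''u'' = util ps t" using 2 by (simp add: util_def)
      ultimately show "wp I ?cond s3 (\<lambda>t' s'. t1 + (t2 + t') \<le> n * 40 + scan_time + 40 \<and> ?Q s')"
        using 1 2 by (simp add: tau_in)
    qed
  qed (use t lh in auto)
  then have "wp I (build_partition ''t'' ;; compute_utility ;; ?cond) ?s1
      (\<lambda>t' s'. 8 + t' \<le> n * 40 + scan_time + 60 \<and> ?Q s')"
    by (rule wp_mono) simp
  moreover have "nsafe I s ?mid" "nval I s ?mid = t" "1 + ncost ?mid = 8"
    using lh by (simp_all add: t_def)
  ultimately show ?thesis
    unfolding search_body_def Let_def t_def[symmetric]
    by (simp only: wp_Seq[of I "''t'' ::= ?mid"] wp_Assign simp_thms)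
qed

definition search_time :: nat where
  "search_time = lg * (n * 40 + scan_time + 70) + 20"

lemma wp_search:
  assumes s: "solved ps s" and tau: "\<tau> \<le> 1"
  shows "wp I search s (\<lambda>t' s'. t' \<le> search_time \<and>
    nat_var s' ''low'' = t_star {..<n} E C (stored_H n s) \<tau> \<and> nat_var s' ''low'' \<le> nat_var s ''cnt'')"
proof -
  let ?cnt = "nat_var s ''cnt''"
  let ?b = "NLess (Var ''low'') (Var ''high'')"
  let ?s1 = "s\<lparr>nat_var := (nat_var s)(''low'' := 0, ''high'' := ?cnt)\<rparr>"
  let ?R = "n * 40 + scan_time + 70"
  \<comment> \<open>The utility reaches \<tau> at \<open>low\<close> and stays below it beyond
    \<open>high\<close>; the positions in between are open.\<close>
  let ?ok = "\<lambda>s'. nat_var s' ''low'' \<le> nat_var s' ''high'' \<and> nat_var s' ''high'' \<le> ?cnt \<and>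
      \<tau> \<le> util ps (nat_var s' ''low'') \<and> (\<forall>t. nat_var s' ''high'' < t \<longrightarrow> t \<le> ?cnt \<longrightarrow> util ps t < \<tau>)"
  define Inv where "Inv k s' \<longleftrightarrow> ?ok s' \<and> (\<exists>m. nat_var s' ''high'' - nat_var s' ''low'' < 2 ^ m \<and> k = m * ?R + 4)"
    for k and s' :: store
  let ?Q = "\<lambda>s'. nat_var s' ''low'' \<le> ?cnt \<and> \<tau> \<le> util ps (nat_var s' ''low'') \<and>
      (\<forall>t. nat_var s' ''low'' < t \<longrightarrow> t \<le> ?cnt \<longrightarrow> util ps t < \<tau>)"
  have loop: "wp I (While ?b search_body) ?s1 (\<lambda>t s'. t \<le> lg * ?R + 4 \<and> ?Q s' \<and> frame search_body ?s1 s')"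
  proof (rule wp_While[where Inv = Inv])
    \<comment> \<open>\<open>cnt < n\<close> and \<open>n \<le> 2 ^ lg\<close> make
      \<open>lg\<close> halvings enough; that \<open>low = 0\<close> qualifies is where \<tau> \<le>
      1 enters.\<close>
    have "?cnt < 2 ^ lg" using s n_le_lg by (simp add: solved_def)
    then show "Inv (lg * ?R + 4) ?s1" using tau by (auto simp: Inv_def util_0)
    fix k s' assume inv: "Inv k s'" and fr: "frame search_body ?s1 s'"
    show "bsafe I s' ?b" by simp
    show "1 + bcost ?b \<le> k \<and> ?Q s'" if "\<not> bval I s' ?b"
      using inv that by (auto simp: Inv_def)
    show "wp I search_body s' (\<lambda>t s''. \<exists>k'. Inv k' s'' \<and> 1 + bcost ?b + t + k' \<le> k)" if less: "bval I s' ?b"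
    proof -
      let ?low = "nat_var s' ''low''" and ?high = "nat_var s' ''high''"
      have lh: "?low < ?high" using less by simp
      obtain m where m: "?high - ?low < 2 ^ m" "k = m * ?R + 4" and ok: "?ok s'"
        using inv by (auto simp: Inv_def)
      obtain m' where m': "m = Suc m'" using m lh by (cases m) auto
      have "solved ps ?s1" using s by (simp add: solved_def)
      then have s': "solved ps s'"
        using frame_solved[OF fr]
        by (simp add: search_body_def build_partition_def compute_utility_def scan_superedges_def)
      have cnt: "nat_var s' ''cnt'' = ?cnt" using solved_length[OF s] solved_length[OF s'] by simp
      show ?thesis
      proof (rule wp_mono[OF wp_search_body[OF s' refl refl lh]])
        show "?high \<le> nat_var s' ''cnt''" using ok cnt by simp
        fix t' and s'' :: store assume *: "t' \<le> n * 40 + scan_time + 60 \<and>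
          (let t = (?low + ?high + 1) div 2 in
            if \<tau> \<le> util ps t then nat_var s'' ''low'' = t \<and> nat_var s'' ''high'' = ?high
            else nat_var s'' ''low'' = ?low \<and> nat_var s'' ''high'' = t - 1)"
        define t where "t = (?low + ?high + 1) div 2"
        note step = *[unfolded Let_def, folded t_def]
        \<comment> \<open>Rounding the midpoint up gives \<open>low < t\<close>, so that moving
          \<open>low\<close> to \<open>t\<close> is progress, and both remaining intervals are
          shorter than \<open>2 ^ m'\<close>.\<close>
        have t: "?low < t" "t \<le> ?high" "?high - t < 2 ^ m'" "t - 1 - ?low < 2 ^ m'"
          using lh m(1) unfolding t_def m' by auto
        have "?ok s'' \<and> nat_var s'' ''high'' - nat_var s'' ''low'' < 2 ^ m'"
        proof (cases "\<tau> \<le> util ps t")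
          case True
          then show ?thesis using step t ok by simp
        next
          case False
          have "util ps t'' < \<tau>" if "t - 1 < t''" for t''
          proof -
            have "t \<le> t''" using that t(1) by linarith
            then show ?thesis using util_antimono[of t t'' ps] False by simp
          qed
          moreover have "?low \<le> t - 1" "t - 1 \<le> ?cnt" using t ok by linarith+
          ultimately show ?thesis using step t ok False by simp
        qed
        then have "Inv (m' * ?R + 4) s''" unfolding Inv_def by blast
        then show "\<exists>k'. Inv k' s'' \<and> 1 + bcost ?b + t' + k' \<le> k"
          by (intro exI[of _ "m' * ?R + 4"] conjI) (use * m m' in simp_all)
      qed
    qed
  qed
  have star: "l = t_star {..<n} E C (stored_H n s) \<tau>"
    if l: "l \<le> ?cnt" "\<tau> \<le> util ps l" "\<forall>t. l < t \<longrightarrow> t \<le> ?cnt \<longrightarrow> util ps t < \<tau>" for l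
  proof -
    have lenH: "length (stored_H n s) = ?cnt" using s by (simp add: stored_H_edge solved_def)
    have "{t \<in> {0..?cnt}. \<tau> \<le> utility {..<n} E C (partition_at {..<n} (stored_H n s) t)} = {t \<in> {0..?cnt}. \<tau> \<le> util ps t}"
      using partition_at_labels[OF s] by (auto simp: util_def)
    moreover have "Max {t \<in> {0..?cnt}. \<tau> \<le> util ps t} = l"
    proof (rule Max_eqI)
      show "t \<le> l" if "t \<in> {t \<in> {0..?cnt}. \<tau> \<le> util ps t}" for t
        using l(3) that by (force simp: not_le[symmetric])
    qed (use l in auto)
    ultimately show ?thesis by (simp add: t_star_def lenH)
  qed
  have "wp I (While ?b search_body) ?s1 (\<lambda>t' s'. t' \<le> lg * ?R + 4 \<and>
    nat_var s' ''low'' = t_star {..<n} E C (stored_H n s) \<tau> \<and> nat_var s' ''low'' \<le> ?cnt)"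
    using loop by (rule wp_mono) (use star in blast)
  then show ?thesis
    unfolding search_def search_body_def[symmetric] search_time_def
    by simp (erule wp_mono, simp)
qed

section \<open>Output of the summary\<close>

lemma wp_emit_labels:
  assumes lab: "labelled \<rho> s" and sh: "shaped s"
  shows "wp I (For ''x'' (Lit 0) N (Emit (Arr ''rep'' (Var ''x'')))) s
    (\<lambda>t s'. t \<le> n * 12 + 7 \<and> tape s' = tape s @ map \<rho> [0..<n])"
proof (rule wp_mono)
  let ?c = "Emit (Arr ''rep'' (Var ''x''))"
  let ?F = "For ''x'' (Lit 0) N ?c"
  show "wp I ?F s (\<lambda>t s'. t \<le> (n - 0) * (3 + 7 + ncost N) + 4 + ncost (Lit 0) + ncost N \<and>
      nat_var s' ''x'' = n \<and> frame ?F s s' \<and> tape s' = tape s @ map \<rho> [0..<n])"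
  proof (rule wp_For[where Inv = "\<lambda>x s'. tape s' = tape s @ map \<rho> [0..<x]"])
    fix x s' assume x: "x < n" "nat_var s' ''x'' = x" and inv: "tape s' = tape s @ map \<rho> [0..<x]"
      and fr: "frame ?F s s'"
    have "nat_arr s' ''rep'' ! x = \<rho> x" "length (nat_arr s' ''rep'') = n"
      using lab sh x by (simp_all add: frameD[OF fr] labelled_def shaped_def)
    then show "wp I ?c s' (\<lambda>t s''. t \<le> 3 \<and> nat_var s'' ''x'' = x \<and>
        tape (s''\<lparr>nat_var := (nat_var s'')(''x'' := Suc x)\<rparr>) = tape s @ map \<rho> [0..<Suc x])"
      using x inv by simp
  qed (auto simp: n_in)
qed auto

definition output_time :: nat where
  "output_time = n * 52 + 27 + scan_time"

lemma wp_output_summary: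
  assumes s: "solved ps s" and t: "nat_var s ''low'' = t" "t \<le> nat_var s ''cnt''" and tp: "tape s = []"
  shows "wp I (output_summary ''low'') s (\<lambda>t' s'. t' \<le> output_time \<and>
    encodes_summary n (tape s') (summary_at {..<n} E C (stored_H n s) t))"
proof -
  define \<rho> where "\<rho> = labels ps t"
  let ?emit = "For ''x'' (Lit 0) N (Emit (Arr ''rep'' (Var ''x'')))"
  let ?act = "Emit (Var ''r'') ;; Emit (Var ''q'')"
  let ?flat = "\<lambda>es :: (nat \<times> nat) list. concat (map (\<lambda>(r, q). [r, q]) es)"
  let ?Acc = "\<lambda>es (u :: real) tp. tp = map \<rho> [0..<n] @ ?flat es"
  have act: "performs ?act ?Acc \<rho>" by (simp add: performs_def)
  have enc: "encodes_summary n (map \<rho> [0..<n] @ ?flat es) (summary_at {..<n} E C (stored_H n s) t)"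
    if es: "distinct es" "set es = label_pairs \<rho>" for es
  proof -
    have P: "partition_at {..<n} (stored_H n s) t = part \<rho> ` \<rho> ` {..<n}"
      unfolding \<rho>_def by (rule partition_at_labels[OF s t(2)])

    have "superedges {..<n} E C (part \<rho> ` \<rho> ` {..<n}) = (`) (part \<rho>) ` (\<lambda>(r, q). {r, q}) ` set es"
      using superedges_labels[OF _ E_pairs, of C \<rho>] es label_pairs_bij(2)[of \<rho>] by simp
    also have "\<dots> = (\<lambda>(r, q). {part \<rho> r, part \<rho> q}) ` set es" by (auto simp: image_image)
    finally have S: "superedges {..<n} E C (part \<rho> ` \<rho> ` {..<n}) = (\<lambda>(r, q). {part \<rho> r, part \<rho> q}) ` set es" .
    have "distinct (map (\<lambda>(r, q). {r, q}) es)"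
      using es label_pairs_bij(1)[of \<rho>] by (simp add: distinct_map)
    then show ?thesis
      unfolding encodes_summary_def summary_at_def Let_def P S
      by (intro exI[of _ \<rho>] exI[of _ es]) (simp add: part_of_def)
  qed
  show ?thesis
    unfolding output_summary_def wp_Seq[of I "build_partition ''low''"]
  proof (rule wp_frame[OF wp_build_partition_solved[OF s t(1)]])
    fix t1 s1 assume 1: "t1 \<le> n * 40 + 20 \<and> labelled (labels ps t) s1" and fr: "frame (build_partition ''low'') s s1"
    have s1: "solved ps s1" using frame_solved[OF fr] s by (simp add: build_partition_def)
    have tp1: "tape s1 = []" using tp by (simp add: frameD[OF fr] build_partition_def)
    have lab: "labelled \<rho> s1" and sh: "shaped s1" using 1 s1 by (auto simp: \<rho>_def solved_def)
    show "wp I (?emit ;; scan_superedges ?act) s1 (\<lambda>t' s'. t1 + t' \<le> output_time \<and>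
        encodes_summary n (tape s') (summary_at {..<n} E C (stored_H n s) t))"
      unfolding wp_Seq[of I ?emit]
    proof (rule wp_frame[OF wp_emit_labels[OF lab sh]])
      fix t2 s2 assume 2: "t2 \<le> n * 12 + 7 \<and> tape s2 = tape s1 @ map \<rho> [0..<n]" and fr': "frame ?emit s1 s2"
      have s2: "solved ps s2" using frame_solved[OF fr'] s1 by simp
      have lab2: "labelled \<rho> s2" using lab by (simp add: labelled_def frameD[OF fr'])
      show "wp I (scan_superedges ?act) s2 (\<lambda>t' s'. t1 + (t2 + t') \<le> output_time \<and>
          encodes_summary n (tape s') (summary_at {..<n} E C (stored_H n s) t))"
      proof (rule wp_mono[OF wp_scan_superedges[OF act _ lab2]])
        show "shaped s2" "real_var s2 ''cs'' = spurious_importance {..<n} E" using s2 by (auto simp: solved_def)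
        show "tape s2 = map \<rho> [0..<n] @ ?flat []" using 2 tp1 by simp
        fix t3 s3 assume "t3 \<le> scan_time \<and> shaped s3 \<and>
          (\<exists>es. tape s3 = map \<rho> [0..<n] @ ?flat es \<and> distinct es \<and> set es = label_pairs \<rho>)"
        then show "t1 + (t2 + t3) \<le> output_time \<and>
            encodes_summary n (tape s3) (summary_at {..<n} E C (stored_H n s) t)"
          using 1 2 enc by (auto simp: output_time_def)
      qed
    qed
  qed (use t in auto)
qed

end

section \<open>The whole program\<close>

context encoded
begin

text \<open>Handshake: every edge appears in the adjacency lists of both its ends.\<close>

lemma off_n: "off n = 2 * card E"
proof -
  have *: "off m = (\<Sum>x<m. length (ns x))" for m by (induction m) (simp_all add: off_Suc)
  have "off n = (\<Sum>x<n. card {y. {x, y} \<in> E})"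
    unfolding * by (intro sum.cong refl) (use ns distinct_card in \<open>metis lessThan_iff\<close>)
  also have "\<dots> = card (SIGMA x:{..<n}. {y. {x, y} \<in> E})"
    by (rule card_SigmaI[symmetric]) (use edge_less in \<open>auto intro: finite_subset[of _ "{..<n}"]\<close>)
  also have "(SIGMA x:{..<n}. {y. {x, y} \<in> E}) = {(x, y) \<in> {..<n} \<times> {..<n}. {x, y} \<in> E}"
    using edge_less by auto
  also have "card \<dots> = 2 * card E"
  proof -
    have "pairs_between {..<n} {..<n} = pairs {..<n}" by (simp add: pairs_between_def pairs_def)
    then have "pairs_between {..<n} {..<n} \<inter> E = E" using E_pairs by blast
    then have "real (card {(x, y) \<in> {..<n} \<times> {..<n}. {x, y} \<in> E}) = real (2 * card E)"
      using sum_arcs_within[OF _ E_pairs, of "{..<n}" "\<lambda>_. 1"] by (simp add: case_prod_unfold)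
    then show ?thesis by linarith
  qed
  finally show ?thesis .
qed

text \<open>\<open>d\<close> is twice the number of non-adjacent pairs, so \<open>2 / d\<close> is
  the spurious importance, and the program's 0 for \<open>d = 0\<close> agrees with the convention
  on division by zero.\<close>

lemma spurious_importance_d:
  defines "d \<equiv> n * (n - 1) - off n"
  shows "spurious_importance {..<n} E = (if d = 0 then 0 else 2 / real d)"
proof -
  have le: "card E \<le> n choose 2" using card_mono[OF finite_pairs E_pairs] card_pairs[of "{..<n}"] by simp
  have "2 * (n choose 2) = n * (n - 1)"
    using card_pairs_within[of "{..<n}"] card_pairs[of "{..<n}"] by (simp add: pairs_between_def pairs_def)
  then have "d = 2 * (n choose 2) - 2 * card E" by (simp only: d_def off_n)
  then have "d = 2 * ((n choose 2) - card E)" by (simp only: diff_mult_distrib2)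
  then have d: "real d = 2 * (real (n choose 2) - real (card E))" using le by (simp add: of_nat_diff)
  have halve: "1 / y = 2 / (2 * y)" for y :: real by simp
  have "spurious_importance {..<n} E = 2 / real d"
    unfolding spurious_importance_def d card_lessThan by (rule halve)
  then show ?thesis by simp
qed

text \<open>Generalizing over the store after each allocation keeps the store terms from growing.\<close>

lemma wp_Alloc_Seq:
  assumes "nsafe I s e"
    and "\<And>s'. nat_arr s' = (nat_arr s)(a := replicate (nval I s e) 0) \<Longrightarrow> real_arr s' = real_arr s \<Longrightarrow>
      tape s' = tape s \<Longrightarrow> allocated s' = allocated s + nval I s e \<Longrightarrow>
      wp I c s' (\<lambda>t. Q (1 + ncost e + nval I s e + t))"
  shows "wp I (Alloc a e ;; c) s Q"
  unfolding wp_Seq wp_Alloc using assms by (intro conjI) (assumption, simp)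

lemma wp_RAlloc_Seq:
  assumes "nsafe I s e"
    and "\<And>s'. real_arr s' = (real_arr s)(a := replicate (nval I s e) 0) \<Longrightarrow> nat_arr s' = nat_arr s \<Longrightarrow>
      tape s' = tape s \<Longrightarrow> allocated s' = allocated s + nval I s e \<Longrightarrow>
      wp I c s' (\<lambda>t. Q (1 + ncost e + nval I s e + t))"
  shows "wp I (RAlloc a e ;; c) s Q"
  unfolding wp_Seq wp_RAlloc using assms by (intro conjI) (assumption, simp)

text \<open>The factor 15 counts the arrays: two of length \<open>2 * n\<close> and eleven of length
  \<open>n\<close>.\<close>

lemma wp_prepare:
  "wp I prepare initial (\<lambda>t s. t \<le> n * 15 + 80 \<and> shaped s \<and> allocated s = n * 15 \<and> tape s = [] \<and>
    real_var s ''cs'' = spurious_importance {..<n} E)"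
proof -
  have "real n * (real n - 1) = real (n * (n - 1))" using n_pos by (simp add: of_nat_diff)
  then have ne: "real n * (real n - 1) \<noteq> real (off n)" if "\<not> n * (n - Suc 0) \<le> off n"
    using that by (simp only: of_nat_eq_iff One_nat_def)
  have rest: "wp I (''d'' ::= N \<otimes> (N \<ominus> Lit 1) \<ominus> In ''off'' N ;;
      Cond (NEq (Var ''d'') (Lit 0))
        (''cs'' ::=\<^sub>r OfNat (Lit 0))
        (''cs'' ::=\<^sub>r OfNat (Lit 2) \<oslash>\<^sub>r OfNat (Var ''d''))) s
      (\<lambda>t s'. t \<le> 30 \<and> shaped s' \<and> allocated s' = allocated s \<and> tape s' = tape s \<and>
        real_var s' ''cs'' = spurious_importance {..<n} E)" if "shaped s" for s
    using that ne by (simp add: n_in off_nth off_length shaped_def spurious_importance_d)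
  show ?thesis
    unfolding prepare_def
    apply (rule wp_Alloc_Seq, simp add: n_in)+
    apply (rule wp_RAlloc_Seq, simp add: n_in)
    apply (rule wp_mono[OF rest])
     apply (simp add: shaped_def n_in)
    apply (simp add: initial_def n_in)
    done
qed

section \<open>Total running time and its asymptotic bound\<close>

definition total_time :: nat where
  "total_time = (n * 15 + 80) + (off n * (credit + 70) + n * 60 + 20 + kruskal_time) + search_time + output_time"

lemma wp_t_buds:
  assumes tau: "\<tau> \<le> 1"
  shows "wp I t_buds initial (\<lambda>t s. t \<le> total_time \<and> allocated s = n * 15 \<and> sorted_msf E cen (stored_H n s) \<and>
    encodes_summary n (tape s) (summary_at {..<n} E C (stored_H n s) (t_star {..<n} E C (stored_H n s) \<tau>)))"
  unfolding t_buds_def wp_Seq[of I prepare]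
proof (rule wp_mono[OF wp_prepare])
  fix t1 s1 assume 1: "t1 \<le> n * 15 + 80 \<and> shaped s1 \<and> allocated s1 = n * 15 \<and> tape s1 = [] \<and>
    real_var s1 ''cs'' = spurious_importance {..<n} E"
  show "wp I (build_H ;; search ;; output_summary ''low'') s1 (\<lambda>t s. t1 + t \<le> total_time \<and> allocated s = n * 15 \<and>
      sorted_msf E cen (stored_H n s) \<and>
      encodes_summary n (tape s) (summary_at {..<n} E C (stored_H n s) (t_star {..<n} E C (stored_H n s) \<tau>)))"
    unfolding wp_Seq[of I build_H]
  proof (rule wp_frame[OF wp_build_H])
    show "shaped s1" using 1 by simp
    fix t2 s2 assume 2: "t2 \<le> off n * (credit + 70) + n * 60 + 20 + kruskal_time \<and> shaped s2 \<and>
      (\<exists>X. candidates X (two_hop E) \<and>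
        reduced_store X s2)"
      and fr: "frame build_H s1 s2"
    have eff: "\<not> emits build_H" "\<not> allocates build_H" "''cs'' \<notin> real_vars_of build_H"
      by (simp_all add: build_H_def kruskal_effects)
    have same2: "tape s2 = []" "allocated s2 = n * 15" "real_var s2 ''cs'' = spurious_importance {..<n} E"
      using 1 frameD(2,5,6)[OF fr] eff by simp_all
    obtain X where X: "candidates X (two_hop E)"
      "reduced_store X s2"
      using 2 by blast
    obtain ps where "forest_list ps (take (nat_var s2 ''cnt'') (nat_arr s2 ''buf''))"
      "\<forall>j<nat_var s2 ''cnt''. ps ! j = (nat_arr s2 ''child'' ! j, nat_arr s2 ''parent'' ! j)"
      using X(2) unfolding reduced_def by blast
    then have s2: "solved ps s2" using X(2) 2 same2 by (simp add: solved_def reduced_def)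
    have msf: "sorted_msf E cen (stored_H n s2)"
      unfolding stored_H_edge by (rule sorted_msf_reduced[OF X])
    show "wp I (search ;; output_summary ''low'') s2 (\<lambda>t s. t1 + (t2 + t) \<le> total_time \<and> allocated s = n * 15 \<and>
        sorted_msf E cen (stored_H n s) \<and>
        encodes_summary n (tape s) (summary_at {..<n} E C (stored_H n s) (t_star {..<n} E C (stored_H n s) \<tau>)))"
      unfolding wp_Seq[of I search]
    proof (rule wp_frame[OF wp_search[OF s2 tau]])
      fix t3 s3 assume 3: "t3 \<le> search_time \<and> nat_var s3 ''low'' = t_star {..<n} E C (stored_H n s2) \<tau> \<and>
          nat_var s3 ''low'' \<le> nat_var s2 ''cnt''" and fr3: "frame search s2 s3"
      note effs = search_def build_partition_def compute_utility_def scan_superedges_def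
      have s3: "solved ps s3" using frame_solved[OF fr3] s2 by (simp add: effs)
      have same3: "tape s3 = []" "allocated s3 = n * 15" "nat_var s3 ''cnt'' = nat_var s2 ''cnt''"
        "stored_H n s3 = stored_H n s2"
        using same2 by (simp_all add: frameD[OF fr3] effs stored_H_edge)
      show "wp I (output_summary ''low'') s3 (\<lambda>t s. t1 + (t2 + (t3 + t)) \<le> total_time \<and> allocated s = n * 15 \<and>
        sorted_msf E cen (stored_H n s) \<and>
        encodes_summary n (tape s) (summary_at {..<n} E C (stored_H n s) (t_star {..<n} E C (stored_H n s) \<tau>)))"
      proof (rule wp_frame[OF wp_output_summary[OF s3 refl _ same3(1)]])
        show "nat_var s3 ''low'' \<le> nat_var s3 ''cnt''" using 3 same3 by simp
        fix t4 s4 assume 4: "t4 \<le> output_time \<and>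
            encodes_summary n (tape s4) (summary_at {..<n} E C (stored_H n s3) (nat_var s3 ''low''))"
          and fr4: "frame (output_summary ''low'') s3 s4"
        have "allocated s4 = n * 15" "stored_H n s4 = stored_H n s2"
          using same3 by (simp_all add: frameD[OF fr4] effs output_summary_def stored_H_edge)
        then show "t1 + (t2 + (t3 + t4)) \<le> total_time \<and> allocated s4 = n * 15 \<and>
            sorted_msf E cen (stored_H n s4) \<and>
            encodes_summary n (tape s4) (summary_at {..<n} E C (stored_H n s4) (t_star {..<n} E C (stored_H n s4) \<tau>))"
          using 1 2 3 4 same3 msf by (simp add: total_time_def)
      qed
    qed
  qed
qed

text \<open>Importances summing to 1 force an edge. From two vertices on, \<open>log 2 n\<close> is
  at least 1, so the final bound can absorb additive constants.\<close>

lemma n_ge_2: "2 \<le> n"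
proof -
  have "E \<noteq> {}" using C_imp by (auto simp: importances_def)
  then obtain e where "e \<in> E" by blast
  then have "e \<in> pairs {..<n}" using E_pairs by blast
  then obtain u v where "u < n" "v < n" "u \<noteq> v" by (auto elim: pairsE)
  then show ?thesis by linarith
qed

text \<open>Minimality of \<open>lg\<close> gives \<open>2 ^ (lg - 1) < n\<close>; the remaining 1
  from rounding up is at most \<open>log 2 n\<close> as \<open>n \<ge> 2\<close>.\<close>

lemma lg_log: "1 \<le> lg" "real lg \<le> 2 * log 2 (real n)"
proof -
  show "1 \<le> lg" using n_le_lg n_ge_2 by (cases lg) auto
  have log1: "1 \<le> log 2 (real n)" using n_ge_2 by simp
  obtain k where k: "lg = Suc k" using \<open>1 \<le> lg\<close> by (cases lg) auto
  then have "\<not> n \<le> 2 ^ k" using not_less_Least[of k "\<lambda>k. n \<le> 2 ^ k"] unfolding lg_def by simp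
  then have "(2::real) ^ k < real n" by (metis not_le of_nat_less_iff of_nat_numeral of_nat_power)
  then have "real k \<le> log 2 (real n)" using n_pos by (simp add: le_log_iff powr_realpow)
  then show "real lg \<le> 2 * log 2 (real n)" using log1 k by simp
qed

lemma total_time_bound:
  "real total_time \<le> 100000 * (real (card (two_hop E)) + real n) * log 2 (real n)"
proof -
  define W where "W = card (two_hop E) + n"
  define Z where "Z = W * lg"
  \<comment> \<open>\<open>off n\<close> is \<open>2 * card E\<close>, and |E| \<le> 2 |F| +
    n.\<close>
  have offW: "off n \<le> 4 * W"
    using card_edges_le_two_hop[OF _ E_pairs] by (simp add: off_n W_def)
  have nW: "n \<le> W" by (simp add: W_def)
  have W1: "1 \<le> W" using n_pos nW by linarith
  have lgZ: "lg \<le> Z" and WZ: "W \<le> Z" using W1 lg_log(1) by (simp_all add: Z_def)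
  have nZ: "n * lg \<le> Z" unfolding Z_def using nW by (rule mult_right_mono) simp
  have oZ: "off n * lg \<le> 4 * Z" unfolding Z_def using mult_right_mono[OF offW, of lg] by (simp add: mult.assoc)
  \<comment> \<open>Every summand is a multiple of \<open>n * lg\<close>, \<open>off n * lg\<close>,
    \<open>n\<close>, \<open>off n\<close>, \<open>lg\<close> or 1, each of which is at most
    \<open>4 * Z\<close>. The factor 2 between \<open>lg\<close> and \<open>log\<close> then turns
    50000 into 100000.\<close>
  have "total_time = n * 15 + 80 + (off n * lg * 2000 + off n * 2070 + n * 60 + 20 + (n * lg * 2000 + n * 2000)) +
      (n * lg * 142 + off n * lg * 161 + lg * 91 + 20) + (n * 154 + off n * 161 + 48)"
    by (simp add: total_time_def credit_def kruskal_time_def search_time_def output_time_def scan_time_def algebra_simps)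
  also have "\<dots> \<le> 50000 * Z" using offW nW W1 lgZ WZ nZ oZ by linarith
  finally have "real total_time \<le> 50000 * (real W * real lg)" unfolding Z_def by (metis of_nat_le_iff of_nat_mult of_nat_numeral)
  also have "\<dots> \<le> 50000 * (real W * (2 * log 2 (real n)))"
    using lg_log(2) by (intro mult_left_mono) auto
  finally show ?thesis by (simp add: W_def algebra_simps)
qed

end

theorem theorem4p3:
  shows "\<exists>K > 0. \<forall>(n :: nat) (V :: nat set) (E :: nat set set) (cen :: nat \<Rightarrow> real)
      (C :: nat set \<Rightarrow> real) (\<tau> :: real) (I :: input).
    V = {..<n} \<and> simple_graph V E \<and> importances E C \<and> \<tau> \<le> 1 \<and> encodes_input I n E cen C \<tau> \<longrightarrow>
    (\<exists>(t :: nat) (s :: store) (H :: nat set list).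
       exec I t_buds initial t s \<and>
       stored_H n s = H \<and> sorted_msf E cen H \<and>
       encodes_summary n (tape s) (summary_at V E C H (t_star V E C H \<tau>)) \<and>
       real t \<le> K * (real (card (two_hop E)) + real (card V)) * log 2 (real (card V)) \<and>
       real (space t_buds s) \<le> K * real (card V))"
\<comment> \<open>One constant for both bounds, fixed before the input: the number of scalars is
  determined by the program text, and 100000 is the constant of
  \<open>total_time_bound\<close>.\<close>
proof (intro exI[of _ "100000 + 2 * real (card (scalars t_buds))"] conjI allI impI)
  let ?K = "100000 + 2 * real (card (scalars t_buds))"
  show "0 < ?K" by simp
  fix n V E cen C \<tau> I
  assume asm: "V = {..<n} \<and> simple_graph V E \<and> importances E C \<and> \<tau> \<le> 1 \<and> encodes_input I n E cen C \<tau>"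
  then have E: "E \<subseteq> pairs {..<n}" using simple_graph_pairs by blast
  have npos: "0 < n"
  proof (rule ccontr)
    assume "\<not> 0 < n"
    then have "E = {}" using E by (auto simp: pairs_def)
    then show False using asm by (simp add: importances_def)
  qed
  obtain ns where "encoded I n E cen C \<tau> ns"
    using asm E npos unfolding encodes_input_def encoded_def by blast
  then interpret encoded I n E cen C \<tau> ns .
  obtain t s where ts: "exec I t_buds initial t s" "t \<le> total_time" "allocated s = n * 15"
    "sorted_msf E cen (stored_H n s)"
    "encodes_summary n (tape s) (summary_at {..<n} E C (stored_H n s) (t_star {..<n} E C (stored_H n s) \<tau>))"
    using wp_t_buds asm unfolding wp_def by blast
  have "real t \<le> 100000 * (real (card (two_hop E)) + real n) * log 2 (real n)"
    using ts(2) total_time_bound by linarith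
  also have "\<dots> \<le> ?K * (real (card (two_hop E)) + real n) * log 2 (real n)"
    using n_ge_2 by (intro mult_right_mono) auto
  finally have time: "real t \<le> ?K * (real (card (two_hop E)) + real (card V)) * log 2 (real (card V))"
    using asm by simp
  have "real (space t_buds s) = 2 * real (card (scalars t_buds)) + 15 * real n"
    using ts(3) by (simp add: space_def)
  \<comment> \<open>As \<open>n \<ge> 1\<close>, the fixed number of scalar words is at most that
    number times \<open>n\<close>; the 15 array words per vertex go into 100000.\<close>
  also have "\<dots> \<le> 2 * real (card (scalars t_buds)) * real n + 100000 * real n"
    using npos by (intro add_mono mult_right_mono) (simp_all add: mult_le_cancel_left1)
  finally have "real (space t_buds s) \<le> ?K * real (card V)" using asm by (simp add: algebra_simps)
  then show "\<exists>t s H. exec I t_buds initial t s \<and> stored_H n s = H \<and> sorted_msf E cen H \<and>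
       encodes_summary n (tape s) (summary_at V E C H (t_star V E C H \<tau>)) \<and>
       real t \<le> ?K * (real (card (two_hop E)) + real (card V)) * log 2 (real (card V)) \<and>
       real (space t_buds s) \<le> ?K * real (card V)"
    using ts time asm by blast
qed

end
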